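(* Let $k\ge 2$ be an integer and let $F=F_k\subset\mathbb{Z}\subset\mathbb{R}$ be the set of $k$th-power-free integers. Then the diffraction spectrum $\hat\gamma$ of $F$ (the Fourier transform of the natural autocorrelation $\gamma$ of $F$) exists and is a pure point measure. It is supported (i.e. concentrated) on the set of rational numbers $a/q$ (in lowest terms, $q\ge 1$) whose denominator $q$ is $(k+1)$th-power-free. The diffraction intensity at a point with such a denominator $q$ is $$\hat\gamma(\{a/q\})=\frac{1}{\zeta(k)^2}\prod_{p\mid q}\frac{1}{(p^k-1)^2},$$ the product being over primes $p$ dividing $q$. This measure can also be represented as $$\xi(k)\sum_{\substack{d\ge 1\\ d\text{ squarefree}}}\Bigl(\prod_{p\mid d}\frac{1}{p^{2k}-2p^k}\Bigr)\,\omega_{\mathbb{Z}/d^k},$$ a weak*-convergent sum of Dirac combs.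
   Context: For an integer $r\ge 1$, an integer is $r$th-power-free if it is not divisible by $d^r$ for any integer $d>1$; $F_k=\{m\in\mathbb{Z}\mid m\text{ is }k\text{th-power-free}\}$. Here $\mathbb{Z}/d^k=\{m/d^k\mid m\in\mathbb{Z}\}\subset\mathbb{R}$. For a uniformly discrete $S\subset\mathbb{R}$, its Dirac comb is the tempered distribution $\omega_S=\sum_{x\in S}\delta_x$, and its natural autocorrelation is $$\gamma=\lim_{R\to\infty}\frac{1}{2R}\sum_{x,y\in S,\ |x|,|y|<R}\delta_{x-y},$$ the limit taken in the weak*-topology on the space of tempered distributions (if it exists). The diffraction spectrum of $S$ is the Fourier transform $\hat\gamma$, defined by $(\hat\gamma,\psi)=(\gamma,\hat\psi)$ for Schwartz functions $\psi$, with $\hat\psi(y)=\int_{\mathbb{R}}e^{-2\pi i yx}\psi(x)\,dx$; when it exists it is a positive tempered measure. A measure is pure point if it is the sum of its atoms, and the intensity at $x$ is $\hat\gamma(\{x\})$. $\zeta$ is the Riemann zeta function, and $\xi(s)=\prod_p\bigl(1-\frac{2}{p^s}\bigr)$ for $\mathrm{Re}(s)>1$, the product over all primes. Empty products equal $1$, and $1$ is squarefree. *)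

theory Defs
  imports "HOL-Analysis.Analysis" "HOL-Computational_Algebra.Squarefree"
begin

subsection \<open>Schwartz functions and tempered distributions on the real line\<close>

definition iter_deriv :: "nat \<Rightarrow> (real \<Rightarrow> complex) \<Rightarrow> real \<Rightarrow> complex" where
  "iter_deriv n f = ((\<lambda>g x. vector_derivative g (at x)) ^^ n) f"

definition Schwartz :: "(real \<Rightarrow> complex) set" where
  "Schwartz = {f.
     (\<forall>n x. iter_deriv n f differentiable (at x)) \<and>
     (\<forall>m n. bounded (range (\<lambda>x. of_real (x ^ m) * iter_deriv n f x)))}"

definition schwartz_seminorm :: "nat \<Rightarrow> nat \<Rightarrow> (real \<Rightarrow> complex) \<Rightarrow> real" where
  "schwartz_seminorm m n f = (SUP x. norm (of_real (x ^ m) * iter_deriv n f x))"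

text \<open>The locally convex topology of the Schwartz space: all seminorm balls form a subbase.\<close>

definition schwartz_topology :: "(real \<Rightarrow> complex) topology" where
  "schwartz_topology = topology_generated_by
     {{g \<in> Schwartz. schwartz_seminorm m n (\<lambda>x. g x - f x) < e} | m n f e.
        f \<in> Schwartz \<and> 0 < e}"

text \<open>
  A distribution is a functional on \<^const>\<open>Schwartz\<close>; being \<^const>\<open>extensional\<close> there, it is
  determined by its values on Schwartz functions.
\<close>

type_synonym functional = "(real \<Rightarrow> complex) \<Rightarrow> complex"

definition tempered :: "functional set" where
  "tempered = {T \<in> extensional Schwartz.
     (\<forall>f\<in>Schwartz. \<forall>g\<in>Schwartz. T (\<lambda>x. f x + g x) = T f + T g) \<and>
     (\<forall>c. \<forall>f\<in>Schwartz. T (\<lambda>x. c * f x) = c * T f) \<and>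
     continuous_map schwartz_topology euclidean T}"

definition weak_star :: "functional topology" where
  "weak_star = subtopology (product_topology (\<lambda>_. euclidean) Schwartz) tempered"

definition scale_dist :: "complex \<Rightarrow> functional \<Rightarrow> functional" where
  "scale_dist c T = (\<lambda>\<psi>\<in>Schwartz. c * T \<psi>)"

text \<open>Unconditional convergence of a family of distributions: limit along finite partial sums.\<close>

definition has_weak_star_sum :: "('i \<Rightarrow> functional) \<Rightarrow> 'i set \<Rightarrow> functional \<Rightarrow> bool" where
  "has_weak_star_sum T I L \<longleftrightarrow>
     limitin weak_star (\<lambda>D. \<lambda>\<psi>\<in>Schwartz. \<Sum>i\<in>D. T i \<psi>) L (finite_subsets_at_top I)"

definition fourier :: "(real \<Rightarrow> complex) \<Rightarrow> real \<Rightarrow> complex" where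
  "fourier \<psi> y = (LINT x|lborel. exp (- (2 * of_real pi * \<i> * of_real (y * x))) * \<psi> x)"

definition fourier_dist :: "functional \<Rightarrow> functional" where
  "fourier_dist T = (\<lambda>\<psi>\<in>Schwartz. T (fourier \<psi>))"


subsection \<open>Measures as distributions\<close>

definition measure_dist :: "real measure \<Rightarrow> functional" where
  "measure_dist \<mu> = (\<lambda>\<psi>\<in>Schwartz. LINT x|\<mu>. \<psi> x)"

definition tempered_measure :: "real measure \<Rightarrow> bool" where
  "tempered_measure \<mu> \<longleftrightarrow>
     sets \<mu> = sets borel \<and>
     (\<forall>K. compact K \<longrightarrow> emeasure \<mu> K < \<infinity>) \<and>
     (\<forall>\<psi>\<in>Schwartz. integrable \<mu> \<psi>) \<and>
     measure_dist \<mu> \<in> tempered"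

definition pure_point :: "real measure \<Rightarrow> bool" where
  "pure_point \<mu> \<longleftrightarrow>
     (\<forall>A\<in>sets \<mu>. emeasure \<mu> A = (\<integral>\<^sup>+x. emeasure \<mu> {x} \<partial>count_space A))"


subsection \<open>Dirac combs, autocorrelation and diffraction\<close>

definition dirac_comb :: "real set \<Rightarrow> functional" where
  "dirac_comb S = (\<lambda>\<psi>\<in>Schwartz. \<Sum>\<^sub>\<infinity>x\<in>S. \<psi> x)"

definition is_autocorrelation :: "real set \<Rightarrow> functional \<Rightarrow> bool" where
  "is_autocorrelation S \<gamma> \<longleftrightarrow>
     limitin weak_star
       (\<lambda>R::real. \<lambda>\<psi>\<in>Schwartz.
          of_real (1 / (2 * R)) *
          (\<Sum>x\<in>{x\<in>S. \<bar>x\<bar> < R}. \<Sum>y\<in>{y\<in>S. \<bar>y\<bar> < R}. \<psi> (x - y)))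
       \<gamma> at_top"

text \<open>The functional \<open>fourier_dist \<gamma>\<close> is here identified with the measure representing it.\<close>

definition is_diffraction_spectrum :: "real set \<Rightarrow> real measure \<Rightarrow> bool" where
  "is_diffraction_spectrum S \<mu> \<longleftrightarrow>
     tempered_measure \<mu> \<and>
     (\<exists>\<gamma>. is_autocorrelation S \<gamma> \<and> fourier_dist \<gamma> = measure_dist \<mu>)"


subsection \<open>Arithmetic\<close>

definition power_free :: "nat \<Rightarrow> int \<Rightarrow> bool" where
  "power_free r m \<longleftrightarrow> \<not> (\<exists>d>1. d ^ r dvd m)"

definition power_free_points :: "nat \<Rightarrow> real set" where
  "power_free_points k = real_of_int ` {m. power_free k m}"

definition scaled_integers :: "nat \<Rightarrow> nat \<Rightarrow> real set" where
  "scaled_integers d k = {of_int m / real d ^ k | m. True}"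

text \<open>The Dirichlet series and the Euler product below are used only for \<open>Re s > 1\<close>.\<close>

definition zeta :: "complex \<Rightarrow> complex" where
  "zeta s = (\<Sum>n. 1 / of_nat (Suc n) powr s)"

definition xi :: "complex \<Rightarrow> complex" where
  "xi s = (\<Prod>p. if prime p then 1 - 2 / of_nat p powr s else 1)"

end

theory Submission
  imports Defs "HOL-Probability.Sinc_Integral" "HOL-Probability.Characteristic_Functions"
    "HOL-Real_Asymp.Real_Asymp"
begin

text \<open>
  Both the autocorrelation and the diffraction measure are sums over squarefree \<open>d\<close>, and the
  Poisson summation formula carries one into the other term by term.

  The coefficient of \<open>\<delta>\<^sub>m\<close> in the autocorrelation is the density of the integers \<open>y\<close> for which
  \<open>y\<close> and \<open>y + m\<close> are both \<open>k\<close>th-power-free. Only demanding this for primes \<open>p \<le> N\<close> gives a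
  periodic set, whose density is \<open>\<Prod>(1 - \<rho>\<^sub>p / p\<^sup>k)\<close> by the Chinese remainder theorem, where
  \<open>\<rho>\<^sub>p\<close> is 1 if \<open>p\<^sup>k\<close> divides \<open>m\<close> and 2 otherwise. A pair that is kept wrongly contains a
  multiple of some \<open>n\<^sup>k\<close> with \<open>n > N\<close>, and the number of nonzero such multiples in \<open>(-R, R)\<close> is at
  most \<open>2 R\<close> times the tail of the zeta series, uniformly in \<open>R\<close>. Letting \<open>R\<close> and then \<open>N\<close>
  grow gives the Euler product over all primes (\<open>power_free_pairs_has_density\<close>). Relative to
  \<open>\<xi>(k) = \<Prod>(1 - 2 / p\<^sup>k)\<close> it is the product of \<open>1 + 1 / (p\<^sup>k - 2)\<close> over the primes with
  \<open>p\<^sup>k dvd m\<close>; multiplied out, it is a sum over the squarefree \<open>d\<close> with \<open>d\<^sup>k dvd m\<close>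
  (\<open>squarefree_sum_eq_euler_product\<close>). So the autocorrelation is \<open>\<xi>(k)\<close> times the sum over \<open>d\<close>
  of \<open>\<Prod>1 / (p\<^sup>k - 2)\<close>, over \<open>p dvd d\<close>, times the Dirac comb of \<open>d\<^sup>k \<int>\<close>.

  The Fourier transform of the Dirac comb of \<open>N \<int>\<close> is \<open>1 / N\<close> times that of \<open>\<int> / N\<close>
  (\<open>poisson_summation_lattice\<close>). Taking \<open>N = d\<^sup>k\<close> turns the weights into
  \<open>\<Prod>1 / (p\<^sup>k (p\<^sup>k - 2))\<close>, which is the asserted representation; it is a positive measure on
  the countable set of all \<open>m / d\<^sup>k\<close>, hence pure point. In lowest terms, \<open>a / q\<close> lies in
  \<open>\<int> / d\<^sup>k\<close> iff \<open>q\<close> divides \<open>d\<^sup>k\<close>, that is, iff \<open>q\<close> is \<open>(k + 1)\<close>th-power-free and every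
  prime divisor of \<open>q\<close> divides \<open>d\<close>. Summing the weights over these \<open>d\<close> is once more an Euler
  product (\<open>comb_weight_has_sum\<close>). With \<open>t = p\<^sup>k\<close>, the identity
  \<open>(1 - 2 / t) (1 + 1 / (t (t - 2))) = (1 - 1 / t)\<^sup>2\<close> makes it \<open>1 / \<zeta>(k)\<^sup>2\<close> up to the primes
  that divide \<open>q\<close>.

  All analytic estimates rest on one bound: a Schwartz function is at most a constant times
  \<open>1 / (1 + x\<^sup>2)\<close>, the constant being a sum of two seminorms. It makes the functionals tempered,
  dominates the limit that defines the autocorrelation, and bounds a sum over \<open>\<int> / N\<close> by a
  multiple of \<open>N\<close>. With \<open>N = d\<^sup>k\<close> this bound takes the second family of weights to the first,
  whose sum over all squarefree \<open>d\<close> is finite.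
\<close>

section \<open>Schwartz functions and tempered functionals\<close>

definition rapid_decay :: "(real \<Rightarrow> complex) \<Rightarrow> bool" where
  "rapid_decay f \<longleftrightarrow> (\<forall>m. bounded (range (\<lambda>x. of_real (x ^ m) * f x)))"

lemma iter_deriv_0 [simp]: "iter_deriv 0 f = f"
  and iter_deriv_Suc: "iter_deriv (Suc n) f = (\<lambda>x. vector_derivative (iter_deriv n f) (at x))"
  by (simp_all add: iter_deriv_def)

lemma iter_deriv_shift: "iter_deriv n (\<lambda>x. vector_derivative f (at x)) = iter_deriv (Suc n) f"
  by (induction n) (simp_all add: iter_deriv_Suc)

text \<open>
  Closure properties of the Schwartz space become one-step checks: a class of rapidly decaying
  functions that contains a derivative of each of its members contains all their iterated
  derivatives. No formula for the \<open>n\<close>th derivative of a product or of a Fourier transform is needed.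
\<close>

lemma Schwartz_coinduct:
  assumes "f \<in> P" "\<And>g. g \<in> P \<Longrightarrow> rapid_decay g"
    and deriv: "\<And>g. g \<in> P \<Longrightarrow> \<exists>g'\<in>P. \<forall>x. (g has_vector_derivative g' x) (at x)"
  shows "f \<in> Schwartz"
proof -
  have P: "iter_deriv n f \<in> P" for n
  proof (induction n)
    case (Suc n)
    then obtain g' where "g' \<in> P" "\<And>x. (iter_deriv n f has_vector_derivative g' x) (at x)"
      using deriv by blast
    then have "iter_deriv (Suc n) f = g'"
      by (auto simp: iter_deriv_Suc intro!: vector_derivative_at)
    with \<open>g' \<in> P\<close> show ?case by simp
  qed (use assms in simp)
  have "iter_deriv n f differentiable (at x)" for n x
    using deriv[OF P[of n]] by (auto intro: differentiableI_vector)
  moreover have "bounded (range (\<lambda>x. of_real (x ^ m) * iter_deriv n f x))" for m n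
    using assms(2)[OF P[of n]] by (simp add: rapid_decay_def)
  ultimately show ?thesis by (simp add: Schwartz_def)
qed

lemma Schwartz_rapid_decay: "f \<in> Schwartz \<Longrightarrow> rapid_decay f"
  by (simp add: Schwartz_def rapid_decay_def) (metis iter_deriv_0)

lemma Schwartz_has_vector_derivative:
  assumes "f \<in> Schwartz"
  shows "(f has_vector_derivative vector_derivative f (at x)) (at x)"
proof -
  have "iter_deriv 0 f differentiable (at x)" using assms unfolding Schwartz_def by blast
  then show ?thesis by (simp add: vector_derivative_works)
qed

lemma Schwartz_deriv:
  assumes "f \<in> Schwartz"
  shows "(\<lambda>x. vector_derivative f (at x)) \<in> Schwartz"
  using assms by (simp add: Schwartz_def iter_deriv_shift)

lemma rapid_decay_add:
  assumes "rapid_decay f" "rapid_decay g"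
  shows "rapid_decay (\<lambda>x. f x + g x)"
  unfolding rapid_decay_def
proof
  fix m
  show "bounded (range (\<lambda>x. of_real (x ^ m) * (f x + g x)))"
    using bounded_plus_comp[of "\<lambda>x. of_real (x ^ m) * f x" UNIV "\<lambda>x. of_real (x ^ m) * g x"] assms
    by (simp add: rapid_decay_def ring_distribs)
qed

lemma rapid_decay_mult_left:
  assumes "rapid_decay f"
  shows "rapid_decay (\<lambda>x. c * f x)"
  unfolding rapid_decay_def
proof
  fix m
  have "bounded ((\<lambda>z. c * z) ` range (\<lambda>x. of_real (x ^ m) * f x))"
    using assms unfolding rapid_decay_def
    by (intro bounded_linear_image[OF _ bounded_linear_mult_right]) blast
  then show "bounded (range (\<lambda>x. of_real (x ^ m) * (c * f x)))"
    by (simp add: image_image mult_ac)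
qed

lemma rapid_decay_times_x:
  assumes "rapid_decay f"
  shows "rapid_decay (\<lambda>x. of_real x * f x)"
  unfolding rapid_decay_def
proof
  fix m
  have "bounded (range (\<lambda>x. of_real (x ^ Suc m) * f x))"
    using assms unfolding rapid_decay_def by blast
  then show "bounded (range (\<lambda>x. of_real (x ^ m) * (of_real x * f x)))"
    by (simp add: mult_ac)
qed

lemma rapid_decay_rescale:
  assumes "rapid_decay f" "c \<noteq> 0"
  shows "rapid_decay (\<lambda>x. f (c * x))"
  unfolding rapid_decay_def
proof
  fix m
  have "bounded ((\<lambda>z. of_real (1 / c ^ m) * z) ` range (\<lambda>x. of_real (x ^ m) * f x))"
    using assms(1) unfolding rapid_decay_def
    by (intro bounded_linear_image[OF _ bounded_linear_mult_right]) blast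
  then have "bounded (range (\<lambda>x. of_real (1 / c ^ m) * (of_real (x ^ m) * f x)))"
    by (simp only: image_image)
  then have "bounded ((\<lambda>x. of_real (1 / c ^ m) * (of_real (x ^ m) * f x)) ` range (\<lambda>x. c * x))"
    by (rule bounded_subset) (rule image_mono, simp)
  moreover have "(\<lambda>x. of_real (x ^ m) * f (c * x))
      = (\<lambda>x. of_real (1 / c ^ m) * (of_real ((c * x) ^ m) * f (c * x)))"
    using assms(2) by (auto simp: power_mult_distrib)
  ultimately show "bounded (range (\<lambda>x. of_real (x ^ m) * f (c * x)))"
    by (simp only: image_image)
qed

lemma Schwartz_add:
  assumes "f \<in> Schwartz" "g \<in> Schwartz"
  shows "(\<lambda>x. f x + g x) \<in> Schwartz"
proof (rule Schwartz_coinduct[where P = "{\<lambda>x. f x + g x | f g. f \<in> Schwartz \<and> g \<in> Schwartz}"])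
  show "\<exists>h'\<in>{\<lambda>x. f x + g x | f g. f \<in> Schwartz \<and> g \<in> Schwartz}. \<forall>x. (h has_vector_derivative h' x) (at x)"
    if "h \<in> {\<lambda>x. f x + g x | f g. f \<in> Schwartz \<and> g \<in> Schwartz}" for h
  proof -
    from that obtain f g where h: "h = (\<lambda>x. f x + g x)" "f \<in> Schwartz" "g \<in> Schwartz" by auto
    have m: "(\<lambda>x. vector_derivative f (at x) + vector_derivative g (at x))
        \<in> {\<lambda>x. f x + g x | f g. f \<in> Schwartz \<and> g \<in> Schwartz}"
      by (intro CollectI exI[of _ "\<lambda>x. vector_derivative f (at x)"]
            exI[of _ "\<lambda>x. vector_derivative g (at x)"] conjI refl Schwartz_deriv h)
    have "(h has_vector_derivative vector_derivative f (at x) + vector_derivative g (at x)) (at x)" for x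
      unfolding h(1) by (intro has_vector_derivative_add Schwartz_has_vector_derivative h)
    then show ?thesis by (intro bexI[OF _ m] allI)
  qed
qed (use assms in \<open>auto intro!: rapid_decay_add dest: Schwartz_rapid_decay\<close>)

lemma Schwartz_mult_left:
  assumes "f \<in> Schwartz"
  shows "(\<lambda>x. c * f x) \<in> Schwartz"
proof (rule Schwartz_coinduct[where P = "{\<lambda>x. c * f x | f. f \<in> Schwartz}"])
  show "\<exists>h'\<in>{\<lambda>x. c * f x | f. f \<in> Schwartz}. \<forall>x. (h has_vector_derivative h' x) (at x)"
    if "h \<in> {\<lambda>x. c * f x | f. f \<in> Schwartz}" for h
  proof -
    from that obtain f where h: "h = (\<lambda>x. c * f x)" "f \<in> Schwartz" by auto
    then show ?thesis
      by (intro bexI[where x="\<lambda>x. c * vector_derivative f (at x)"])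
         (auto intro!: has_vector_derivative_mult_right Schwartz_has_vector_derivative dest: Schwartz_deriv)
  qed
  show "(\<lambda>x. c * f x) \<in> {\<lambda>x. c * f x | f. f \<in> Schwartz}" using assms by blast
  show "rapid_decay h" if "h \<in> {\<lambda>x. c * f x | f. f \<in> Schwartz}" for h
    using that by (auto intro!: rapid_decay_mult_left dest: Schwartz_rapid_decay)
qed

lemma Schwartz_diff:
  assumes "f \<in> Schwartz" "g \<in> Schwartz"
  shows "(\<lambda>x. f x - g x) \<in> Schwartz"
  using Schwartz_add[OF assms(1) Schwartz_mult_left[OF assms(2), of "-1"]] by simp

lemma Schwartz_zero: "(\<lambda>x. 0) \<in> Schwartz"
proof (rule Schwartz_coinduct[where P = "{\<lambda>x. 0}"])
  show "rapid_decay g" if "g \<in> {\<lambda>x. 0}" for g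
    using that by (auto simp: rapid_decay_def)
qed auto

text \<open>
  The functions \<open>x f\<close> alone are not closed under differentiation; with a second Schwartz function
  added they are, since \<open>(x f + g)' = x f' + (f + g')\<close>.
\<close>

lemma Schwartz_times_x:
  assumes "f \<in> Schwartz"
  shows "(\<lambda>x. of_real x * f x) \<in> Schwartz"
proof -
  let ?P = "{\<lambda>x. of_real x * f x + g x | f g. f \<in> Schwartz \<and> g \<in> Schwartz}"
  show ?thesis
  proof (rule Schwartz_coinduct[where P = ?P])
    show "(\<lambda>x. of_real x * f x) \<in> ?P"
      using assms Schwartz_zero by force
    show "\<exists>h'\<in>?P. \<forall>x. (h has_vector_derivative h' x) (at x)" if h: "h \<in> ?P" for h
    proof -
      from h obtain f g where fg: "h = (\<lambda>x. of_real x * f x + g x)" "f \<in> Schwartz" "g \<in> Schwartz"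
        by auto
      let ?h' = "\<lambda>x. of_real x * vector_derivative f (at x) + (f x + vector_derivative g (at x))"
      have d: "(h has_vector_derivative ?h' x) (at x)" for x
        unfolding fg(1)
        using has_vector_derivative_add[OF has_vector_derivative_mult[OF
            has_vector_derivative_of_real[OF DERIV_ident] Schwartz_has_vector_derivative[OF fg(2)]]
            Schwartz_has_vector_derivative[OF fg(3)]]
        by (simp add: algebra_simps)
      have m: "?h' \<in> ?P"
        by (intro CollectI exI[of _ "\<lambda>x. vector_derivative f (at x)"]
            exI[of _ "\<lambda>x. f x + vector_derivative g (at x)"] conjI refl Schwartz_deriv Schwartz_add fg)
      show ?thesis by (intro bexI[OF _ m] allI d)
    qed
  qed (auto intro!: rapid_decay_add rapid_decay_times_x dest: Schwartz_rapid_decay)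
qed

lemma Schwartz_rescale:
  assumes "f \<in> Schwartz" "c \<noteq> 0"
  shows "(\<lambda>x. f (c * x)) \<in> Schwartz"
proof -
  let ?P = "{\<lambda>x. b * f (c * x) | f b. f \<in> Schwartz}"
  show ?thesis
  proof (rule Schwartz_coinduct[where P = ?P])
    show "(\<lambda>x. f (c * x)) \<in> ?P"
      using assms(1) by force
    show "\<exists>h'\<in>?P. \<forall>x. (h has_vector_derivative h' x) (at x)" if h: "h \<in> ?P" for h
    proof -
      from h obtain f b where f: "h = (\<lambda>x. b * f (c * x))" "f \<in> Schwartz" by auto
      have "((f \<circ> (\<lambda>x. c * x)) has_vector_derivative c *\<^sub>R vector_derivative f (at (c * x))) (at x)" for x
        using f by (intro vector_diff_chain_at)
          (auto intro!: derivative_eq_intros Schwartz_has_vector_derivative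
             simp flip: has_real_derivative_iff_has_vector_derivative)
      then have "(h has_vector_derivative (b * of_real c) * vector_derivative f (at (c * x))) (at x)" for x
        unfolding f(1) by (subst mult.assoc)
          (rule has_vector_derivative_mult_right, simp add: o_def scaleR_conv_of_real)
      then have "\<forall>x. (h has_vector_derivative (b * of_real c) * vector_derivative f (at (c * x))) (at x)"
        by blast
      moreover have "(\<lambda>x. (b * of_real c) * vector_derivative f (at (c * x))) \<in> ?P"
        using Schwartz_deriv[OF f(2)]
        by (intro CollectI exI[of _ "\<lambda>x. vector_derivative f (at x)"] exI[of _ "b * of_real c"]) simp
      ultimately show ?thesis by (rule rev_bexI[rotated])
    qed
  qed (use assms(2) in \<open>auto intro!: rapid_decay_mult_left rapid_decay_rescale dest: Schwartz_rapid_decay\<close>)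
qed

lemma Schwartz_continuous: "f \<in> Schwartz \<Longrightarrow> continuous_on A f"
  using has_vector_derivative_continuous[OF Schwartz_has_vector_derivative]
  by (simp add: continuous_at_imp_continuous_on)

lemma Schwartz_measurable [measurable_dest]: "f \<in> Schwartz \<Longrightarrow> f \<in> borel_measurable borel"
  by (intro borel_measurable_continuous_onI Schwartz_continuous)

text \<open>
  The one seminorm used in all estimates below: it bounds \<open>(1 + x\<^sup>2) \<bar>f x\<bar>\<close>.
\<close>

definition decay_norm :: "(real \<Rightarrow> complex) \<Rightarrow> real" where
  "decay_norm f = schwartz_seminorm 0 0 f + schwartz_seminorm 2 0 f"

lemma norm_le_schwartz_seminorm:
  assumes "f \<in> Schwartz"
  shows "norm (of_real (x ^ m) * iter_deriv n f x) \<le> schwartz_seminorm m n f"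
  unfolding schwartz_seminorm_def
proof (rule cSUP_upper)
  have "bounded (range (\<lambda>x. of_real (x ^ m) * iter_deriv n f x))"
    using assms unfolding Schwartz_def by blast
  then show "bdd_above (range (\<lambda>x. norm (of_real (x ^ m) * iter_deriv n f x)))"
    unfolding bounded_iff bdd_above_def by simp
qed simp

lemma schwartz_seminorm_nonneg: "f \<in> Schwartz \<Longrightarrow> 0 \<le> schwartz_seminorm m n f"
  using norm_le_schwartz_seminorm[of f 0 m n] norm_ge_zero order_trans by blast

lemma decay_norm_nonneg: "f \<in> Schwartz \<Longrightarrow> 0 \<le> decay_norm f"
  by (simp add: decay_norm_def schwartz_seminorm_nonneg)

lemma Schwartz_decay:
  assumes "f \<in> Schwartz"
  shows "norm (f x) \<le> decay_norm f * inverse (1 + x\<^sup>2)"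
proof -
  have "norm (f x) * (1 + x\<^sup>2) = norm (of_real (x ^ 0) * iter_deriv 0 f x) + norm (of_real (x ^ 2) * iter_deriv 0 f x)"
    by (simp add: norm_mult norm_power algebra_simps)
  also have "\<dots> \<le> decay_norm f"
    unfolding decay_norm_def by (intro add_mono norm_le_schwartz_seminorm assms)
  finally show ?thesis
    by (simp add: field_simps add_pos_nonneg)
qed

text \<open>
  By additivity, \<open>T g - T f = T (g - f)\<close>, so the bound controls \<open>T\<close> on the intersection of two
  subbasic balls around \<open>f\<close>, one for each seminorm in \<^const>\<open>decay_norm\<close>.
\<close>

lemma continuous_map_schwartz:
  fixes T :: functional
  assumes add: "\<And>f g. f \<in> Schwartz \<Longrightarrow> g \<in> Schwartz \<Longrightarrow> T (\<lambda>x. f x + g x) = T f + T g"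
    and bound: "\<And>f. f \<in> Schwartz \<Longrightarrow> norm (T f) \<le> C * decay_norm f"
  shows "continuous_map schwartz_topology euclidean T"
proof -
  define ball where "ball m n f e = {g \<in> Schwartz. schwartz_seminorm m n (\<lambda>x. g x - f x) < e}"
    for m n f and e :: real
  define S where "S = {ball m n f e | m n f e. f \<in> Schwartz \<and> 0 < e}"
  have top: "schwartz_topology = topology_generated_by S"
    by (simp add: schwartz_topology_def S_def ball_def)
  have zero: "schwartz_seminorm m n (\<lambda>x. 0) = 0" for m n
  proof -
    have "iter_deriv n (\<lambda>x. 0) = (\<lambda>x. 0)"
      by (induction n) (auto simp: iter_deriv_Suc)
    then show ?thesis by (simp add: schwartz_seminorm_def)
  qed
  have self: "f \<in> ball m n f e" if "f \<in> Schwartz" "0 < e" for f m n e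
    using that by (simp add: ball_def zero)
  have space: "topspace schwartz_topology = Schwartz"
  proof -
    have "\<Union>S \<subseteq> Schwartz" by (auto simp: S_def ball_def)
    moreover have "f \<in> \<Union>S" if "f \<in> Schwartz" for f
    proof
      show "f \<in> ball 0 0 f 1" using self that by simp
      show "ball 0 0 f 1 \<in> S" unfolding S_def using that zero_less_one by blast
    qed
    ultimately show ?thesis
      unfolding top topology_generated_by_topspace by blast
  qed
  have "openin schwartz_topology {f \<in> topspace schwartz_topology. T f \<in> U}" if "open U" for U
  proof (subst openin_subopen, intro ballI)
    fix f assume "f \<in> {f \<in> topspace schwartz_topology. T f \<in> U}"
    then have f: "f \<in> Schwartz" "T f \<in> U" by (auto simp: space)
    with \<open>open U\<close> obtain e where e: "e > 0" "\<And>z. dist z (T f) < e \<Longrightarrow> z \<in> U"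
      by (auto simp: open_dist)
    define r where "r = e / (2 * (\<bar>C\<bar> + 1))"
    have r: "r > 0" using e by (simp add: r_def)
    let ?N = "ball 0 0 f r \<inter> ball 2 0 f r"
    have "ball m n f r \<in> S" for m n unfolding S_def using f r by blast
    then have "openin schwartz_topology ?N"
      unfolding top by (intro openin_Int topology_generated_by_Basis)
    moreover have "f \<in> ?N" using self f r by simp
    moreover have "T g \<in> U" if "g \<in> ?N" for g
    proof (rule e(2))
      have g: "g \<in> Schwartz" using that by (simp add: ball_def)
      have d: "(\<lambda>x. g x - f x) \<in> Schwartz" using f g by (intro Schwartz_diff)
      have "T g = T (\<lambda>x. f x + (g x - f x))" by simp
      also have "\<dots> = T f + T (\<lambda>x. g x - f x)" by (rule add) (fact f d)+
      finally have "dist (T g) (T f) = norm (T (\<lambda>x. g x - f x))" by (simp add: dist_norm)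
      also have "\<dots> \<le> C * decay_norm (\<lambda>x. g x - f x)" by (rule bound) fact
      also have "\<dots> \<le> (\<bar>C\<bar> + 1) * decay_norm (\<lambda>x. g x - f x)"
        using decay_norm_nonneg[OF d] by (intro mult_right_mono) auto
      also have "\<dots> < (\<bar>C\<bar> + 1) * (r + r)"
        using that by (intro mult_strict_left_mono add_strict_mono)
          (auto simp: ball_def decay_norm_def)
      also have "\<dots> = e" by (simp add: r_def divide_simps)
      finally show "dist (T g) (T f) < e" .
    qed
    ultimately show "\<exists>N. openin schwartz_topology N \<and> f \<in> N \<and> N \<subseteq> {f \<in> topspace schwartz_topology. T f \<in> U}"
      by (intro exI[of _ ?N]) (auto simp: space ball_def)
  qed
  then show ?thesis by (simp add: continuous_map_def)
qed

lemma temperedI: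
  fixes L :: functional
  assumes add: "\<And>f g. f \<in> Schwartz \<Longrightarrow> g \<in> Schwartz \<Longrightarrow> L (\<lambda>x. f x + g x) = L f + L g"
    and scale: "\<And>c f. f \<in> Schwartz \<Longrightarrow> L (\<lambda>x. c * f x) = c * L f"
    and bound: "\<And>f. f \<in> Schwartz \<Longrightarrow> norm (L f) \<le> C * decay_norm f"
  shows "restrict L Schwartz \<in> tempered"
  unfolding tempered_def
proof (intro CollectI conjI ballI allI)
  show "continuous_map schwartz_topology euclidean (restrict L Schwartz)"
    by (rule continuous_map_schwartz[where C = C])
       (simp_all add: add bound Schwartz_add)
qed (simp_all add: add scale Schwartz_add Schwartz_mult_left)

section \<open>The Fourier transform on the Schwartz space\<close>

lemma integrable_inverse_one_plus_square: "integrable lborel (\<lambda>x::real. inverse (1 + x\<^sup>2))"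
  using integrable_inverse_1_plus_square by (simp add: set_integrable_def)

lemma integrable_of_decay:
  fixes f :: "real \<Rightarrow> complex"
  assumes "f \<in> borel_measurable borel" "\<And>x. norm (f x) \<le> C * inverse (1 + x\<^sup>2)"
  shows "integrable lborel f"
proof (rule Bochner_Integration.integrable_bound)
  show "integrable lborel (\<lambda>x. C * inverse (1 + x\<^sup>2))"
    by (intro integrable_mult_right integrable_inverse_one_plus_square)
  show "AE x in lborel. norm (f x) \<le> norm (C * inverse (1 + x\<^sup>2))"
    using assms(2) order_trans abs_ge_self by (fastforce simp del: abs_mult)
qed (use assms(1) in simp)

lemma Schwartz_integrable: "f \<in> Schwartz \<Longrightarrow> integrable lborel f"
  by (rule integrable_of_decay) (auto intro: Schwartz_decay Schwartz_measurable)

lemma fourier_cis: "fourier f y = (LINT x|lborel. cis (- (2 * pi * y * x)) * f x)"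
  unfolding fourier_def by (intro Bochner_Integration.integral_cong) (auto simp: cis_conv_exp mult_ac)

lemma integrable_cis_mult:
  assumes "integrable lborel f"
  shows "integrable lborel (\<lambda>x. cis (a * x) * f x)"
proof (rule Bochner_Integration.integrable_bound[OF assms])
  show "(\<lambda>x. cis (a * x) * f x) \<in> borel_measurable lborel"
    using borel_measurable_integrable[OF assms]
    by (intro borel_measurable_times)
       (auto intro!: borel_measurable_continuous_onI continuous_intros)
qed (simp add: norm_mult)

lemma norm_fourier_le:
  assumes "integrable lborel f"
  shows "norm (fourier f y) \<le> (LINT x|lborel. norm (f x))"
  unfolding fourier_cis
  using integral_norm_bound[of lborel "\<lambda>x. cis (- (2 * pi * y * x)) * f x"]
  by (simp add: norm_mult)

lemma norm_cis_minus_linear: "norm (cis t - (1 + \<i> * of_real t)) \<le> t\<^sup>2"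
proof -
  have "norm (cis t - (1 + \<i> * of_real t)) \<le> t\<^sup>2 / 2"
    using iexp_approx1[of t 1] by (simp add: cis_conv_exp power2_eq_square)
  also have "\<dots> \<le> t\<^sup>2" by simp
  finally show ?thesis .
qed

text \<open>
  The second-order remainder of the exponential bounds the error of the linear approximation by
  \<open>K (z - y)\<^sup>2\<close>, with \<open>K\<close> the integral of \<open>\<bar>(2 \<pi> x)\<^sup>2 f x\<bar>\<close>; this replaces an interchange of
  limit and integral.
\<close>

lemma fourier_has_vector_derivative:
  assumes "f \<in> Schwartz"
  shows "(fourier f has_vector_derivative fourier (\<lambda>x. - (2 * pi * \<i>) * (of_real x * f x)) y) (at y)"
proof -
  let ?g = "\<lambda>x. - (2 * pi * \<i>) * (of_real x * f x)"
  have g: "integrable lborel ?g" and f: "integrable lborel f"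
    by (intro Schwartz_integrable Schwartz_mult_left Schwartz_times_x assms)+
  define K where "K = (LINT x|lborel. norm ((2 * pi)\<^sup>2 * (of_real x * (of_real x * f x)) :: complex))"
  have K: "integrable lborel (\<lambda>x. norm ((2 * pi)\<^sup>2 * (of_real x * (of_real x * f x)) :: complex))"
    by (intro integrable_norm Schwartz_integrable Schwartz_mult_left Schwartz_times_x assms)
  have bound: "norm (fourier f z - fourier f y - (z - y) *\<^sub>R fourier ?g y) \<le> K * (norm (z - y))\<^sup>2" for z
  proof -
    let ?R = "\<lambda>x. cis (- (2 * pi * y * x)) *
        (cis (- (2 * pi * (z - y) * x)) - (1 + \<i> * of_real (- (2 * pi * (z - y) * x)))) * f x"
    have R: "cis (- (2 * pi * z) * x) * f x - cis (- (2 * pi * y) * x) * f x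
        - (z - y) *\<^sub>R (cis (- (2 * pi * y) * x) * ?g x) = ?R x" for x
    proof -
      have "cis (- (2 * pi * z) * x) = cis (- (2 * pi * y) * x) * cis (- (2 * pi * (z - y) * x))"
        by (simp add: cis_mult algebra_simps)
      then show ?thesis by (simp add: scaleR_conv_of_real algebra_simps)
    qed
    have int: "integrable lborel ?R"
      unfolding R[symmetric]
      by (intro Bochner_Integration.integrable_diff integrable_scaleR_right integrable_cis_mult f g)
    have eq: "fourier f z - fourier f y - (z - y) *\<^sub>R fourier ?g y = (LINT x|lborel. ?R x)"
      unfolding R[symmetric]
      using integrable_cis_mult[OF f, of "- (2 * pi * z)"] integrable_cis_mult[OF f, of "- (2 * pi * y)"]
        integrable_cis_mult[OF g, of "- (2 * pi * y)"]
      by (simp add: fourier_cis)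
    have "norm (fourier f z - fourier f y - (z - y) *\<^sub>R fourier ?g y)
        \<le> (LINT x|lborel. (z - y)\<^sup>2 * norm ((2 * pi)\<^sup>2 * (of_real x * (of_real x * f x)) :: complex))"
      unfolding eq
    proof (rule Bochner_Integration.integral_norm_bound_integral)
      show "integrable lborel (\<lambda>x. (z - y)\<^sup>2 * norm ((2 * pi)\<^sup>2 * (of_real x * (of_real x * f x)) :: complex))"
        using K by (rule integrable_mult_right)
      have "norm (cis (- (2 * pi * (z - y) * x)) - (1 + \<i> * of_real (- (2 * pi * (z - y) * x)))) * norm (f x)
          \<le> (- (2 * pi * (z - y) * x))\<^sup>2 * norm (f x)" for x
        by (intro mult_right_mono norm_cis_minus_linear) simp
      moreover have "(- (2 * pi * (z - y) * x))\<^sup>2 * norm (f x)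
          = (z - y)\<^sup>2 * norm ((2 * pi)\<^sup>2 * (of_real x * (of_real x * f x)) :: complex)" for x
        by (simp add: norm_mult power2_eq_square abs_mult_self_eq)
      ultimately show "norm (?R x) \<le> (z - y)\<^sup>2 * norm ((2 * pi)\<^sup>2 * (of_real x * (of_real x * f x)) :: complex)" for x
        by (simp only: norm_mult[of _ "f x"] norm_mult[of "cis _"] norm_cis mult_1_left)
    qed (rule int)
    also have "\<dots> = K * (norm (z - y))\<^sup>2"
      by (simp add: K_def mult.commute)
    finally show ?thesis .
  qed
  show ?thesis
    unfolding has_vector_derivative_def has_derivative_at2
  proof (intro conjI bounded_linear_scaleR_left)
    show "((\<lambda>z. (1 / norm (z - y)) *\<^sub>R (fourier f z - (fourier f y + (z - y) *\<^sub>R fourier ?g y))) \<longlongrightarrow> 0) (at y)"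
    proof (rule Lim_null_comparison)
      show "\<forall>\<^sub>F z in at y. norm ((1 / norm (z - y)) *\<^sub>R (fourier f z - (fourier f y + (z - y) *\<^sub>R fourier ?g y)))
          \<le> K * norm (z - y)"
        unfolding eventually_at_filter
      proof (intro always_eventually allI impI)
        fix z assume "z \<noteq> y"
        then show "norm ((1 / norm (z - y)) *\<^sub>R (fourier f z - (fourier f y + (z - y) *\<^sub>R fourier ?g y)))
          \<le> K * norm (z - y)"
          using bound[of z] by (simp add: diff_diff_eq[symmetric] pos_divide_le_eq power2_eq_square)
      qed
      show "((\<lambda>z. K * norm (z - y)) \<longlongrightarrow> 0) (at y)"
        by (auto intro!: tendsto_eq_intros)
    qed
  qed
qed

lemma Schwartz_tendsto_0:
  assumes "f \<in> Schwartz"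
  shows "(f \<longlongrightarrow> 0) at_top" "(f \<longlongrightarrow> 0) at_bot"
proof -
  have "((\<lambda>x::real. inverse (1 + x\<^sup>2)) \<longlongrightarrow> 0) at_top" "((\<lambda>x::real. inverse (1 + x\<^sup>2)) \<longlongrightarrow> 0) at_bot"
    by real_asymp+
  then have *: "((\<lambda>x::real. decay_norm f * inverse (1 + x\<^sup>2)) \<longlongrightarrow> 0) at_top"
      "((\<lambda>x::real. decay_norm f * inverse (1 + x\<^sup>2)) \<longlongrightarrow> 0) at_bot"
    by (auto intro: tendsto_mult_right_zero)
  show "(f \<longlongrightarrow> 0) at_top" "(f \<longlongrightarrow> 0) at_bot"
    by (rule Lim_null_comparison[OF _ *(1)] Lim_null_comparison[OF _ *(2)];
        simp add: Schwartz_decay assms always_eventually)+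
qed

lemma integral_derivative_eq_0:
  fixes F :: "real \<Rightarrow> complex"
  assumes "\<And>x. (F has_vector_derivative f x) (at x)" "\<And>x. isCont f x" "integrable lborel f"
    and "(F \<longlongrightarrow> 0) at_top" "(F \<longlongrightarrow> 0) at_bot"
  shows "(LINT x|lborel. f x) = 0"
proof -
  have "(LBINT x=-\<infinity>..\<infinity>. f x) = 0 - 0"
    by (rule interval_integral_FTC_integrable)
       (use assms in \<open>simp_all add: set_integrable_def ereal_tendsto_simps\<close>)
  then show ?thesis
    by (simp add: interval_lebesgue_integral_def set_lebesgue_integral_def)
qed

text \<open>
  Integration by parts: the derivative of \<open>exp (- 2 \<pi> \<i> y x) f x\<close> has integral 0 because the
  function itself vanishes at both ends.
\<close>

lemma fourier_deriv:
  assumes "f \<in> Schwartz"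
  shows "fourier (\<lambda>x. vector_derivative f (at x)) y = 2 * pi * \<i> * y * fourier f y"
proof -
  let ?f' = "\<lambda>x. vector_derivative f (at x)"
  let ?e = "\<lambda>x. cis (- (2 * pi * y) * x)"
  have int: "integrable lborel (\<lambda>x. ?e x * ?f' x)" "integrable lborel (\<lambda>x. ?e x * f x)"
    by (intro integrable_cis_mult Schwartz_integrable Schwartz_deriv assms)+
  have "(LINT x|lborel. ?e x * ?f' x + - (2 * pi * \<i> * y) * (?e x * f x)) = 0"
  proof (rule integral_derivative_eq_0)
    show "((\<lambda>x. ?e x * f x) has_vector_derivative ?e x * ?f' x + - (2 * pi * \<i> * y) * (?e x * f x)) (at x)" for x
    proof -
      have "(?e has_vector_derivative (- (2 * pi * y)) *\<^sub>R (\<i> * ?e x)) (at x)"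
        by (auto intro!: derivative_eq_intros simp: scaleR_conv_of_real has_vector_derivative_def)
      from has_vector_derivative_mult[OF this Schwartz_has_vector_derivative[OF assms]]
      show ?thesis by (simp add: scaleR_conv_of_real algebra_simps)
    qed
    have "continuous_on UNIV (\<lambda>x. ?e x * ?f' x + - (2 * pi * \<i> * y) * (?e x * f x))"
      by (intro continuous_intros Schwartz_continuous Schwartz_deriv assms)
    then show "isCont (\<lambda>x. ?e x * ?f' x + - (2 * pi * \<i> * y) * (?e x * f x)) x" for x
      by (simp add: continuous_on_eq_continuous_at)
    have lim: "((\<lambda>x. ?e x * f x) \<longlongrightarrow> 0) F" if "(f \<longlongrightarrow> 0) F" for F
      using that by (intro Lim_null_comparison[OF _ tendsto_norm_zero[OF that]])
        (simp add: norm_mult always_eventually)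
    show "((\<lambda>x. ?e x * f x) \<longlongrightarrow> 0) at_top" "((\<lambda>x. ?e x * f x) \<longlongrightarrow> 0) at_bot"
      by (intro lim Schwartz_tendsto_0 assms)+
    show "integrable lborel (\<lambda>x. ?e x * ?f' x + - (2 * pi * \<i> * y) * (?e x * f x))"
      using int by (intro Bochner_Integration.integrable_add integrable_mult_right)
  qed
  then have "(LINT x|lborel. ?e x * ?f' x) = 2 * pi * \<i> * y * (LINT x|lborel. ?e x * f x)"
    using int by simp
  then show ?thesis by (simp add: fourier_cis)
qed

text \<open>
  Each factor \<open>x\<close> is traded for a derivative of \<open>f\<close>, which is again a Schwartz function.
\<close>

lemma fourier_rapid_decay:
  assumes "f \<in> Schwartz"
  shows "rapid_decay (fourier f)"
  unfolding rapid_decay_def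
proof
  fix m
  show "bounded (range (\<lambda>x. of_real (x ^ m) * fourier f x))"
    using assms
  proof (induction m arbitrary: f)
    case 0
    then show ?case
      using norm_fourier_le[OF Schwartz_integrable] by (auto simp: bounded_iff)
  next
    case (Suc m)
    let ?f' = "\<lambda>x. 1 / (2 * pi * \<i>) * vector_derivative f (at x)"
    have "?f' \<in> Schwartz" by (intro Schwartz_mult_left Schwartz_deriv Suc)
    moreover have "fourier ?f' x = of_real x * fourier f x" for x
    proof -
      have "fourier ?f' x = 1 / (2 * pi * \<i>) * fourier (\<lambda>x. vector_derivative f (at x)) x"
        unfolding fourier_def by (subst integral_mult_right_zero[symmetric]) (simp add: mult_ac)
      then show ?thesis using fourier_deriv[OF Suc.prems] by (simp add: field_simps)
    qed
    ultimately show ?case using Suc.IH[of ?f'] by (simp add: mult_ac)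
  qed
qed

theorem fourier_Schwartz:
  assumes "f \<in> Schwartz"
  shows "fourier f \<in> Schwartz"
proof (rule Schwartz_coinduct[where P = "fourier ` Schwartz"])
  show "fourier f \<in> fourier ` Schwartz" using assms by simp
  show "rapid_decay g" if "g \<in> fourier ` Schwartz" for g
    using that fourier_rapid_decay by auto
  show "\<exists>g'\<in>fourier ` Schwartz. \<forall>x. (g has_vector_derivative g' x) (at x)"
    if g: "g \<in> fourier ` Schwartz" for g
  proof -
    from g obtain f where f: "f \<in> Schwartz" "g = fourier f" by auto
    show ?thesis unfolding f(2)
      by (intro bexI[where x = "fourier (\<lambda>x. - (2 * pi * \<i>) * (of_real x * f x))"] allI imageI
            fourier_has_vector_derivative Schwartz_mult_left Schwartz_times_x f(1))
  qed
qed

section \<open>The Poisson summation formula\<close>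

text \<open>
  The sine is concave on \<open>[0, \<pi>]\<close>, so it lies above its chord from \<open>0\<close> to \<open>\<pi> / 2\<close>.
\<close>

lemma sin_pi_ge:
  assumes "0 \<le> t" "t \<le> 1 / 2"
  shows "2 * t \<le> sin (pi * t)"
proof -
  have conc: "concave_on {0..pi} sin"
    by (rule f''_le0_imp_concave[where f' = cos and f'' = "\<lambda>x. - sin x"])
       (auto intro!: derivative_eq_intros sin_ge_zero)
  have "(1 - 2 * t) * sin 0 + (2 * t) * sin (pi / 2) \<le> sin ((1 - 2 * t) *\<^sub>R 0 + (2 * t) *\<^sub>R (pi / 2))"
    using assms by (intro concave_onD[OF conc]) auto
  then show ?thesis by (simp add: mult.commute)
qed

lemma norm_cis_minus_one: "norm (cis (2 * pi * t) - 1) = 2 * \<bar>sin (pi * t)\<bar>"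
proof -
  have "cis (2 * pi * t) - 1 = cis (pi * t) * (cis (pi * t) - cis (- (pi * t)))"
    by (simp add: right_diff_distrib cis_mult mult.commute) (simp add: algebra_simps)
  also have "cis (pi * t) - cis (- (pi * t)) = 2 * \<i> * of_real (sin (pi * t))"
    by (simp add: complex_eq_iff)
  finally show ?thesis by (simp add: norm_mult)
qed

lemma norm_cis_minus_one_ge:
  assumes "\<bar>t\<bar> \<le> 1 / 2"
  shows "4 * \<bar>t\<bar> \<le> norm (cis (2 * pi * t) - 1)"
proof (cases "t \<ge> 0")
  case True
  then show ?thesis using sin_pi_ge[of t] assms by (simp add: norm_cis_minus_one)
next
  case False
  then show ?thesis using sin_pi_ge[of "-t"] assms by (simp add: norm_cis_minus_one)
qed

text \<open>
  Compares the decay at a point with the decay at the nearest integer, or after a small translation.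
\<close>

lemma inverse_one_plus_square_shift:
  fixes x s :: real
  assumes "\<bar>x - s\<bar> \<le> 1"
  shows "inverse (1 + s\<^sup>2) \<le> 3 * inverse (1 + x\<^sup>2)"
proof -
  have "(x - s)\<^sup>2 \<le> 1" using assms by (simp add: abs_square_le_1)
  moreover have "0 \<le> (x - 2 * s)\<^sup>2" "0 \<le> s\<^sup>2" by simp_all
  ultimately have "1 + x\<^sup>2 \<le> 3 * (1 + s\<^sup>2)" unfolding power2_eq_square ring_distribs by linarith
  then show ?thesis by (simp add: field_simps add_pos_nonneg)
qed

lemma round_eq_iff: "round x = n \<longleftrightarrow> of_int n - 1 / 2 \<le> x \<and> x < of_int n + (1 / 2 :: real)"
  unfolding round_def floor_eq_iff by linarith

lemma measurable_round [measurable]: "(round :: real \<Rightarrow> int) \<in> measurable borel (count_space UNIV)"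
  unfolding round_def by measurable

lemma cis_two_pi_int [simp]: "cis (2 * pi * of_int n) = 1" "cis (- (2 * pi * of_int n)) = 1"
  by (simp_all add: cis_multiple_2pi flip: cis_inverse)

text \<open>
  The cell is the half-open unit interval around \<open>n\<close>. A character of nonzero integer frequency runs
  through whole periods on it.
\<close>

lemma has_bochner_integral_cis_cell:
  fixes m n :: int
  shows "has_bochner_integral lborel
    (\<lambda>x. if round x = n then cis (- (2 * pi * of_int m * x)) else 0) (if m = 0 then 1 else 0)"
proof -
  let ?a = "real_of_int n - 1 / 2" and ?b = "real_of_int n + 1 / 2"
  have "has_bochner_integral lborel (\<lambda>x. indicator {?a..?b} x *\<^sub>R cis (- (2 * pi * of_int m * x)))
     (if m = 0 then 1 else 0)"
  proof (cases "m = 0")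
    case True
    have "has_bochner_integral lborel (\<lambda>x. indicator {?a..?b} x *\<^sub>R (1::complex)) (of_real ?b - of_real ?a)"
      by (intro has_bochner_integral_FTC_Icc) (auto intro!: derivative_eq_intros)
    with True show ?thesis by simp
  next
    case False
    define c where "c = - (2 * pi * of_int m)"
    have c: "c \<noteq> 0" using False by (simp add: c_def)
    let ?F = "\<lambda>x. cis (c * x) / (c * \<i>)"
    have "has_bochner_integral lborel (\<lambda>x. indicator {?a..?b} x *\<^sub>R cis (c * x)) (?F ?b - ?F ?a)"
    proof (rule has_bochner_integral_FTC_Icc)
      fix x
      have "((\<lambda>x. cis (c * x)) has_vector_derivative c *\<^sub>R (\<i> * cis (c * x))) (at x within {?a..?b})"
        by (auto intro!: derivative_eq_intros simp: has_vector_derivative_def)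
      from has_vector_derivative_divide[OF this, of "c * \<i>"]
      show "(?F has_vector_derivative cis (c * x)) (at x within {?a..?b})"
        using c by (simp add: scaleR_conv_of_real)
    qed (auto intro!: continuous_intros)
    moreover have "cis (c * ?b) = cis (c * ?a)"
    proof -
      have "cis (c * ?b) = cis (c * ?a) * cis (- (2 * pi * of_int m))"
        by (simp add: cis_mult c_def algebra_simps)
      then show ?thesis by simp
    qed
    ultimately show ?thesis using False by (simp add: c_def)
  qed
  then show ?thesis
  proof (rule has_bochner_integralI_AE[OF _ _ AE_mp])
    show "AE x in lborel. x \<noteq> ?b" by (rule AE_lborel_singleton)
    show "AE x in lborel. x \<noteq> ?b \<longrightarrow>
        indicator {?a..?b} x *\<^sub>R cis (- (2 * pi * of_int m * x)) =
        (if round x = n then cis (- (2 * pi * of_int m * x)) else 0)"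
      by (auto simp: round_eq_iff indicator_def)
    have [measurable]: "(\<lambda>x. cis (- (2 * pi * of_int m * x))) \<in> borel_measurable borel"
      by (intro borel_measurable_continuous_onI continuous_intros)
    have "(\<lambda>x. if round x = n then cis (- (2 * pi * of_int m * x)) else 0) \<in> borel_measurable borel"
      by measurable
    then show "(\<lambda>x. if round x = n then cis (- (2 * pi * of_int m * x)) else 0) \<in> borel_measurable lborel"
      by simp
  qed
qed

text \<open>
  The sum is compared with the integral of \<open>1 / (1 + (x / N)\<^sup>2)\<close>, cell by cell. Growth that is no
  worse than linear in \<open>N\<close> is what makes the sum over all combs converge later.
\<close>

lemma sum_int_decay_le:
  fixes F :: "int set" and N :: real
  assumes "finite F" "N \<ge> 1"
  shows "(\<Sum>n\<in>F. inverse (1 + (of_int n / N)\<^sup>2)) \<le> 3 * N * (LINT x|lborel. inverse (1 + x\<^sup>2))"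
proof -
  have int: "integrable lborel (\<lambda>x. inverse (1 + (x / N)\<^sup>2))"
    using lborel_integrable_real_affine[OF integrable_inverse_one_plus_square, of "1 / N" 0] assms
    by simp
  have cell: "has_bochner_integral lborel (\<lambda>x::real. if round x = n then 1 else 0 :: real) 1" for n
  proof -
    have "has_bochner_integral lborel (\<lambda>x. Re (if round x = n then cis (- (2 * pi * of_int 0 * x)) else 0))
        (Re (if (0::int) = 0 then 1 else 0))"
      by (intro has_bochner_integral_Re has_bochner_integral_cis_cell)
    then show ?thesis by (simp add: if_distrib cong: if_cong)
  qed
  have cells: "has_bochner_integral lborel
      (\<lambda>x::real. \<Sum>n\<in>F. inverse (1 + (of_int n / N)\<^sup>2) * (if round x = n then 1 else 0 :: real))
      (\<Sum>n\<in>F. inverse (1 + (of_int n / N)\<^sup>2) * 1)"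
    by (intro has_bochner_integral_sum has_bochner_integral_mult_right cell)
  then have "(\<Sum>n\<in>F. inverse (1 + (of_int n / N)\<^sup>2))
     = integral\<^sup>L lborel (\<lambda>x::real. \<Sum>n\<in>F. inverse (1 + (of_int n / N)\<^sup>2) * (if round x = n then 1 else 0 :: real))"
    by (simp add: has_bochner_integral_iff)
  also have "\<dots> \<le> (LINT x|lborel. 3 * inverse (1 + (x / N)\<^sup>2))"
  proof (rule integral_mono)
    fix x :: real
    have "(\<Sum>n\<in>F. inverse (1 + (of_int n / N)\<^sup>2) * (if round x = n then 1 else 0 :: real))
      = (if round x \<in> F then inverse (1 + (of_int (round x) / N)\<^sup>2) else 0)"
      using assms(1) by (simp add: if_distrib sum.delta cong: if_cong)
    also have "\<dots> \<le> inverse (1 + (of_int (round x) / N)\<^sup>2)" by simp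
    also have "\<dots> \<le> 3 * inverse (1 + (x / N)\<^sup>2)"
    proof (rule inverse_one_plus_square_shift)
      have "\<bar>x / N - of_int (round x) / N\<bar> = \<bar>of_int (round x) - x\<bar> / N"
        using assms(2) by (simp add: diff_divide_distrib[symmetric] abs_minus_commute)
      also have "\<dots> \<le> \<bar>of_int (round x) - x\<bar> / 1"
        using assms(2) by (intro divide_left_mono) auto
      also have "\<dots> \<le> 1" using of_int_round_abs_le[of x] by simp
      finally show "\<bar>x / N - of_int (round x) / N\<bar> \<le> 1" .
    qed
    finally show "(\<Sum>n\<in>F. inverse (1 + (of_int n / N)\<^sup>2) * (if round x = n then 1 else 0 :: real))
       \<le> 3 * inverse (1 + (x / N)\<^sup>2)" .
  next
    show "integrable lborel (\<lambda>x. 3 * inverse (1 + (x / N)\<^sup>2))"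
      using int by (rule integrable_mult_right)
  qed (use cells in \<open>simp add: has_bochner_integral_iff\<close>)
  also have "\<dots> = 3 * (LINT x|lborel. inverse (1 + (x / N)\<^sup>2))"
    by simp
  also have "(LINT x|lborel. inverse (1 + (x / N)\<^sup>2)) = N * (LINT x|lborel. inverse (1 + x\<^sup>2))"
    using lborel_integral_real_affine[of "1 / N" "\<lambda>x. inverse (1 + x\<^sup>2)" 0] assms(2) by simp
  finally show ?thesis by simp
qed

lemma summable_on_int_decay: "(\<lambda>n::int. inverse (1 + (of_int n)\<^sup>2) :: real) summable_on UNIV"
  using sum_int_decay_le[of _ 1]
  by (intro nonneg_bdd_above_summable_on)
     (auto simp: bdd_above_def intro!: exI[of _ "3 * (LINT x|lborel. inverse (1 + x\<^sup>2))"])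

lemma has_sum_int_symmetric_limit:
  assumes "(f has_sum S) (UNIV :: int set)"
  shows "(\<lambda>M. \<Sum>n\<in>{- int M..int M}. f n) \<longlonglongrightarrow> S"
proof -
  have "filterlim (\<lambda>M. {- int M..int M}) (finite_subsets_at_top UNIV) sequentially"
    unfolding filterlim_finite_subsets_at_top
  proof (intro allI impI)
    fix X :: "int set" assume "finite X \<and> X \<subseteq> UNIV"
    then obtain B where B: "\<And>x. x \<in> X \<Longrightarrow> \<bar>x\<bar> \<le> B"
      by (metis finite_imageI bdd_above_finite bdd_above_def imageI)
    show "\<forall>\<^sub>F M in sequentially. finite {- int M..int M} \<and> X \<subseteq> {- int M..int M} \<and> {- int M..int M} \<subseteq> UNIV"
      using eventually_ge_at_top[of "nat B"]
    proof eventually_elim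
      case (elim M)
      then have "B \<le> int M" by linarith
      then show ?case using B by fastforce
    qed
  qed
  with assms show ?thesis
    unfolding has_sum_def by (rule filterlim_compose)
qed

text \<open>
  Translation by half a period \<open>s = 1 / (2 y)\<close> of the character flips its sign, so twice the
  transform of \<open>g\<close> at \<open>y\<close> is the transform of \<open>g x - g (x + s)\<close>. As \<open>s\<close> tends to 0 this
  difference tends to 0 at the points of continuity of \<open>g\<close>, and the bound on \<open>g\<close> dominates it.
\<close>

lemma riemann_lebesgue_decay:
  fixes g :: "real \<Rightarrow> complex"
  assumes meas: "g \<in> borel_measurable borel"
    and bound: "\<And>x. norm (g x) \<le> C * inverse (1 + x\<^sup>2)"
    and cont: "AE x in lborel. isCont g x"
    and y: "\<And>j. \<bar>y j\<bar> \<ge> 1" "filterlim (\<lambda>j. \<bar>y j\<bar>) at_top sequentially"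
  shows "(\<lambda>j. fourier g (y j)) \<longlonglongrightarrow> 0"
proof (rule Lim_null_comparison)
  define s where "s j = 1 / (2 * y j)" for j
  have y0: "y j \<noteq> 0" for j using y(1)[of j] by auto
  have s1: "\<bar>s j\<bar> \<le> 1" for j using y(1)[of j] by (simp add: s_def abs_mult divide_simps)
  have C: "C \<ge> 0" using order_trans[OF norm_ge_zero bound[of 0]] by simp
  have g: "integrable lborel g" by (rule integrable_of_decay[OF meas bound])
  have gs: "integrable lborel (\<lambda>x. g (x + s j))" for j
    using lborel_integrable_real_affine[OF g, of 1 "s j"] by (simp add: add.commute)
  show "\<forall>\<^sub>F j in sequentially. norm (fourier g (y j)) \<le> (LINT x|lborel. norm (g x - g (x + s j)))"
  proof (intro always_eventually allI)
    fix j
    let ?e = "\<lambda>x. cis (- (2 * pi * y j) * x)"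
    have "fourier g (y j) = (LINT x|lborel. ?e (s j + 1 * x) * g (s j + 1 * x))"
      unfolding fourier_cis
      using lborel_integral_real_affine[of 1 "\<lambda>x. cis (- (2 * pi * y j * x)) * g x" "s j"]
      by (simp only: abs_one scaleR_one) simp
    also have "\<dots> = (LINT x|lborel. - (?e x * g (x + s j)))"
    proof (intro Bochner_Integration.integral_cong refl)
      fix x
      have "?e (s j + 1 * x) = cis (- pi) * ?e x"
        using y0[of j] by (simp add: cis_mult s_def algebra_simps)
      also have "cis (- pi) = - 1" by (simp add: complex_eq_iff)
      finally show "?e (s j + 1 * x) * g (s j + 1 * x) = - (?e x * g (x + s j))"
        by (simp add: add.commute)
    qed
    finally have "2 * fourier g (y j) = (LINT x|lborel. ?e x * g x) + (LINT x|lborel. - (?e x * g (x + s j)))"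
      by (simp add: fourier_cis)
    also have "\<dots> = (LINT x|lborel. ?e x * (g x - g (x + s j)))"
      using integrable_cis_mult[OF g, of "- (2 * pi * y j)"] integrable_cis_mult[OF gs, of "- (2 * pi * y j)"]
      by (subst Bochner_Integration.integral_add[symmetric])
         (auto intro!: Bochner_Integration.integral_cong simp: algebra_simps)
    finally have "norm (2 * fourier g (y j)) \<le> (LINT x|lborel. norm (?e x * (g x - g (x + s j))))"
      by simp
    then have "2 * norm (fourier g (y j)) \<le> (LINT x|lborel. norm (g x - g (x + s j)))"
      by (simp add: norm_mult)
    then show "norm (fourier g (y j)) \<le> (LINT x|lborel. norm (g x - g (x + s j)))"
      using norm_ge_zero[of "fourier g (y j)"] by linarith
  qed
  have s: "s \<longlonglongrightarrow> 0"
  proof (rule tendsto_rabs_zero_cancel)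
    have "(\<lambda>j. inverse \<bar>y j\<bar>) \<longlonglongrightarrow> 0"
      by (rule tendsto_inverse_0_at_top) fact
    then have "(\<lambda>j. 1 / 2 * inverse \<bar>y j\<bar>) \<longlonglongrightarrow> 0"
      by (rule tendsto_mult_right_zero)
    moreover have "\<bar>s j\<bar> = 1 / 2 * inverse \<bar>y j\<bar>" for j
      by (simp add: s_def abs_mult inverse_eq_divide)
    ultimately show "(\<lambda>j. \<bar>s j\<bar>) \<longlonglongrightarrow> 0" by (simp only:)
  qed
  have "(\<lambda>j. LINT x|lborel. norm (g x - g (x + s j))) \<longlonglongrightarrow> (LINT x|lborel. (\<lambda>_. 0 :: real) (x :: real))"
  proof (rule integral_dominated_convergence)
    show "integrable lborel (\<lambda>x. 4 * C * inverse (1 + x\<^sup>2))"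
      by (intro integrable_mult_right integrable_inverse_one_plus_square)
    show "AE x in lborel. norm (norm (g x - g (x + s j))) \<le> 4 * C * inverse (1 + x\<^sup>2)" for j
    proof (rule AE_I2)
      fix x
      have "norm (g x - g (x + s j)) \<le> norm (g x) + norm (g (x + s j))" by (rule norm_triangle_ineq4)
      also have "norm (g (x + s j)) \<le> C * inverse (1 + (x + s j)\<^sup>2)" by (rule bound)
      also have "\<dots> \<le> C * (3 * inverse (1 + x\<^sup>2))"
        using s1 C by (intro mult_left_mono inverse_one_plus_square_shift) auto
      finally show "norm (norm (g x - g (x + s j))) \<le> 4 * C * inverse (1 + x\<^sup>2)"
        using bound[of x] by simp
    qed
    show "AE x in lborel. (\<lambda>j. norm (g x - g (x + s j))) \<longlonglongrightarrow> 0"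
      using cont
    proof eventually_elim
      case (elim x)
      have "(\<lambda>j. x + s j) \<longlonglongrightarrow> x + 0" by (intro tendsto_add tendsto_const s)
      then have "(\<lambda>j. g (x + s j)) \<longlonglongrightarrow> g x"
        using isCont_tendsto_compose[OF elim] by simp
      from tendsto_norm[OF tendsto_diff[OF tendsto_const[of "g x"] this]]
      show ?case by simp
    qed
  qed (use meas in measurable)
  then show "(\<lambda>j. LINT x|lborel. norm (g x - g (x + s j))) \<longlonglongrightarrow> 0" by simp
qed

text \<open>
  Subtracting from \<open>f\<close> its value at the nearest integer leaves a function \<open>h\<close> that vanishes to first
  order at every integer; its jumps are at the half-integers, where they do no harm. Hence \<open>h\<close> is
  \<open>exp (2 \<pi> \<i> x) - 1\<close> times an integrable function \<open>g\<close>, and the values of the Fourier transform of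
  \<open>h\<close> at the integers are differences of consecutive values of that of \<open>g\<close>. Their symmetric sums
  telescope and tend to 0 by the Riemann-Lebesgue lemma. The piecewise constant part \<open>f - h\<close> has
  an explicit transform at the integers.
\<close>

locale poisson_remainder =
  fixes f :: "real \<Rightarrow> complex"
  assumes Schwartz: "f \<in> Schwartz"
begin

definition h where "h x = f x - f (of_int (round x))"

definition g where "g x = h x / (cis (2 * pi * x) - 1)"

lemma round_decomp: "cis (2 * pi * x) = cis (2 * pi * (x - of_int (round x)))"
proof -
  have "cis (2 * pi * (x - of_int (round x))) = cis (2 * pi * x) * cis (- (2 * pi * of_int (round x)))"
    by (simp add: cis_mult algebra_simps del: cis_two_pi_int)
  then show ?thesis by simp
qed

lemma cis_eq_1_imp_round:
  assumes "cis (2 * pi * x) = 1"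
  shows "of_int (round x) = x"
proof -
  have "\<bar>x - of_int (round x)\<bar> \<le> 1 / 2"
    using of_int_round_abs_le[of x] by (simp add: abs_minus_commute)
  from norm_cis_minus_one_ge[OF this] assms show ?thesis
    by (simp add: round_decomp[symmetric])
qed

lemma h_eq: "h x = (cis (2 * pi * x) - 1) * g x"
proof (cases "cis (2 * pi * x) = 1")
  \<comment> \<open>Only at the integers; there \<open>h\<close> vanishes.\<close>
  case True
  then show ?thesis using cis_eq_1_imp_round[OF True] by (simp add: h_def)
qed (simp add: g_def)

lemma h_measurable [measurable]: "h \<in> borel_measurable borel"
proof -
  have [measurable]: "f \<in> borel_measurable borel" using Schwartz by (rule Schwartz_measurable)
  show ?thesis unfolding h_def by measurable
qed

lemma g_measurable [measurable]: "g \<in> borel_measurable borel"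
proof -
  have [measurable]: "(\<lambda>x. cis (2 * pi * x)) \<in> borel_measurable borel"
    by (intro borel_measurable_continuous_onI continuous_intros)
  show ?thesis unfolding g_def by measurable
qed

lemma norm_h_le:
  "norm (h x) \<le> (3 * decay_norm (\<lambda>x. vector_derivative f (at x)) * inverse (1 + x\<^sup>2)) * \<bar>x - of_int (round x)\<bar>"
proof -
  let ?n = "real_of_int (round x)" and ?f' = "\<lambda>x. vector_derivative f (at x)"
  have f': "?f' \<in> Schwartz" using Schwartz by (rule Schwartz_deriv)
  have "norm (f x - f ?n) \<le> (3 * decay_norm ?f' * inverse (1 + x\<^sup>2)) * norm (x - ?n)"
  proof (rule differentiable_bound[where S = "cball x 1" and f' = "\<lambda>s t. t *\<^sub>R ?f' s"])
    fix s assume s: "s \<in> cball x 1"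
    show "(f has_derivative (\<lambda>t. t *\<^sub>R ?f' s)) (at s within cball x 1)"
      using Schwartz_has_vector_derivative[OF Schwartz]
      by (auto simp: has_vector_derivative_def intro: has_derivative_at_withinI)
    show "onorm (\<lambda>t. t *\<^sub>R ?f' s) \<le> 3 * decay_norm ?f' * inverse (1 + x\<^sup>2)"
    proof (rule onorm_le)
      fix t :: real
      have "norm (?f' s) \<le> decay_norm ?f' * inverse (1 + s\<^sup>2)" by (rule Schwartz_decay[OF f'])
      also have "\<dots> \<le> decay_norm ?f' * (3 * inverse (1 + x\<^sup>2))"
        using s by (intro mult_left_mono inverse_one_plus_square_shift decay_norm_nonneg f')
          (auto simp: dist_real_def)
      finally have "norm (?f' s) * norm t \<le> (3 * decay_norm ?f' * inverse (1 + x\<^sup>2)) * norm t"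
        by (intro mult_right_mono) (auto simp: mult_ac)
      then show "norm (t *\<^sub>R ?f' s) \<le> (3 * decay_norm ?f' * inverse (1 + x\<^sup>2)) * norm t"
        by (simp add: mult.commute)
    qed
  next
    show "?n \<in> cball x 1"
      unfolding mem_cball dist_real_def using of_int_round_abs_le[of x] by linarith
  qed auto
  then show ?thesis by (simp add: h_def)
qed

definition C where "C = 3 * decay_norm (\<lambda>x. vector_derivative f (at x))"

lemma C_nonneg: "C \<ge> 0"
  unfolding C_def using decay_norm_nonneg[OF Schwartz_deriv[OF Schwartz]] by simp

lemma norm_g_le: "norm (g x) \<le> C * inverse (1 + x\<^sup>2)"
proof (cases "x = of_int (round x)")
  case True
  then have "h x = 0" by (simp add: h_def)
  then show ?thesis using C_nonneg by (simp add: g_def)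
next
  case False
  define t where "t = \<bar>x - of_int (round x)\<bar>"
  have t: "t > 0" using False by (simp add: t_def)
  have "\<bar>x - of_int (round x)\<bar> \<le> 1 / 2"
    using of_int_round_abs_le[of x] by (simp add: abs_minus_commute)
  then have den: "4 * t \<le> norm (cis (2 * pi * x) - 1)"
    using norm_cis_minus_one_ge by (simp add: round_decomp[of x] t_def)
  have "norm (g x) = norm (h x) / norm (cis (2 * pi * x) - 1)" by (simp add: g_def norm_divide)
  also have "\<dots> \<le> norm (h x) / (4 * t)"
    using t den by (intro divide_left_mono mult_pos_pos norm_ge_zero) linarith+
  also have "\<dots> \<le> (C * inverse (1 + x\<^sup>2) * t) / (4 * t)"
    using norm_h_le[of x] t by (intro divide_right_mono) (auto simp: C_def t_def)
  also have "\<dots> = (C * inverse (1 + x\<^sup>2)) / 4" using t by simp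
  also have "\<dots> \<le> (C * inverse (1 + x\<^sup>2)) / 1"
    using C_nonneg by (intro divide_left_mono) auto
  finally show ?thesis by simp
qed

lemma norm_h_le': "norm (h x) \<le> C * inverse (1 + x\<^sup>2)"
proof -
  have "norm (h x) \<le> C * inverse (1 + x\<^sup>2) * \<bar>x - of_int (round x)\<bar>"
    using norm_h_le by (simp add: C_def)
  also have "\<dots> \<le> C * inverse (1 + x\<^sup>2) * 1"
    using C_nonneg of_int_round_abs_le[of x] by (intro mult_left_mono) (auto simp: abs_minus_commute)
  finally show ?thesis by simp
qed

lemma g_integrable: "integrable lborel g" and h_integrable: "integrable lborel h"
  by (rule integrable_of_decay[OF g_measurable norm_g_le])
     (rule integrable_of_decay[OF h_measurable norm_h_le'])

lemma isCont_g:
  assumes "x \<notin> range (\<lambda>n::int. of_int n / 2)"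
  shows "isCont g x"
proof -
  have "x \<noteq> of_int n" for n :: int
    using assms rangeI[of "\<lambda>n::int. real_of_int n / 2" "2 * n"] by auto
  from this[of "round x"] have 1: "cis (2 * pi * x) - 1 \<noteq> 0" using cis_eq_1_imp_round[of x] by auto
  have "x + 1 / 2 \<notin> \<int>"
  proof
    assume "x + 1 / 2 \<in> \<int>"
    then obtain n :: int where "x + 1 / 2 = of_int n" by (auto elim: Ints_cases)
    then have "x = of_int (2 * n - 1) / 2" by simp
    with assms show False by blast
  qed
  then have "\<forall>\<^sub>F y in nhds (x + 1 / 2). \<lfloor>y\<rfloor> = \<lfloor>x + 1 / 2\<rfloor>"
    using eventually_floor_eq[OF filterlim_ident] by blast
  moreover have "filterlim (\<lambda>y. y + 1 / 2) (nhds (x + 1 / 2)) (nhds x)"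
    by (intro tendsto_intros filterlim_ident)
  ultimately have ev: "\<forall>\<^sub>F y in nhds x. round y = round x"
    unfolding round_def filterlim_iff by blast
  have "isCont (\<lambda>y. (f y - f (of_int (round x))) / (cis (2 * pi * y) - 1)) x"
  proof (rule continuous_divide)
    show "isCont (\<lambda>y. f y - f (of_int (round x))) x"
      using Schwartz_continuous[OF Schwartz, of UNIV]
      by (intro continuous_intros) (simp add: continuous_on_eq_continuous_at)
    have "continuous_on UNIV (\<lambda>y. cis (2 * pi * y) - 1)" by (intro continuous_intros)
    then show "isCont (\<lambda>y. cis (2 * pi * y) - 1) x" by (simp add: continuous_on_eq_continuous_at)
  qed (use 1 in simp)
  moreover have "\<forall>\<^sub>F y in nhds x. g y = (f y - f (of_int (round x))) / (cis (2 * pi * y) - 1)"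
    using ev by eventually_elim (simp add: g_def h_def)
  ultimately show ?thesis by (simp add: isCont_cong)
qed

lemma AE_isCont_g: "AE x in lborel. isCont g x"
proof (rule AE_I')
  show "range (\<lambda>n::int. real_of_int n / 2) \<in> null_sets lborel"
    by (intro countable_imp_null_set_lborel countable_image) auto
  show "{x \<in> space lborel. \<not> isCont g x} \<subseteq> range (\<lambda>n::int. real_of_int n / 2)"
    using isCont_g by blast
qed

lemma fourier_h_telescope: "fourier h (of_int m) = fourier g (of_int (m - 1)) - fourier g (of_int m)"
proof -
  have "fourier h (of_int m) = (LINT x|lborel. cis (- (2 * pi * of_int (m - 1)) * x) * g x
      - cis (- (2 * pi * of_int m) * x) * g x)"
    unfolding fourier_cis
  proof (intro Bochner_Integration.integral_cong refl)
    fix x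
    have "cis (- (2 * pi * of_int (m - 1)) * x) = cis (- (2 * pi * of_int m * x)) * cis (2 * pi * x)"
      by (simp add: cis_mult algebra_simps)
    then show "cis (- (2 * pi * of_int m * x)) * h x = cis (- (2 * pi * of_int (m - 1)) * x) * g x
      - cis (- (2 * pi * of_int m) * x) * g x"
      by (simp add: h_eq algebra_simps)
  qed
  also have "\<dots> = fourier g (of_int (m - 1)) - fourier g (of_int m)"
    using integrable_cis_mult[OF g_integrable, of "- (2 * pi * of_int (m - 1))"]
      integrable_cis_mult[OF g_integrable, of "- (2 * pi * of_int m)"]
    by (simp add: fourier_cis)
  finally show ?thesis .
qed

lemma sum_fourier_h: "(\<Sum>m\<in>{- int M..int M}. fourier h (of_int m))
    = fourier g (of_int (- int M - 1)) - fourier g (of_int (int M))"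
proof (induction M)
  case 0
  then show ?case by (simp add: fourier_h_telescope[of 0, simplified])
next
  case (Suc M)
  have "{- int (Suc M)..int (Suc M)} = insert (- int M - 1) (insert (int M + 1) {- int M..int M})"
    by auto
  then have "(\<Sum>m\<in>{- int (Suc M)..int (Suc M)}. fourier h (of_int m))
      = fourier h (of_int (- int M - 1)) + (fourier h (of_int (int M + 1)) +
          (\<Sum>m\<in>{- int M..int M}. fourier h (of_int m)))"
    by (simp only:) (subst sum.insert; simp)+
  also have "\<dots> = fourier g (of_int (- int (Suc M) - 1)) - fourier g (of_int (int (Suc M)))"
    unfolding Suc.IH fourier_h_telescope[of "- int M - 1"] fourier_h_telescope[of "int M + 1"]
    by (simp add: algebra_simps)
  finally show ?case .
qed

lemma sum_fourier_h_tendsto_0: "(\<lambda>M. \<Sum>m\<in>{- int M..int M}. fourier h (of_int m)) \<longlonglongrightarrow> 0"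
proof (rule LIMSEQ_imp_Suc)
  have "(\<lambda>M. fourier g (of_int (- int (Suc M) - 1))) \<longlonglongrightarrow> 0"
    by (rule riemann_lebesgue_decay[OF g_measurable norm_g_le AE_isCont_g]) (simp, real_asymp)
  moreover have "(\<lambda>M. fourier g (of_int (int (Suc M)))) \<longlonglongrightarrow> 0"
    by (rule riemann_lebesgue_decay[OF g_measurable norm_g_le AE_isCont_g]) (simp, real_asymp)
  ultimately show "(\<lambda>M. \<Sum>m\<in>{- int (Suc M)..int (Suc M)}. fourier h (of_int m)) \<longlonglongrightarrow> 0"
    unfolding sum_fourier_h using tendsto_diff by fastforce
qed

end

lemma Schwartz_abs_summable_int:
  assumes "f \<in> Schwartz"
  shows "(\<lambda>n::int. norm (f (of_int n))) summable_on UNIV"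
  by (rule summable_on_comparison_test[OF summable_on_cmult_right[OF summable_on_int_decay, of "decay_norm f"]])
     (simp_all add: Schwartz_decay assms)

text \<open>
  For finitely many cells this is the cell integral above; dominated convergence gives the rest.
\<close>

lemma fourier_round:
  assumes "f \<in> Schwartz"
  shows "fourier (\<lambda>x::real. f (of_int (round x))) (of_int m) = (if m = 0 then \<Sum>\<^sub>\<infinity>n::int. f (of_int n) else 0)"
proof (rule LIMSEQ_unique)
  have [measurable]: "f \<in> borel_measurable borel" using assms by (rule Schwartz_measurable)
  let ?S = "\<lambda>M x. \<Sum>n\<in>{- int M..int M}. f (of_int n) *
      (if round x = n then cis (- (2 * pi * of_int m * x)) else 0)"
  have cells: "has_bochner_integral lborel (?S M) (\<Sum>n\<in>{- int M..int M}. f (of_int n) * (if m = 0 then 1 else 0))" for M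
    by (intro has_bochner_integral_sum has_bochner_integral_mult_right has_bochner_integral_cis_cell)
  have S_eq: "?S M x = (if round x \<in> {- int M..int M} then cis (- (2 * pi * of_int m * x)) * f (of_int (round x)) else 0)"
    for M x by (simp add: if_distrib mult.commute cong: if_cong)
  have [measurable]: "(\<lambda>x. cis (- (2 * pi * of_int m * x))) \<in> borel_measurable borel"
      by (intro borel_measurable_continuous_onI continuous_intros)
  have "(\<lambda>M. LINT x|lborel. ?S M x) \<longlonglongrightarrow> (LINT x|lborel. cis (- (2 * pi * of_int m * x)) * f (of_int (round x)))"
  proof (rule integral_dominated_convergence)
    show "integrable lborel (\<lambda>x. 3 * decay_norm f * inverse (1 + x\<^sup>2))"
      by (intro integrable_mult_right integrable_inverse_one_plus_square)
    show "AE x in lborel. norm (?S M x) \<le> 3 * decay_norm f * inverse (1 + x\<^sup>2)" for M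
    proof (rule AE_I2)
      fix x
      have "norm (?S M x) \<le> norm (f (of_int (round x)))"
        unfolding S_eq by (simp add: norm_mult)
      also have "\<dots> \<le> decay_norm f * inverse (1 + (of_int (round x))\<^sup>2)"
        by (rule Schwartz_decay[OF assms])
      also have "\<dots> \<le> decay_norm f * (3 * inverse (1 + x\<^sup>2))"
        using of_int_round_abs_le[of x]
        by (intro mult_left_mono inverse_one_plus_square_shift decay_norm_nonneg assms)
           (simp add: abs_minus_commute)
      finally show "norm (?S M x) \<le> 3 * decay_norm f * inverse (1 + x\<^sup>2)" by simp
    qed
    show "AE x in lborel. (\<lambda>M. ?S M x) \<longlonglongrightarrow> cis (- (2 * pi * of_int m * x)) * f (of_int (round x))"
    proof (rule AE_I2)
      fix x :: real
      have "\<forall>\<^sub>F M in sequentially. ?S M x = cis (- (2 * pi * of_int m * x)) * f (of_int (round x))"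
        using eventually_ge_at_top[of "nat \<bar>round x\<bar>"]
        by eventually_elim (auto simp: S_eq)
      then show "(\<lambda>M. ?S M x) \<longlonglongrightarrow> cis (- (2 * pi * of_int m * x)) * f (of_int (round x))"
        by (rule tendsto_eventually)
    qed
    show "?S M \<in> borel_measurable lborel" for M
      using cells by (simp add: has_bochner_integral_iff)
    have "(\<lambda>x. cis (- (2 * pi * of_int m * x)) * f (of_int (round x))) \<in> borel_measurable borel"
      by measurable
    then show "(\<lambda>x. cis (- (2 * pi * of_int m * x)) * f (of_int (round x))) \<in> borel_measurable lborel"
      by simp
  qed
  then show "(\<lambda>M. \<Sum>n\<in>{- int M..int M}. f (of_int n) * (if m = 0 then 1 else 0))
      \<longlonglongrightarrow> fourier (\<lambda>x. f (of_int (round x))) (of_int m)"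
    unfolding fourier_cis using cells by (simp only: has_bochner_integral_iff)
  have "((\<lambda>n::int. f (of_int n)) has_sum (\<Sum>\<^sub>\<infinity>n::int. f (of_int n))) UNIV"
    by (rule has_sum_infsum[OF abs_summable_summable[OF Schwartz_abs_summable_int[OF assms]]])
  from tendsto_mult_right[OF has_sum_int_symmetric_limit[OF this], of "if m = 0 then 1 else 0"]
  have "(\<lambda>M. \<Sum>n\<in>{- int M..int M}. f (of_int n) * (if m = 0 then 1 else 0))
      \<longlonglongrightarrow> (\<Sum>\<^sub>\<infinity>n::int. f (of_int n)) * (if m = 0 then 1 else 0)"
    by (simp only: sum_distrib_right)
  also have "(\<Sum>\<^sub>\<infinity>n::int. f (of_int n)) * (if m = 0 then 1 else 0) = (if m = 0 then \<Sum>\<^sub>\<infinity>n::int. f (of_int n) else 0)"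
    by simp
  finally show "(\<lambda>M. \<Sum>n\<in>{- int M..int M}. f (of_int n) * (if m = 0 then 1 else 0))
      \<longlonglongrightarrow> (if m = 0 then \<Sum>\<^sub>\<infinity>n::int. f (of_int n) else 0)" .
qed

text \<open>
  Both sides are the limit of the symmetric partial sums of the transform of \<open>f\<close>: the part \<open>h\<close>
  contributes nothing in the limit, the piecewise constant part contributes only at frequency 0.
\<close>

theorem poisson_summation:
  assumes "f \<in> Schwartz"
  shows "(\<Sum>\<^sub>\<infinity>m::int. fourier f (of_int m)) = (\<Sum>\<^sub>\<infinity>n::int. f (of_int n))"
proof (rule LIMSEQ_unique)
  interpret poisson_remainder f by unfold_locales fact
  let ?r = "\<lambda>x::real. f (of_int (round x))"
  have r: "integrable lborel ?r"
    using Bochner_Integration.integrable_diff[OF Schwartz_integrable[OF assms] h_integrable]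
    by (simp add: h_def)
  have split: "fourier f (of_int m) = fourier h (of_int m) + fourier ?r (of_int m)" for m :: int
  proof -
    have "(LINT x|lborel. cis (- (2 * pi * of_int m) * x) * h x + cis (- (2 * pi * of_int m) * x) * ?r x)
        = fourier h (of_int m) + fourier ?r (of_int m)"
      using integrable_cis_mult[OF h_integrable, of "- (2 * pi * of_int m)"]
        integrable_cis_mult[OF r, of "- (2 * pi * of_int m)"]
      by (simp add: fourier_cis)
    then show ?thesis by (simp add: fourier_cis h_def algebra_simps)
  qed
  have "(\<lambda>M. (\<Sum>m\<in>{- int M..int M}. fourier h (of_int m)) + (\<Sum>\<^sub>\<infinity>n::int. f (of_int n)))
      \<longlonglongrightarrow> 0 + (\<Sum>\<^sub>\<infinity>n::int. f (of_int n))"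
    by (intro tendsto_add tendsto_const sum_fourier_h_tendsto_0)
  then show "(\<lambda>M. \<Sum>m\<in>{- int M..int M}. fourier f (of_int m)) \<longlonglongrightarrow> (\<Sum>\<^sub>\<infinity>n::int. f (of_int n))"
    by (simp add: split sum.distrib fourier_round[OF assms])
  have "((\<lambda>m::int. fourier f (of_int m)) has_sum (\<Sum>\<^sub>\<infinity>m::int. fourier f (of_int m))) UNIV"
    by (rule has_sum_infsum[OF abs_summable_summable[OF Schwartz_abs_summable_int[OF fourier_Schwartz[OF assms]]]])
  from has_sum_int_symmetric_limit[OF this]
  show "(\<lambda>M. \<Sum>m\<in>{- int M..int M}. fourier f (of_int m)) \<longlonglongrightarrow> (\<Sum>\<^sub>\<infinity>m::int. fourier f (of_int m))" .
qed

lemma poisson_summation_lattice: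
  assumes "f \<in> Schwartz" "N > 0"
  shows "(\<Sum>\<^sub>\<infinity>m::int. fourier f (N * of_int m)) = 1 / of_real N * (\<Sum>\<^sub>\<infinity>n::int. f (of_int n / N))"
proof -
  have "fourier (\<lambda>x. f (1 / N * x)) y = of_real N * fourier f (N * y)" for y
  proof -
    have "fourier (\<lambda>x. f (1 / N * x)) y
        = \<bar>N\<bar> *\<^sub>R (LINT x|lborel. cis (- (2 * pi * y * (0 + N * x))) * f (1 / N * (0 + N * x)))"
      unfolding fourier_cis using assms(2) by (intro lborel_integral_real_affine) simp
    then show ?thesis using assms(2) by (simp add: fourier_cis scaleR_conv_of_real mult_ac)
  qed
  then have "(\<Sum>\<^sub>\<infinity>m::int. of_real N * fourier f (N * of_int m)) = (\<Sum>\<^sub>\<infinity>n::int. f (1 / N * of_int n))"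
    using poisson_summation[OF Schwartz_rescale[OF assms(1), of "1 / N"]] assms(2) by simp
  then show ?thesis
    using assms(2) by (simp add: infsum_cmult_right' field_simps)
qed

section \<open>Squarefree sums and Euler products\<close>

definition primes_le :: "nat \<Rightarrow> nat set" where
  "primes_le N = {p. prime p \<and> p \<le> N}"

lemma finite_primes_le [simp]: "finite (primes_le N)"
  by (rule finite_subset[of _ "{..N}"]) (auto simp: primes_le_def)

lemma eventually_subset_primes_le:
  assumes "finite Q" "\<And>p. p \<in> Q \<Longrightarrow> prime p"
  shows "\<forall>\<^sub>F N in sequentially. Q \<subseteq> primes_le N"
proof -
  obtain B where B: "\<And>p. p \<in> Q \<Longrightarrow> p \<le> B"
    using assms(1) by (meson finite_nat_set_iff_bounded_le)
  show ?thesis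
    using eventually_ge_at_top[of B]
  proof eventually_elim
    case (elim N)
    have "p \<le> N" if "p \<in> Q" for p using B[OF that] elim by simp
    with assms(2) show ?case by (auto simp: primes_le_def)
  qed
qed

text \<open>
  For nonnegative terms the sums along one exhausting sequence of finite sets bound all finite sums,
  and so determine the unconditional sum.
\<close>

lemma has_sum_exhaustion:
  fixes f :: "'a \<Rightarrow> real"
  assumes nonneg: "\<And>x. x \<in> A \<Longrightarrow> f x \<ge> 0"
    and fin: "\<And>N. finite (F N)" "\<And>N. F N \<subseteq> A"
    and cover: "\<And>x. x \<in> A \<Longrightarrow> \<forall>\<^sub>F N in sequentially. x \<in> F N"
    and lim: "(\<lambda>N. sum f (F N)) \<longlonglongrightarrow> L"
  shows "(f has_sum L) A"
proof -
  have ev: "\<forall>\<^sub>F N in sequentially. X \<subseteq> F N" if "finite X" "X \<subseteq> A" for X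
  proof -
    have "\<forall>\<^sub>F N in sequentially. \<forall>x\<in>X. x \<in> F N"
      using that cover by (intro eventually_ball_finite) auto
    then show ?thesis by eventually_elim auto
  qed
  have "sum f X \<le> L" if X: "finite X" "X \<subseteq> A" for X
  proof (rule tendsto_lowerbound[OF lim])
    show "\<forall>\<^sub>F N in sequentially. sum f X \<le> sum f (F N)"
      using ev[OF X]
      by eventually_elim (meson sum_mono2 fin nonneg DiffD1 subsetD)
  qed simp
  then have "f summable_on A"
    using nonneg by (intro nonneg_bdd_above_summable_on) (auto simp: bdd_above_def)
  then have sum: "(f has_sum infsum f A) A" by (rule has_sum_infsum)
  have "filterlim F (finite_subsets_at_top A) sequentially"
    unfolding filterlim_finite_subsets_at_top using ev fin by (auto elim: eventually_mono)
  with sum have "(\<lambda>N. sum f (F N)) \<longlonglongrightarrow> infsum f A"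
    unfolding has_sum_def by (rule filterlim_compose)
  with lim sum show ?thesis using LIMSEQ_unique by blast
qed

lemma prime_factors_prod_primes:
  assumes "finite X" "\<And>p. p \<in> X \<Longrightarrow> prime (p::nat)"
  shows "prime_factors (\<Prod>X) = X"
proof -
  have "prime_factors (\<Prod>X) = (\<Union>p\<in>X. prime_factors p)"
    using assms by (subst prime_factors_prod) (auto dest: assms(2))
  also have "\<dots> = X"
    using assms(2) by (auto simp: prime_prime_factors)
  finally show ?thesis .
qed

lemma squarefree_prod_primes:
  assumes "\<And>p. p \<in> X \<Longrightarrow> prime (p::nat)"
  shows "squarefree (\<Prod>X)"
  using assms by (intro squarefree_prod_coprime) (auto simp: primes_coprime squarefree_prime)

lemma prod_prime_factors_squarefree:
  assumes "squarefree (d::nat)"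
  shows "\<Prod>(prime_factors d) = d"
proof -
  have "d \<noteq> 0" using assms by (metis not_squarefree_0)
  then have "d = (\<Prod>p\<in>prime_factors d. p ^ multiplicity p d)"
    by (simp add: prime_factorization_nat)
  also have "\<dots> = \<Prod>(prime_factors d)"
    using assms \<open>d \<noteq> 0\<close> by (intro prod.cong) (auto simp: squarefree_factorial_semiring')
  finally show ?thesis ..
qed

definition euler_product_tends :: "(nat \<Rightarrow> real) \<Rightarrow> real \<Rightarrow> bool" where
  "euler_product_tends f L \<longleftrightarrow> (\<lambda>N. \<Prod>p\<in>primes_le N. f p) \<longlonglongrightarrow> L"

text \<open>
  Multiplying out the product over the primes up to \<open>N\<close> means choosing a summand at each prime. The
  set of primes where \<open>g p\<close> is chosen is the set of prime factors of a unique squarefree \<open>d\<close>. At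
  the primes in \<open>Q\<close> the summand 1 is missing, so these primes must divide \<open>d\<close>.
\<close>

lemma squarefree_sum_eq_euler_product:
  fixes g :: "nat \<Rightarrow> real"
  assumes g: "\<And>p. prime p \<Longrightarrow> g p \<ge> 0"
    and Q: "finite Q" "\<And>p. p \<in> Q \<Longrightarrow> prime p"
    and lim: "euler_product_tends (\<lambda>p. g p + (if p \<in> Q then 0 else 1)) L"
  shows "((\<lambda>d. \<Prod>p\<in>prime_factors d. g p) has_sum L)
    {d. d \<ge> 1 \<and> squarefree d \<and> Q \<subseteq> prime_factors d}"
proof (rule has_sum_exhaustion)
  let ?A = "{d. d \<ge> 1 \<and> squarefree d \<and> Q \<subseteq> prime_factors d}"
  let ?F = "\<lambda>N. {d\<in>?A. prime_factors d \<subseteq> primes_le N}"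
  let ?P = "\<lambda>N. {X\<in>Pow (primes_le N). Q \<subseteq> X}"
  have bij: "bij_betw (\<lambda>X. \<Prod>X) (?P N) (?F N)" for N
  proof (rule bij_betw_byWitness[where f' = prime_factors])
    have X: "finite X" "\<And>p. p \<in> X \<Longrightarrow> prime p" if "X \<in> ?P N" for X
      using that finite_subset[OF _ finite_primes_le[of N]] by (auto simp: primes_le_def)
    show "\<forall>X\<in>?P N. prime_factors (\<Prod>X) = X"
    proof (rule ballI)
      fix X assume "X \<in> ?P N"
      from X[OF this] show "prime_factors (\<Prod>X) = X" by (rule prime_factors_prod_primes)
    qed
    show "\<forall>d\<in>?F N. \<Prod>(prime_factors d) = d"
      by (auto simp: prod_prime_factors_squarefree)
    show "(\<lambda>X. \<Prod>X) ` ?P N \<subseteq> ?F N"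
    proof (rule image_subsetI)
      fix X assume XP': "X \<in> ?P N"
      then have XP: "X \<in> Pow (primes_le N)" "Q \<subseteq> X" by blast+
      have "\<Prod>X \<noteq> 0" using X(1)[OF XP'] X(2)[OF XP', of 0] by (auto simp: prod_zero_iff)
      then have "1 \<le> \<Prod>X" by linarith
      moreover have "squarefree (\<Prod>X)" using X(2)[OF XP'] by (rule squarefree_prod_primes)
      ultimately show "\<Prod>X \<in> ?F N"
        using XP prime_factors_prod_primes[OF X[OF XP']] by simp
    qed
    show "prime_factors ` ?F N \<subseteq> ?P N" by auto
  qed
  show "finite (?F N)" for N
    using bij_betw_finite[OF bij[of N]] by simp
  show "\<forall>\<^sub>F N in sequentially. d \<in> ?F N" if "d \<in> ?A" for d
    using eventually_subset_primes_le[of "prime_factors d"] that by (auto elim: eventually_mono)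
  have "\<forall>\<^sub>F N in sequentially. (\<Prod>p\<in>primes_le N. g p + (if p \<in> Q then 0 else 1))
      = (\<Sum>d\<in>?F N. \<Prod>p\<in>prime_factors d. g p)"
  proof (rule eventually_mono[OF eventually_subset_primes_le])
    fix N assume elim: "Q \<subseteq> primes_le N"
    have "(\<Prod>p\<in>primes_le N. g p + (if p \<in> Q then 0 else 1))
       = (\<Sum>X\<in>Pow (primes_le N). (\<Prod>p\<in>X. g p) * (\<Prod>p\<in>primes_le N - X. if p \<in> Q then 0 else 1))"
      by (rule prod_add) simp
    also have "\<dots> = (\<Sum>X\<in>Pow (primes_le N). if Q \<subseteq> X then \<Prod>p\<in>X. g p else 0)"
    proof (rule sum.cong[OF refl])
      fix X assume "X \<in> Pow (primes_le N)"
      have "(\<Prod>p\<in>primes_le N - X. if p \<in> Q then 0 else 1 :: real) = (if Q \<subseteq> X then 1 else 0)"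
      proof (cases "Q \<subseteq> X")
        case False
        then show ?thesis using elim by (auto simp: prod_zero_iff)
      qed (auto intro!: prod.neutral)
      then show "(\<Prod>p\<in>X. g p) * (\<Prod>p\<in>primes_le N - X. if p \<in> Q then 0 else 1)
          = (if Q \<subseteq> X then \<Prod>p\<in>X. g p else 0)" by simp
    qed
    also have "\<dots> = (\<Sum>X\<in>?P N. \<Prod>p\<in>X. g p)"
      by (rule sum.inter_filter[symmetric]) simp
    also have "\<dots> = (\<Sum>X\<in>?P N. \<Prod>p\<in>prime_factors (\<Prod>X). g p)"
    proof (rule sum.cong[OF refl])
      fix X assume "X \<in> ?P N"
      then have "finite X" "\<And>p. p \<in> X \<Longrightarrow> prime p"
        using finite_subset[OF _ finite_primes_le[of N]] by (auto simp: primes_le_def)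
      then show "(\<Prod>p\<in>X. g p) = (\<Prod>p\<in>prime_factors (\<Prod>X). g p)"
        by (simp add: prime_factors_prod_primes)
    qed
    also have "\<dots> = (\<Sum>d\<in>?F N. \<Prod>p\<in>prime_factors d. g p)"
      by (rule sum.reindex_bij_betw[OF bij])
    finally show "(\<Prod>p\<in>primes_le N. g p + (if p \<in> Q then 0 else 1))
      = (\<Sum>d\<in>?F N. \<Prod>p\<in>prime_factors d. g p)" .
  qed (use Q in auto)
  then show "(\<lambda>N. \<Sum>d\<in>?F N. \<Prod>p\<in>prime_factors d. g p) \<longlonglongrightarrow> L"
    using lim unfolding euler_product_tends_def by (rule Lim_transform_eventually[rotated])
  show "0 \<le> (\<Prod>p\<in>prime_factors d. g p)" for d
    by (intro prod_nonneg g) auto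
qed auto

lemma prime_powers_dvd_iff:
  assumes "squarefree (d::nat)"
  shows "int d ^ k dvd m \<longleftrightarrow> (\<forall>p\<in>prime_factors d. int p ^ k dvd m)"
proof
  assume "int d ^ k dvd m"
  then show "\<forall>p\<in>prime_factors d. int p ^ k dvd m"
    using dvd_trans[OF dvd_power_same] by (metis in_prime_factors_imp_dvd int_dvd_int_iff)
next
  assume *: "\<forall>p\<in>prime_factors d. int p ^ k dvd m"
  have "(\<Prod>p\<in>X. int p ^ k) dvd m" if "X \<subseteq> prime_factors d" "finite X" for X
    using that(2,1)
  proof (induction X)
    case (insert p X)
    have "coprime (int p ^ k) (\<Prod>p\<in>X. int p ^ k)"
    proof (rule prod_coprime_right)
      fix q assume "q \<in> X"
      then have "prime p" "prime q" "p \<noteq> q" using insert by auto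
      then show "coprime (int p ^ k) (int q ^ k)"
        by (simp add: primes_coprime)
    qed
    with insert * show ?case
      by (simp add: divides_mult)
  qed simp
  from this[of "prime_factors d"] have "(\<Prod>p\<in>prime_factors d. int p) ^ k dvd m"
    by (simp add: prod_power_distrib)
  also have "(\<Prod>p\<in>prime_factors d. int p) = int (\<Prod>(prime_factors d))" by simp
  finally show "int d ^ k dvd m"
    by (simp only: prod_prime_factors_squarefree[OF assms])
qed

text \<open>
  No prime occurs more than \<open>k\<close> times in \<open>q\<close>, and every prime factor of \<open>d\<close> occurs \<open>k\<close> times in
  \<open>d ^ k\<close>.
\<close>

lemma dvd_power_squarefree_iff:
  assumes k: "k \<ge> 1" and q: "q \<ge> 1" "power_free (k + 1) (int q)" and d: "d \<ge> 1" "squarefree (d::nat)"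
  shows "q dvd d ^ k \<longleftrightarrow> prime_factors q \<subseteq> prime_factors d"
proof
  assume "q dvd d ^ k"
  then show "prime_factors q \<subseteq> prime_factors d"
    using d by (auto intro!: prime_factorsI intro: prime_dvd_power dvd_trans)
next
  assume sub: "prime_factors q \<subseteq> prime_factors d"
  show "q dvd d ^ k"
  proof (rule multiplicity_le_imp_dvd)
    fix p :: nat assume p: "prime p"
    have "multiplicity p q \<le> k"
    proof (rule ccontr)
      assume "\<not> ?thesis"
      then have "p ^ (k + 1) dvd q" by (intro multiplicity_dvd') simp
      then have "int p ^ (k + 1) dvd int q" by (metis int_dvd_int_iff of_nat_power)
      moreover have "int p > 1" using prime_gt_1_nat[OF p] by simp
      ultimately show False using q(2) unfolding power_free_def by blast
    qed
    show "multiplicity p q \<le> multiplicity p (d ^ k)"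
    proof (cases "p dvd q")
      case True
      then have "p \<in> prime_factors d" using sub p q by (auto simp: prime_factors_dvd)
      then have "multiplicity p d \<ge> 1" using d(2) by (simp add: prime_factors_multiplicity Suc_le_eq)
      then have "k \<le> multiplicity p (d ^ k)"
        using p d by (simp add: prime_elem_multiplicity_power_distrib)
      with \<open>multiplicity p q \<le> k\<close> show ?thesis by simp
    qed (simp add: not_dvd_imp_multiplicity_0)
  qed (use q in simp)
qed

lemma power_free_iff_prime:
  assumes "k \<ge> 1"
  shows "power_free k x \<longleftrightarrow> x \<noteq> 0 \<and> (\<forall>p::nat. prime p \<longrightarrow> \<not> int p ^ k dvd x)"
proof (intro iffI conjI allI impI notI)
  assume x: "power_free k x"
  show False if "x = 0"
    using x that unfolding power_free_def by (metis dvd_0_right one_less_numeral_iff semiring_norm(76))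
  show False if "prime p" "int p ^ k dvd x" for p :: nat
    using x that prime_gt_1_nat[of p] unfolding power_free_def by (metis of_nat_1 of_nat_less_iff)
next
  assume *: "x \<noteq> 0 \<and> (\<forall>p::nat. prime p \<longrightarrow> \<not> int p ^ k dvd x)"
  show "power_free k x"
    unfolding power_free_def
  proof clarify
    fix d :: int assume d: "d > 1" "d ^ k dvd x"
    then obtain p where p: "prime p" "p dvd nat d"
      using prime_factor_nat[of "nat d"] by force
    then have "int p dvd d" using d by (metis int_dvd_int_iff nat_0_le order_less_imp_le zero_less_one order_less_trans)
    then have "int p ^ k dvd x" using d by (meson dvd_power_same dvd_trans)
    with * p show False by blast
  qed
qed

lemma summable_inverse_Suc_powers:
  assumes "k \<ge> 2"
  shows "summable (\<lambda>n. 1 / real (Suc n) ^ k)"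
  using inverse_power_summable[OF assms, where ?'a = real]
  by (subst (asm) summable_Suc_iff[symmetric]) (simp add: inverse_eq_divide)

text \<open>
  Euler's sieve: among the integers that are left, the multiples of \<open>p\<close> account for the fraction
  \<open>1 / p ^ k\<close> of the sum, and sieving by \<open>p\<close> removes exactly these.
\<close>

lemma has_sum_coprime_to_primes:
  assumes k: "k \<ge> 2" and "finite P" "\<And>p. p \<in> P \<Longrightarrow> prime p"
  shows "((\<lambda>n::nat. 1 / real n ^ k) has_sum
     ((\<Sum>n. 1 / real (Suc n) ^ k) * (\<Prod>p\<in>P. 1 - 1 / real p ^ k))) {n. n \<ge> 1 \<and> (\<forall>p\<in>P. \<not> p dvd n)}"
  using assms(2,3)
proof (induction P)
  case empty
  have "((\<lambda>n. 1 / real (Suc n) ^ k) has_sum (\<Sum>n. 1 / real (Suc n) ^ k)) UNIV"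
    using summable_inverse_Suc_powers[OF k] by (intro norm_summable_imp_has_sum summable_sums) auto
  also have "?this \<longleftrightarrow> ((\<lambda>n. 1 / real n ^ k) has_sum (\<Sum>n. 1 / real (Suc n) ^ k)) (Suc ` UNIV)"
    by (subst has_sum_reindex) (auto simp: o_def)
  also have "Suc ` UNIV = {n. n \<ge> 1}"
    by (auto simp: image_iff) (metis Suc_diff_1 Suc_le_D)
  finally show ?case by simp
next
  case (insert p P)
  let ?A = "\<lambda>P. {n::nat. n \<ge> 1 \<and> (\<forall>p\<in>P. \<not> p dvd n)}"
  let ?s = "(\<Sum>n. 1 / real (Suc n) ^ k) * (\<Prod>p\<in>P. 1 - 1 / real p ^ k)"
  have p: "prime p" using insert by simp
  have IH: "((\<lambda>n. 1 / real n ^ k) has_sum ?s) (?A P)"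
    using insert by simp
  then have "((\<lambda>n. 1 / real p ^ k * (1 / real n ^ k)) has_sum (1 / real p ^ k * ?s)) (?A P)"
    by (rule has_sum_cmult_right)
  also have "?this \<longleftrightarrow> ((\<lambda>n. 1 / real n ^ k) has_sum (1 / real p ^ k * ?s)) ((\<lambda>n. p * n) ` ?A P)"
    using p by (subst has_sum_reindex) (auto simp: o_def inj_on_def power_mult_distrib)
  finally have sub: "((\<lambda>n. 1 / real n ^ k) has_sum (1 / real p ^ k * ?s)) ((\<lambda>n. p * n) ` ?A P)" .
  have incl: "(\<lambda>n. p * n) ` ?A P \<subseteq> ?A P"
  proof clarify
    fix n assume n: "1 \<le> n" "\<forall>q\<in>P. \<not> q dvd n"
    have "\<not> q dvd p * n" if "q \<in> P" for q
    proof
      assume "q dvd p * n"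
      moreover have "prime q" "q \<noteq> p" using that insert by auto
      ultimately have "q dvd n" using p by (metis prime_dvd_mult_iff primes_dvd_imp_eq)
      with n that show False by blast
    qed
    then show "1 \<le> p * n \<and> (\<forall>q\<in>P. \<not> q dvd p * n)"
      using n prime_gt_0_nat[OF p] by auto
  qed
  have "?A P - (\<lambda>n. p * n) ` ?A P = ?A (insert p P)"
  proof (rule equalityI; rule subsetI)
    fix n assume n: "n \<in> ?A P - (\<lambda>n. p * n) ` ?A P"
    have "\<not> p dvd n"
    proof
      assume "p dvd n"
      then obtain t where t: "n = p * t" by blast
      with n have "t \<in> ?A P" by auto
      with n t show False by blast
    qed
    with n show "n \<in> ?A (insert p P)" by auto
  qed auto
  with has_sum_Diff[OF IH sub incl]
  have "((\<lambda>n. 1 / real n ^ k) has_sum (?s - 1 / real p ^ k * ?s)) (?A (insert p P))" by simp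
  also have "?s - 1 / real p ^ k * ?s = (\<Sum>n. 1 / real (Suc n) ^ k) * (\<Prod>p\<in>insert p P. 1 - 1 / real p ^ k)"
    using insert by (simp add: algebra_simps)
  finally show ?case .
qed

definition zeta_value :: "nat \<Rightarrow> real" where
  "zeta_value k = (\<Sum>n. 1 / real (Suc n) ^ k)"

lemma has_sum_zeta_value:
  assumes "k \<ge> 2"
  shows "((\<lambda>n::nat. 1 / real n ^ k) has_sum zeta_value k) {n. n \<ge> 1}"
  using has_sum_coprime_to_primes[OF assms, of "{}"] by (simp add: zeta_value_def)

definition zeta_tail :: "nat \<Rightarrow> nat \<Rightarrow> real" where
  "zeta_tail k N = zeta_value k - (\<Sum>n=1..N. 1 / real n ^ k)"

lemma sum_le_zeta_tail:
  assumes "k \<ge> 2" "finite F" "F \<subseteq> {N<..}"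
  shows "(\<Sum>n\<in>F. 1 / real n ^ k) \<le> zeta_tail k N"
proof -
  have "(\<Sum>n\<in>F \<union> {1..N}. 1 / real n ^ k) \<le> zeta_value k"
    by (rule finite_sum_le_has_sum[OF has_sum_zeta_value[OF assms(1)]]) (use assms in auto)
  also have "(\<Sum>n\<in>F \<union> {1..N}. 1 / real n ^ k) = (\<Sum>n\<in>F. 1 / real n ^ k) + (\<Sum>n=1..N. 1 / real n ^ k)"
    using assms by (intro sum.union_disjoint) auto
  finally show ?thesis by (simp add: zeta_tail_def)
qed

lemma zeta_tail_tendsto_0:
  assumes "k \<ge> 2"
  shows "zeta_tail k \<longlonglongrightarrow> 0"
proof -
  have "(\<lambda>N. \<Sum>n<N. 1 / real (Suc n) ^ k) \<longlonglongrightarrow> zeta_value k"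
    unfolding zeta_value_def by (rule summable_LIMSEQ[OF summable_inverse_Suc_powers[OF assms]])
  also have "(\<lambda>N. \<Sum>n<N. 1 / real (Suc n) ^ k) = (\<lambda>N. \<Sum>n=1..N. 1 / real n ^ k)"
    by (intro ext sum.reindex_bij_witness[where i = "\<lambda>n. n - 1" and j = Suc]) auto
  finally have "(\<lambda>N. zeta_value k - (\<Sum>n=1..N. 1 / real n ^ k)) \<longlonglongrightarrow> zeta_value k - zeta_value k"
    by (intro tendsto_diff tendsto_const)
  then show ?thesis unfolding zeta_tail_def by simp
qed

lemma zeta_value_pos:
  assumes "k \<ge> 2"
  shows "zeta_value k > 0"
  using sum_le_zeta_tail[of k "{1}" 0] assms by (simp add: zeta_tail_def)

text \<open>
  Sieving by all primes up to \<open>N\<close> leaves 1 and some integers larger than \<open>N\<close>.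
\<close>

lemma euler_product_zeta:
  assumes k: "k \<ge> 2"
  shows "euler_product_tends (\<lambda>p. 1 - 1 / real p ^ k) (1 / zeta_value k)"
proof -
  let ?A = "\<lambda>N. {n. n \<ge> 1 \<and> (\<forall>p\<in>primes_le N. \<not> p dvd n)}"
  let ?E = "\<lambda>N. zeta_value k * (\<Prod>p\<in>primes_le N. 1 - 1 / real p ^ k)"
  have sum: "((\<lambda>n. 1 / real n ^ k) has_sum ?E N) (?A N)" for N
    unfolding zeta_value_def
    by (rule has_sum_coprime_to_primes[OF k]) (auto simp: primes_le_def[abs_def] intro: finite_subset[OF _ finite_atMost])
  have large: "n > N" if n: "n \<in> ?A N" "n \<noteq> 1" for n N
  proof (rule ccontr)
    assume "\<not> n > N"
    obtain p where p: "prime p" "p dvd n" using prime_factor_nat[OF n(2)] by blast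
    then have "p \<le> n" using n by (intro dvd_imp_le) auto
    with p \<open>\<not> n > N\<close> n show False by (auto simp: primes_le_def)
  qed
  have "?E \<longlonglongrightarrow> 1"
  proof (rule tendsto_sandwich[where f = "\<lambda>_. 1" and h = "\<lambda>N. 1 + zeta_tail k N"])
    show "\<forall>\<^sub>F N in sequentially. 1 \<le> ?E N"
    proof (intro always_eventually allI)
      fix N
      have "(\<Sum>n\<in>{1}. 1 / real n ^ k) \<le> ?E N"
        by (rule finite_sum_le_has_sum[OF sum]) (auto simp: primes_le_def)
      then show "1 \<le> ?E N" by simp
    qed
    show "\<forall>\<^sub>F N in sequentially. ?E N \<le> 1 + zeta_tail k N"
    proof (intro always_eventually allI)
      fix N
      show "?E N \<le> 1 + zeta_tail k N"
      proof (rule has_sum_le_finite_sums[OF sum])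
        fix F assume F: "finite F" "F \<subseteq> ?A N"
        have "(\<Sum>n\<in>F. 1 / real n ^ k) \<le> (\<Sum>n\<in>insert 1 (F - {1}). 1 / real n ^ k)"
          using F by (intro sum_mono2) auto
        also have "\<dots> = 1 + (\<Sum>n\<in>F - {1}. 1 / real n ^ k)"
          using F by (subst sum.insert) auto
        also have "(\<Sum>n\<in>F - {1}. 1 / real n ^ k) \<le> zeta_tail k N"
        proof (rule sum_le_zeta_tail[OF k])
          show "F - {1} \<subseteq> {N<..}" using F(2) large by blast
        qed (use F in simp)
        finally show "(\<Sum>n\<in>F. 1 / real n ^ k) \<le> 1 + zeta_tail k N" by simp
      qed
    qed
    show "(\<lambda>N. 1 + zeta_tail k N) \<longlonglongrightarrow> 1"
      using tendsto_add[OF tendsto_const zeta_tail_tendsto_0[OF k], of 1] by simp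
  qed simp
  then have "(\<lambda>N. 1 / zeta_value k * ?E N) \<longlonglongrightarrow> 1 / zeta_value k * 1"
    by (rule tendsto_mult_left)
  then show ?thesis
    unfolding euler_product_tends_def using zeta_value_pos[OF k] by simp
qed

lemma zeta_of_nat:
  assumes "k \<ge> 2"
  shows "zeta (of_nat k) = of_real (zeta_value k)"
proof -
  have "zeta (of_nat k) = (\<Sum>n. of_real (1 / real (Suc n) ^ k))"
    unfolding zeta_def by (intro suminf_cong) (simp add: powr_nat' del: of_nat_Suc)
  also have "\<dots> = of_real (zeta_value k)"
    unfolding zeta_value_def
    by (rule suminf_of_real[symmetric]) (rule summable_inverse_Suc_powers[OF assms])
  finally show ?thesis .
qed

lemma prime_power_ge_4:
  assumes "prime (p::nat)" "k \<ge> 2"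
  shows "real p ^ k \<ge> 4"
proof -
  have "(2::real) ^ 2 \<le> real p ^ 2" using prime_ge_2_nat[OF assms(1)] by (intro power_mono) auto
  also have "\<dots> \<le> real p ^ k" using prime_ge_2_nat[OF assms(1)] assms(2) by (intro power_increasing) auto
  finally show ?thesis by simp
qed

text \<open>
  Every factor is at least \<open>1 / 2\<close> because \<open>p ^ k \<ge> 4\<close>, so the absolutely convergent product does
  not vanish.
\<close>

lemma xi_of_nat:
  assumes k: "k \<ge> 2"
  obtains X where "X > 0" "xi (of_nat k) = of_real X" "euler_product_tends (\<lambda>p. 1 - 2 / real p ^ k) X"
proof -
  define f where "f p = (if prime p then 1 - 2 / real p ^ k else 1)" for p
  have f: "f p > 0" for p
  proof (cases "prime p")
    case True
    then have "2 / real p ^ k \<le> 2 / 4"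
      using prime_power_ge_4[OF True k] prime_gt_0_nat[OF True] by (intro divide_left_mono) auto
    with True show ?thesis unfolding f_def by (simp only: if_True)
  qed (simp add: f_def)
  have "summable (\<lambda>n. 2 * inverse (real n ^ k))"
    by (intro summable_mult inverse_power_summable k)
  then have "summable (\<lambda>p. norm (f p - 1))"
    by (rule summable_comparison_test'[where N = 0]) (auto simp: f_def inverse_eq_divide)
  then have "convergent_prod f"
    by (intro abs_convergent_prod_imp_convergent_prod summable_imp_abs_convergent_prod)
  moreover have "f p \<noteq> 0" for p using f[of p] by simp
  ultimately have conv: "(\<lambda>n. \<Prod>i\<le>n. f i) \<longlonglongrightarrow> prodinf f" "f has_prod prodinf f" "prodinf f \<noteq> 0"
    by (blast intro: convergent_prod_LIMSEQ convergent_prod_has_prod dest: prodinf_nonzero)+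
  have prod_eq: "(\<Prod>i\<le>n. f i) = (\<Prod>p\<in>primes_le n. 1 - 2 / real p ^ k)" for n
  proof -
    have "(\<Prod>i\<le>n. f i) = (\<Prod>i\<in>{i\<in>{..n}. prime i}. 1 - 2 / real i ^ k)"
      unfolding f_def by (rule prod.inter_filter[symmetric]) simp
    also have "{i\<in>{..n}. prime i} = primes_le n" by (auto simp: primes_le_def)
    finally show ?thesis .
  qed
  show thesis
  proof
    have "prodinf f \<ge> 0"
      by (rule tendsto_lowerbound[OF conv(1)]) (auto intro!: always_eventually prod_nonneg less_imp_le[OF f])
    with conv(3) show "prodinf f > 0" by simp
    show "euler_product_tends (\<lambda>p. 1 - 2 / real p ^ k) (prodinf f)"
      using conv(1) by (simp add: euler_product_tends_def prod_eq)
    have "(if prime p then 1 - 2 / of_nat p powr of_nat k else 1 :: complex) = of_real (f p)" for p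
      using k by (auto simp: f_def powr_nat')
    then have "xi (of_nat k) = (\<Prod>p. complex_of_real (f p))"
      by (simp add: xi_def)
    also have "\<dots> = of_real (prodinf f)"
      using conv(2) by (metis has_prod_of_real_iff has_prod_unique)
    finally show "xi (of_nat k) = of_real (prodinf f)" .
  qed
qed

section \<open>Densities of sets of integers\<close>

definition has_density :: "int set \<Rightarrow> real \<Rightarrow> bool" where
  "has_density E \<delta> \<longleftrightarrow> ((\<lambda>R. card {y\<in>E. \<bar>of_int y\<bar> < R} / (2 * R)) \<longlongrightarrow> \<delta>) at_top"

lemma finite_abs_int_less [simp]: "finite {y::int. \<bar>of_int y\<bar> < (R::real)}"
  by (rule finite_subset[of _ "{- \<lceil>R\<rceil>..\<lceil>R\<rceil>}"]) (auto, linarith+)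

lemma finite_abs_int_less_conj [simp]: "finite {y::int. P y \<and> \<bar>of_int y\<bar> < (R::real)}"
  by (rule finite_subset[OF _ finite_abs_int_less[of R]]) auto

text \<open>
  Division with remainder by \<open>q\<close> splits the interval into \<open>2 j\<close> full periods.
\<close>

lemma card_periodic_blocks:
  fixes q :: int and j :: nat
  assumes "q > 0" and per: "\<And>y. y \<in> E \<longleftrightarrow> y mod q \<in> E"
  shows "card (E \<inter> {- int j * q..<int j * q}) = 2 * j * card (E \<inter> {0..<q})"
proof -
  have "bij_betw (\<lambda>(i, r). i * q + r) ({- int j..<int j} \<times> (E \<inter> {0..<q})) (E \<inter> {- int j * q..<int j * q})"
  proof (rule bij_betw_byWitness[where f' = "\<lambda>y. (y div q, y mod q)"])
    show "\<forall>a\<in>{- int j..<int j} \<times> (E \<inter> {0..<q}). (\<lambda>y. (y div q, y mod q)) ((\<lambda>(i, r). i * q + r) a) = a"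
      using assms(1) by (auto simp: div_pos_pos_trivial)
    show "\<forall>y\<in>E \<inter> {- int j * q..<int j * q}. (\<lambda>(i, r). i * q + r) ((\<lambda>y. (y div q, y mod q)) y) = y"
      by simp
    show "(\<lambda>(i, r). i * q + r) ` ({- int j..<int j} \<times> (E \<inter> {0..<q})) \<subseteq> E \<inter> {- int j * q..<int j * q}"
    proof (rule image_subsetI)
      fix a assume "a \<in> {- int j..<int j} \<times> (E \<inter> {0..<q})"
      then obtain i r where a: "a = (i, r)" and i: "i \<in> {- int j..<int j}" and r: "r \<in> E" "r \<in> {0..<q}"
        by blast
      have "(i * q + r) mod q = r" using r by simp
      with r per[of "i * q + r"] have "i * q + r \<in> E" by simp
      moreover have "- int j * q \<le> i * q" using i assms(1) by (intro mult_right_mono) auto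
      moreover have "(i + 1) * q \<le> int j * q" using i assms(1) by (intro mult_right_mono) auto
      ultimately have "i * q + r \<in> E \<inter> {- int j * q..<int j * q}" using r by (auto simp: algebra_simps)
      then show "(case a of (i, r) \<Rightarrow> i * q + r) \<in> E \<inter> {- int j * q..<int j * q}" by (simp add: a)
    qed
    show "(\<lambda>y. (y div q, y mod q)) ` (E \<inter> {- int j * q..<int j * q}) \<subseteq> {- int j..<int j} \<times> (E \<inter> {0..<q})"
    proof (rule image_subsetI)
      fix y assume "y \<in> E \<inter> {- int j * q..<int j * q}"
      then have y: "y \<in> E" "y \<in> {- int j * q..<int j * q}" by blast+
      have y_eq: "y = y div q * q + y mod q" "0 \<le> y mod q" "y mod q < q" using assms(1) by simp_all
      have "- int j \<le> y div q"
      proof (rule ccontr)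
        assume "\<not> - int j \<le> y div q"
        then have "(y div q + 1) * q \<le> - int j * q" using assms(1) by (intro mult_right_mono) auto
        then show False using y(2) y_eq by (simp add: ring_distribs)
      qed
      moreover have "y div q < int j"
      proof (rule ccontr)
        assume "\<not> y div q < int j"
        then have "int j * q \<le> y div q * q" using assms(1) by (intro mult_right_mono) auto
        moreover have "y < int j * q" using y(2) by simp
        ultimately show False using y_eq by linarith
      qed
      ultimately show "(y div q, y mod q) \<in> {- int j..<int j} \<times> (E \<inter> {0..<q})"
        using y(1) per[of y] assms(1) by auto
    qed
  qed
  then have "card (E \<inter> {- int j * q..<int j * q}) = card ({- int j..<int j} \<times> (E \<inter> {0..<q}))"
    by (simp add: bij_betw_same_card)
  then show ?thesis by (simp add: card_cartesian_product nat_mult_distrib)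
qed

lemma periodic_has_density:
  fixes q :: int
  assumes q: "q > 0" and per: "\<And>y. y \<in> E \<longleftrightarrow> y mod q \<in> E"
  shows "has_density E (card (E \<inter> {0..<q}) / q)"
proof -
  define c where "c = real (card (E \<inter> {0..<q}))"
  let ?N = "\<lambda>R. real (card {y\<in>E. \<bar>of_int y\<bar> < R})"
  have lower: "((\<lambda>R. (R / q - 1) * c / R) \<longlongrightarrow> card (E \<inter> {0..<q}) / q) at_top"
  proof -
    have lim: "((\<lambda>R. (c / q) - c * inverse R) \<longlongrightarrow> c / q - c * 0) at_top"
      by (intro tendsto_intros tendsto_inverse_0_at_top filterlim_ident)
    have "\<forall>\<^sub>F R in at_top. c / q - c * inverse R = (R / q - 1) * c / R"
      using eventually_gt_at_top[of 0] by eventually_elim (use q in \<open>simp add: field_simps\<close>)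
    from Lim_transform_eventually[OF lim this] show ?thesis by (simp add: c_def)
  qed
  have upper: "((\<lambda>R. (R / q + 1) * c / R) \<longlongrightarrow> card (E \<inter> {0..<q}) / q) at_top"
  proof -
    have lim: "((\<lambda>R. (c / q) + c * inverse R) \<longlongrightarrow> c / q + c * 0) at_top"
      by (intro tendsto_intros tendsto_inverse_0_at_top filterlim_ident)
    have "\<forall>\<^sub>F R in at_top. c / q + c * inverse R = (R / q + 1) * c / R"
      using eventually_gt_at_top[of 0] by eventually_elim (use q in \<open>simp add: field_simps\<close>)
    from Lim_transform_eventually[OF lim this] show ?thesis by (simp add: c_def)
  qed
  have bounds: "(R / q - 1) * c / R \<le> ?N R / (2 * R) \<and> ?N R / (2 * R) \<le> (R / q + 1) * c / R" if "R > 0" for R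
  proof -
    \<comment> \<open>\<open>{y. \<bar>y\<bar> < R}\<close> contains \<open>2 (j - 1)\<close> full periods and is contained in \<open>2 j\<close> of them.\<close>
    define j where "j = nat \<lceil>R / q\<rceil>"
    have Rq: "R / q > 0" using that q by simp
    then have j: "R / q \<le> j" "j < R / q + 1" "j \<ge> 1" unfolding j_def by linarith+
    have j': "R \<le> j * q" "(j - 1) * q < R" using j q that by (auto simp: field_simps)
    have "?N R \<le> card (E \<inter> {- int j * q..<int j * q})"
    proof (intro of_nat_mono card_mono)
      show "{y \<in> E. \<bar>of_int y\<bar> < R} \<subseteq> E \<inter> {- int j * q..<int j * q}"
      proof (rule subsetI)
        fix y assume "y \<in> {y \<in> E. \<bar>of_int y\<bar> < R}"
        then have y: "y \<in> E" "\<bar>of_int y\<bar> < R" by blast+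
        then have "\<bar>of_int y\<bar> < real_of_int (int j * q)" using j' by simp
        then have "\<bar>y\<bar> < int j * q" by linarith
        then show "y \<in> E \<inter> {- int j * q..<int j * q}" using y by auto
      qed
    qed simp
    also have "\<dots> = 2 * j * c"
      unfolding card_periodic_blocks[OF q per] by (simp add: c_def)
    also have "\<dots> \<le> 2 * (R / q + 1) * c" using j by (intro mult_right_mono) (auto simp: c_def)
    finally have up: "?N R \<le> 2 * (R / q + 1) * c" .
    have "2 * (R / q - 1) * c \<le> 2 * real (j - 1) * c" using j by (intro mult_right_mono) (auto simp: c_def)
    also have "\<dots> = card (E \<inter> {- int (j - 1) * q..<int (j - 1) * q})"
      unfolding card_periodic_blocks[OF q per] by (simp add: c_def)
    also have "\<dots> \<le> ?N R"
    proof (intro of_nat_mono card_mono)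
      show "E \<inter> {- int (j - 1) * q..<int (j - 1) * q} \<subseteq> {y \<in> E. \<bar>of_int y\<bar> < R}"
      proof (rule subsetI)
        fix y assume "y \<in> E \<inter> {- int (j - 1) * q..<int (j - 1) * q}"
        then have y: "y \<in> E" "y \<in> {- int (j - 1) * q..<int (j - 1) * q}" by blast+
        then have "\<bar>y\<bar> \<le> int (j - 1) * q" unfolding atLeastLessThan_iff by linarith
        then have "\<bar>real_of_int y\<bar> \<le> real_of_int (int (j - 1) * q)" by linarith
        also have "\<dots> < R" using j' by simp
        finally show "y \<in> {y \<in> E. \<bar>of_int y\<bar> < R}" using y by simp
      qed
    qed simp
    finally have "2 * (R / q - 1) * c \<le> ?N R" .
    then have "2 * (R / q - 1) * c / (2 * R) \<le> ?N R / (2 * R)"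
      using that by (intro divide_right_mono) auto
    moreover have "?N R / (2 * R) \<le> 2 * (R / q + 1) * c / (2 * R)"
      using up that by (intro divide_right_mono) auto
    moreover have "2 * t * c / (2 * R) = t * c / R" for t by simp
    ultimately show ?thesis by (simp only:)
  qed
  have "\<forall>\<^sub>F R in at_top. (R / q - 1) * c / R \<le> ?N R / (2 * R)"
    using eventually_gt_at_top[of 0] by eventually_elim (use bounds in blast)
  moreover have "\<forall>\<^sub>F R in at_top. ?N R / (2 * R) \<le> (R / q + 1) * c / R"
    using eventually_gt_at_top[of 0] by eventually_elim (use bounds in blast)
  ultimately show ?thesis
    unfolding has_density_def by (rule tendsto_sandwich[OF _ _ lower upper])
qed

text \<open>
  The Chinese remainder theorem: reduction modulo \<open>a\<close> and \<open>b\<close> is injective on the residues modulo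
  \<open>a * b\<close>, hence onto by counting, and it maps the set in question onto a product set.
\<close>

lemma card_residues_coprime_product:
  fixes a b :: int
  assumes "a > 0" "b > 0" "coprime a b"
    and A: "\<And>y. y \<in> A \<longleftrightarrow> y mod a \<in> A" and B: "\<And>y. y \<in> B \<longleftrightarrow> y mod b \<in> B"
  shows "card ((A \<inter> B) \<inter> {0..<a * b}) = card (A \<inter> {0..<a}) * card (B \<inter> {0..<b})"
proof -
  let ?h = "\<lambda>y. (y mod a, y mod b)"
  have inj: "inj_on ?h {0..<a * b}"
  proof (rule inj_onI)
    fix x y assume xy: "x \<in> {0..<a * b}" "y \<in> {0..<a * b}" "?h x = ?h y"
    then have "a dvd x - y" "b dvd x - y" by (auto simp: mod_eq_dvd_iff)
    then have "a * b dvd x - y" using assms(3) by (simp add: divides_mult)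
    then have "x mod (a * b) = y mod (a * b)" by (simp add: mod_eq_dvd_iff)
    with xy show "x = y" by simp
  qed
  have "?h ` {0..<a * b} = {0..<a} \<times> {0..<b}"
  proof (rule card_subset_eq)
    show "?h ` {0..<a * b} \<subseteq> {0..<a} \<times> {0..<b}" using assms by auto
    show "card (?h ` {0..<a * b}) = card ({0..<a} \<times> {0..<b})"
      using assms by (simp add: card_image[OF inj] card_cartesian_product nat_mult_distrib)
  qed simp
  have img: "?h ` ((A \<inter> B) \<inter> {0..<a * b}) = (A \<inter> {0..<a}) \<times> (B \<inter> {0..<b})"
  proof (rule equalityI; rule subsetI)
    fix z assume "z \<in> ?h ` ((A \<inter> B) \<inter> {0..<a * b})"
    then show "z \<in> (A \<inter> {0..<a}) \<times> (B \<inter> {0..<b})" using A B assms by auto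
  next
    fix z assume z: "z \<in> (A \<inter> {0..<a}) \<times> (B \<inter> {0..<b})"
    then have "z \<in> ?h ` {0..<a * b}" using \<open>?h ` {0..<a * b} = _\<close> by auto
    then obtain y where y: "z = ?h y" "y \<in> {0..<a * b}" by blast
    with z A[of y] B[of y] show "z \<in> ?h ` ((A \<inter> B) \<inter> {0..<a * b})" by auto
  qed
  have "card ((A \<inter> B) \<inter> {0..<a * b}) = card (?h ` ((A \<inter> B) \<inter> {0..<a * b}))"
    using inj by (intro card_image[symmetric]) (auto intro: inj_on_subset)
  then show ?thesis unfolding img by (simp add: card_cartesian_product)
qed

text \<open>
  What the prime \<open>p\<close> demands of \<open>y\<close> if \<open>y\<close> and \<open>y + m\<close> are both to be \<open>k\<close>th-power-free.
\<close>

definition avoids :: "nat \<Rightarrow> int \<Rightarrow> nat \<Rightarrow> int set" where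
  "avoids k m p = {y. \<not> int p ^ k dvd y \<and> \<not> int p ^ k dvd y + m}"

lemma avoids_periodic: "y \<in> avoids k m p \<longleftrightarrow> y mod (int p ^ k) \<in> avoids k m p"
proof -
  have "int p ^ k dvd y mod (int p ^ k) + m \<longleftrightarrow> int p ^ k dvd y + m"
    by (metis dvd_eq_mod_eq_0 mod_add_left_eq)
  then show ?thesis by (simp add: avoids_def dvd_mod_iff)
qed

text \<open>
  The density of \<^const>\<open>avoids\<close>: the forbidden residues \<open>0\<close> and \<open>- m\<close> modulo \<open>p ^ k\<close> coincide
  exactly if \<open>p ^ k\<close> divides \<open>m\<close>.
\<close>

definition pair_factor :: "nat \<Rightarrow> int \<Rightarrow> nat \<Rightarrow> real" where
  "pair_factor k m p = 1 - (if int p ^ k dvd m then 1 else 2) / real p ^ k"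

lemma card_avoids:
  assumes "prime p" "k \<ge> 2"
  shows "real (card (avoids k m p \<inter> {0..<int p ^ k})) = pair_factor k m p * real p ^ k"
proof -
  define q where "q = int p ^ k"
  have q4: "q \<ge> 4" using prime_power_ge_4[OF assms] by (simp add: q_def flip: of_nat_power)
  have "{y\<in>{0..<q}. q dvd y} = {0}"
    using q4 by (auto dest: zdvd_imp_le)
  moreover have "{y\<in>{0..<q}. q dvd y + m} = {(- m) mod q}"
  proof -
    define c where "c = (- m) mod q"
    have c: "0 \<le> c" "c < q" using q4 by (simp_all add: c_def)
    have "q dvd y + m \<longleftrightarrow> y mod q = c" for y
      unfolding c_def mod_eq_dvd_iff by simp
    then have iff: "y \<in> {0..<q} \<Longrightarrow> q dvd y + m \<longleftrightarrow> y = c" for y by simp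
    have "x \<in> {y\<in>{0..<q}. q dvd y + m} \<longleftrightarrow> x \<in> {c}" for x
      using iff[of x] c by auto
    then show ?thesis unfolding c_def[symmetric] by blast
  qed
  ultimately have eq: "avoids k m p \<inter> {0..<q} = {0..<q} - {0, (- m) mod q}"
    unfolding avoids_def q_def[symmetric] by blast
  have c1: "card {0, (- m) mod q} = (if q dvd m then 1 else 2)"
    by (auto simp: card_insert_if dvd_eq_mod_eq_0[symmetric])
  have "card ({0..<q} - {0, (- m) mod q}) = card {0..<q} - card {0, (- m) mod q}"
    using q4 by (intro card_Diff_subset) auto
  then have "card (avoids k m p \<inter> {0..<q}) = nat q - (if q dvd m then 1 else 2)"
    unfolding eq c1 by simp
  then have "real (card (avoids k m p \<inter> {0..<q})) = real_of_int q - (if q dvd m then 1 else 2)"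
    using q4 by (auto simp: of_nat_diff)
  then show ?thesis
    using prime_gt_0_nat[OF assms(1)] by (simp add: q_def pair_factor_def left_diff_distrib)
qed

lemma has_density_avoids_all:
  assumes k: "k \<ge> 2" and "finite P" "\<And>p. p \<in> P \<Longrightarrow> prime p"
  shows "has_density (\<Inter>p\<in>P. avoids k m p) (\<Prod>p\<in>P. pair_factor k m p)"
proof -
  define q where "q P = (\<Prod>p\<in>P. int p ^ k)" for P
  have q0: "q P > 0" if "\<And>p. p \<in> P \<Longrightarrow> prime p" for P
    unfolding q_def using that prime_gt_0_nat by (intro prod_pos) auto
  have per: "y \<in> (\<Inter>p\<in>P. avoids k m p) \<longleftrightarrow> y mod q P \<in> (\<Inter>p\<in>P. avoids k m p)" if "finite P" for y P
  proof -
    have "y \<in> avoids k m p \<longleftrightarrow> y mod q P \<in> avoids k m p" if "p \<in> P" for p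
    proof -
      have "int p ^ k dvd q P" unfolding q_def using \<open>finite P\<close> that by (rule dvd_prodI)
      then show ?thesis
        using avoids_periodic[of y k m p] avoids_periodic[of "y mod q P" k m p] by (simp add: mod_mod_cancel)
    qed
    then show ?thesis by blast
  qed
  have "real (card ((\<Inter>p\<in>P. avoids k m p) \<inter> {0..<q P})) = (\<Prod>p\<in>P. pair_factor k m p) * real_of_int (q P)"
    using assms(2,3)
  proof (induction P)
    case (insert p P)
    have P: "\<And>p. p \<in> P \<Longrightarrow> prime p" "prime p" using insert by auto
    have "coprime (int p ^ k) (q P)"
      unfolding q_def
    proof (rule prod_coprime_right)
      fix r assume "r \<in> P"
      show "coprime (int p ^ k) (int r ^ k)"
      proof -
        have "p \<noteq> r" using insert(2) \<open>r \<in> P\<close> by blast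
        from primes_coprime[OF P(2) P(1)[OF \<open>r \<in> P\<close>] this] show ?thesis by simp
      qed
    qed
    then have "card ((avoids k m p \<inter> (\<Inter>p\<in>P. avoids k m p)) \<inter> {0..<int p ^ k * q P})
       = card (avoids k m p \<inter> {0..<int p ^ k}) * card ((\<Inter>p\<in>P. avoids k m p) \<inter> {0..<q P})"
      using P q0[of P] prime_gt_0_nat[of p]
      by (intro card_residues_coprime_product avoids_periodic per insert) auto
    moreover have "q (insert p P) = int p ^ k * q P" using insert by (simp add: q_def)
    ultimately show ?case
      using insert card_avoids[OF P(2) k, of m] by simp
  qed (simp add: q_def)
  then show ?thesis
    using periodic_has_density[OF q0[of P] per] assms q0[of P] by simp
qed

lemma finite_int_abs_boundedI:
  assumes "\<And>y. y \<in> S \<Longrightarrow> \<bar>real_of_int y\<bar> < R"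
  shows "finite (S :: int set)"
  using assms by (intro finite_subset[OF _ finite_abs_int_less[of R]]) auto

text \<open>
  Leaving out 0 is essential: the bound then has no additive error term, so it can be summed over
  infinitely many \<open>q\<close>.
\<close>

lemma card_multiples_le:
  fixes q :: nat
  assumes "q \<ge> 1" "R > 0"
  shows "real (card {y::int. y \<noteq> 0 \<and> int q dvd y \<and> \<bar>of_int y\<bar> < R}) \<le> 2 * R / q"
proof -
  let ?S = "{y::int. y \<noteq> 0 \<and> int q dvd y \<and> \<bar>of_int y\<bar> < R}"
  define t where "t = \<lfloor>R / q\<rfloor>"
  have t: "t \<ge> 0" "of_int t \<le> R / q" using assms by (simp_all add: t_def)
  have "?S \<subseteq> (\<lambda>i. int q * i) ` ({- t..- 1} \<union> {1..t})"
  proof (rule subsetI)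
    fix y :: int assume "y \<in> ?S"
    then obtain i where i: "y = int q * i" "y \<noteq> 0" "\<bar>real_of_int y\<bar> < R" by blast
    then have "real q * \<bar>of_int i\<bar> < R" by (simp add: abs_mult)
    then have "of_int \<bar>i\<bar> \<le> R / q" using assms by (simp add: field_simps)
    then have "\<bar>i\<bar> \<le> t" unfolding t_def by (simp add: le_floor_iff)
    moreover have "i \<noteq> 0" using i by auto
    ultimately show "y \<in> (\<lambda>i. int q * i) ` ({- t..- 1} \<union> {1..t})" using i(1) by (intro image_eqI) auto
  qed
  then have "card ?S \<le> card ((\<lambda>i. int q * i) ` ({- t..- 1} \<union> {1..t}))"
    by (intro card_mono) auto
  also have "\<dots> \<le> card ({- t..- 1} \<union> {1..t})" by (rule card_image_le) simp
  also have "\<dots> \<le> card {- t..- 1} + card {1..t}" by (rule card_Un_le)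
  also have "\<dots> = 2 * nat t" by simp
  finally have "real (card ?S) \<le> real (2 * nat t)"
    by (rule of_nat_mono)
  also have "\<dots> = 2 * of_int t" using t by simp
  also have "\<dots> \<le> 2 * (R / q)" using t by simp
  finally show ?thesis by simp
qed

lemma card_large_power_multiples_le:
  assumes k: "k \<ge> 2" and R: "R > 0"
  shows "real (card {y::int. y \<noteq> 0 \<and> (\<exists>n>N. int n ^ k dvd y) \<and> \<bar>of_int y\<bar> < R}) \<le> 2 * R * zeta_tail k N"
proof -
  let ?S = "{y::int. y \<noteq> 0 \<and> (\<exists>n>N. int n ^ k dvd y) \<and> \<bar>of_int y\<bar> < R}"
  define I where "I = {N<..nat \<lceil>R\<rceil>}"
  let ?M = "\<lambda>n. {y::int. y \<noteq> 0 \<and> int (n ^ k) dvd y \<and> \<bar>of_int y\<bar> < R}"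
  have "?S \<subseteq> (\<Union>n\<in>I. ?M n)"
  proof (rule subsetI)
    fix y :: int assume "y \<in> ?S"
    then obtain n where n: "y \<noteq> 0" "n > N" "int n ^ k dvd y" "\<bar>real_of_int y\<bar> < R" by blast
    have "int n ^ 1 \<le> int n ^ k" using n k by (intro power_increasing) auto
    also have "\<dots> \<le> \<bar>y\<bar>" using dvd_imp_le_int[OF n(1) n(3)] by simp
    finally have "real n \<le> \<bar>real_of_int y\<bar>" by simp
    then have "real n < R" using n(4) by linarith
    then have "n \<in> I" using n by (auto simp: I_def) linarith
    with n show "y \<in> (\<Union>n\<in>I. ?M n)" by auto
  qed
  then have "card ?S \<le> card (\<Union>n\<in>I. ?M n)"
    by (intro card_mono finite_UN_I) (auto simp: I_def intro: finite_int_abs_boundedI[of _ R])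
  also have "\<dots> \<le> (\<Sum>n\<in>I. card (?M n))" by (rule card_UN_le) (simp add: I_def)
  finally have "real (card ?S) \<le> (\<Sum>n\<in>I. real (card (?M n)))"
    by (simp flip: of_nat_sum)
  also have "\<dots> \<le> (\<Sum>n\<in>I. 2 * R / real (n ^ k))"
    by (intro sum_mono card_multiples_le R) (auto simp: I_def)
  also have "\<dots> = 2 * R * (\<Sum>n\<in>I. 1 / real n ^ k)" by (simp add: sum_distrib_left)
  also have "\<dots> \<le> 2 * R * zeta_tail k N"
    using R by (intro mult_left_mono sum_le_zeta_tail[OF k]) (auto simp: I_def)
  finally show ?thesis .
qed

text \<open>
  Sieving by the primes up to \<open>N\<close> gives a periodic superset \<open>EN N\<close> of known density. If \<open>y\<close> is in
  it without being in the set itself, then \<open>y\<close> or \<open>y + m\<close> lies in \<open>D N\<close>, which consists of 0 and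
  of the multiples of \<open>n ^ k\<close> with \<open>n > N\<close>. Hence the two counts, divided by \<open>2 R\<close>, differ by at
  most twice the tail of the zeta series plus a term of order \<open>1 / R\<close>; one chooses \<open>N\<close> first
  and \<open>R\<close> afterwards.
\<close>

lemma power_free_pairs_has_density:
  assumes k: "k \<ge> 2" and c: "euler_product_tends (pair_factor k m) c"
  shows "has_density {y. power_free k y \<and> power_free k (y + m)} c"
proof -
  let ?E = "{y. power_free k y \<and> power_free k (y + m)}"
  define EN where "EN N = (\<Inter>p\<in>primes_le N. avoids k m p)" for N
  define cN where "cN N = (\<Prod>p\<in>primes_le N. pair_factor k m p)" for N
  define D where "D N = insert 0 {z::int. z \<noteq> 0 \<and> (\<exists>n>N. int n ^ k dvd z)}" for N
  let ?C = "\<lambda>S R. real (card {y\<in>S. \<bar>of_int y\<bar> < (R::real)})"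
  have k1: "k \<ge> 1" using k by simp
  have sub: "?E \<subseteq> EN N" for N
    using power_free_iff_prime[OF k1] by (auto simp: EN_def avoids_def primes_le_def)
  have diff: "EN N - ?E \<subseteq> D N \<union> {y. y + m \<in> D N}" for N
  proof -
    have D: "y \<in> D N" if "\<not> power_free k y" "\<And>p. p \<in> primes_le N \<Longrightarrow> \<not> int p ^ k dvd y" for y
    proof (cases "y = 0")
      case False
      with that(1) obtain p :: nat where p: "prime p" "int p ^ k dvd y"
        using power_free_iff_prime[OF k1] by blast
      then have "p \<notin> primes_le N" using that(2) by blast
      with p(1) have "p > N" by (simp add: primes_le_def not_le)
      with p False show ?thesis by (auto simp: D_def)
    qed (simp add: D_def)
    show ?thesis
    proof (rule subsetI)
      fix y assume "y \<in> EN N - ?E"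
      then have y: "\<And>p. p \<in> primes_le N \<Longrightarrow> \<not> int p ^ k dvd y"
          "\<And>p. p \<in> primes_le N \<Longrightarrow> \<not> int p ^ k dvd y + m"
        and "\<not> power_free k y \<or> \<not> power_free k (y + m)"
        unfolding EN_def avoids_def by blast+
      then show "y \<in> D N \<union> {y. y + m \<in> D N}"
        using D[OF _ y(1)] D[OF _ y(2)] by blast
    qed
  qed
  have dens: "has_density (EN N) (cN N)" for N
    unfolding EN_def cN_def by (rule has_density_avoids_all[OF k]) (auto simp: primes_le_def[abs_def])
  have D_card: "?C (D N) R \<le> 1 + 2 * R * zeta_tail k N" if "R > 0" for N R
  proof -
    let ?S = "{y::int. y \<noteq> 0 \<and> (\<exists>n>N. int n ^ k dvd y) \<and> \<bar>of_int y\<bar> < R}"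
    have "{y\<in>D N. \<bar>of_int y\<bar> < R} \<subseteq> insert 0 ?S"
      by (auto simp: D_def)
    then have "card {y\<in>D N. \<bar>of_int y\<bar> < R} \<le> card (insert 0 ?S)"
      by (intro card_mono) (auto intro: finite_int_abs_boundedI[of _ R])
    also have "\<dots> \<le> Suc (card ?S)"
      by (rule card_insert_le_m1) auto
    finally show ?thesis using card_large_power_multiples_le[OF k that, of N] by linarith
  qed
  have D_shift: "?C {y. y + m \<in> D N} R \<le> 1 + 2 * (R + \<bar>of_int m\<bar>) * zeta_tail k N" if "R > 0" for N R
  proof -
    have "card {y\<in>{y. y + m \<in> D N}. \<bar>of_int y\<bar> < R} = card ((\<lambda>y. y + m) ` {y\<in>{y. y + m \<in> D N}. \<bar>of_int y\<bar> < R})"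
      by (intro card_image[symmetric]) (auto simp: inj_on_def)
    also have "\<dots> \<le> card {y\<in>D N. \<bar>of_int y\<bar> < R + \<bar>of_int m\<bar>}"
      by (intro card_mono) auto
    finally show ?thesis using D_card[of "R + \<bar>of_int m\<bar>" N] that by linarith
  qed
  have gap: "\<bar>?C (EN N) R / (2 * R) - ?C ?E R / (2 * R)\<bar> \<le> (1 + \<bar>of_int m\<bar> * zeta_tail k N) * inverse R + 2 * zeta_tail k N"
    if "R > 0" for N R
  proof -
    have le: "?C ?E R \<le> ?C (EN N) R"
      using sub[of N] by (intro of_nat_mono card_mono) auto
    have "{y\<in>EN N. \<bar>of_int y\<bar> < R} \<subseteq> {y\<in>?E. \<bar>of_int y\<bar> < R} \<union>
        ({y\<in>D N. \<bar>of_int y\<bar> < R} \<union> {y\<in>{y. y + m \<in> D N}. \<bar>of_int y\<bar> < R})"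
      using diff[of N] by blast
    then have "card {y\<in>EN N. \<bar>of_int y\<bar> < R} \<le> card ({y\<in>?E. \<bar>of_int y\<bar> < R} \<union>
        ({y\<in>D N. \<bar>of_int y\<bar> < R} \<union> {y\<in>{y. y + m \<in> D N}. \<bar>of_int y\<bar> < R}))"
      by (intro card_mono) auto
    also have "\<dots> \<le> card {y\<in>?E. \<bar>of_int y\<bar> < R} +
        (card {y\<in>D N. \<bar>of_int y\<bar> < R} + card {y\<in>{y. y + m \<in> D N}. \<bar>of_int y\<bar> < R})"
      by (intro order_trans[OF card_Un_le] add_left_mono card_Un_le)
    finally have "?C (EN N) R \<le> ?C ?E R + (?C (D N) R + ?C {y. y + m \<in> D N} R)"
      by (simp flip: of_nat_add)
    also have "\<dots> \<le> ?C ?E R + ((1 + 2 * R * zeta_tail k N) + (1 + 2 * (R + \<bar>of_int m\<bar>) * zeta_tail k N))"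
      using D_card[OF that] D_shift[OF that] by (intro add_mono) auto
    finally have "(?C (EN N) R - ?C ?E R) / (2 * R) \<le> (2 + 4 * R * zeta_tail k N + 2 * \<bar>of_int m\<bar> * zeta_tail k N) / (2 * R)"
      using that by (intro divide_right_mono) (auto simp: algebra_simps)
    also have "\<dots> = (1 + \<bar>of_int m\<bar> * zeta_tail k N) * inverse R + 2 * zeta_tail k N"
      using that by (simp add: field_simps)
    finally show ?thesis using le that by (simp add: diff_divide_distrib divide_right_mono)
  qed
  show ?thesis
    unfolding has_density_def
  proof (rule tendstoI)
    fix e :: real assume e: "e > 0"
    have "cN \<longlonglongrightarrow> c" using c by (simp add: euler_product_tends_def cN_def[abs_def])
    then have "\<forall>\<^sub>F N in sequentially. dist (cN N) c < e / 4" using e by (intro tendstoD) auto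
    moreover have "\<forall>\<^sub>F N in sequentially. dist (zeta_tail k N) 0 < e / 8"
      using e by (intro tendstoD[OF zeta_tail_tendsto_0[OF k]]) auto
    ultimately have "\<forall>\<^sub>F N in sequentially. dist (cN N) c < e / 4 \<and> zeta_tail k N < e / 8"
      by eventually_elim auto
    then obtain N where N: "dist (cN N) c < e / 4" "zeta_tail k N < e / 8"
      using eventually_happens'[OF sequentially_bot] by blast
    have "\<forall>\<^sub>F R in at_top. dist (?C (EN N) R / (2 * R)) (cN N) < e / 4"
      using dens[of N] e unfolding has_density_def by (intro tendstoD) auto
    moreover have "((\<lambda>R. (1 + \<bar>of_int m\<bar> * zeta_tail k N) * inverse R) \<longlongrightarrow> 0) at_top"
      by (intro tendsto_mult_right_zero tendsto_inverse_0_at_top filterlim_ident)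
    then have "\<forall>\<^sub>F R in at_top. dist ((1 + \<bar>of_int m\<bar> * zeta_tail k N) * inverse R) 0 < e / 4"
      using e by (intro tendstoD) auto
    ultimately show "\<forall>\<^sub>F R in at_top. dist (?C ?E R / (2 * R)) c < e"
      using eventually_gt_at_top[of 0]
    proof eventually_elim
      case (elim R)
      then show ?case using gap[of R N] N unfolding dist_real_def by linarith
    qed
  qed
qed

text \<open>
  All factors lie between 0 and 1, so the partial products decrease.
\<close>

lemma euler_product_pair_factor:
  assumes k: "k \<ge> 2"
  obtains c where "euler_product_tends (pair_factor k m) c"
proof -
  have factor: "0 \<le> pair_factor k m p" "pair_factor k m p \<le> 1" if "prime p" for p
  proof -
    have "(if int p ^ k dvd m then 1 else 2) / real p ^ k \<le> 2 / 4"
      using prime_power_ge_4[OF that k] by (intro frac_le) auto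
    then show "0 \<le> pair_factor k m p" "pair_factor k m p \<le> 1" by (auto simp: pair_factor_def)
  qed
  let ?c = "\<lambda>N. \<Prod>p\<in>primes_le N. pair_factor k m p"
  have nonneg: "0 \<le> ?c N" for N
    by (intro prod_nonneg) (auto simp: primes_le_def factor)
  have "decseq ?c"
  proof (rule decseq_SucI)
    fix N
    have "?c (Suc N) = ?c N * (\<Prod>p\<in>primes_le (Suc N) - primes_le N. pair_factor k m p)"
      by (subst prod.subset_diff[of "primes_le N"]) (auto simp: primes_le_def[abs_def] mult.commute)
    also have "\<dots> \<le> ?c N * 1"
      by (intro mult_left_mono nonneg prod_le_1) (auto simp: primes_le_def factor)
    finally show "?c (Suc N) \<le> ?c N" by simp
  qed
  from decseq_convergent[OF this, of 0] nonneg obtain c where "?c \<longlonglongrightarrow> c" by blast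
  then show thesis using that by (simp add: euler_product_tends_def)
qed

definition pair_count :: "nat \<Rightarrow> real \<Rightarrow> int \<Rightarrow> nat" where
  "pair_count k R m = card {y. power_free k y \<and> power_free k (y + m) \<and> \<bar>of_int y\<bar> < R \<and> \<bar>of_int (y + m)\<bar> < R}"

text \<open>
  The condition \<open>\<bar>y + m\<bar> < R\<close> is a boundary effect: the count lies between the counts of all \<open>y\<close>
  in the windows of radius \<open>R - \<bar>m\<bar>\<close> and \<open>R\<close>, and these have the same asymptotics.
\<close>

lemma pair_count_tendsto:
  assumes "has_density {y. power_free k y \<and> power_free k (y + m)} c"
  shows "((\<lambda>R. pair_count k R m / (2 * R))
     \<longlongrightarrow> c) at_top"
proof -
  define a where "a = \<bar>real_of_int m\<bar>"
  let ?E = "{y. power_free k y \<and> power_free k (y + m)}"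
  let ?C = "\<lambda>R::real. real (card {y\<in>?E. \<bar>of_int y\<bar> < R})"
  have up: "((\<lambda>R. ?C R / (2 * R)) \<longlongrightarrow> c) at_top" using assms by (simp add: has_density_def)
  have "((\<lambda>R. ?C (R - a) / (2 * (R - a))) \<longlongrightarrow> c) at_top"
    by (rule filterlim_compose[OF up]) real_asymp
  moreover have "((\<lambda>R. 1 - a * inverse R) \<longlongrightarrow> 1 - a * 0) at_top"
    by (intro tendsto_intros tendsto_inverse_0_at_top filterlim_ident)
  ultimately have "((\<lambda>R. ?C (R - a) / (2 * (R - a)) * (1 - a * inverse R)) \<longlongrightarrow> c * (1 - a * 0)) at_top"
    by (rule tendsto_mult)
  moreover have "\<forall>\<^sub>F R in at_top. ?C (R - a) / (2 * (R - a)) * (1 - a * inverse R) = ?C (R - a) / (2 * R)"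
    using eventually_gt_at_top[of a] eventually_gt_at_top[of 0]
    by eventually_elim (simp add: field_simps)
  ultimately have low: "((\<lambda>R. ?C (R - a) / (2 * R)) \<longlongrightarrow> c) at_top"
    using Lim_transform_eventually by fastforce
  show ?thesis
  proof (rule tendsto_sandwich[OF _ _ low up])
    show "\<forall>\<^sub>F R in at_top. ?C (R - a) / (2 * R) \<le> pair_count k R m / (2 * R)"
      using eventually_gt_at_top[of 0]
    proof eventually_elim
      case (elim R)
      have "{y\<in>?E. \<bar>of_int y\<bar> < R - a} \<subseteq> {y. power_free k y \<and> power_free k (y + m) \<and> \<bar>of_int y\<bar> < R \<and> \<bar>of_int (y + m)\<bar> < R}"
        by (auto simp: a_def)
      then have "?C (R - a) \<le> pair_count k R m"
        unfolding pair_count_def by (intro of_nat_mono card_mono finite_subset[OF _ finite_abs_int_less[of R]]) auto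
      then show ?case using elim by (intro divide_right_mono) auto
    qed
    show "\<forall>\<^sub>F R in at_top. pair_count k R m / (2 * R) \<le> ?C R / (2 * R)"
      using eventually_gt_at_top[of 0]
    proof eventually_elim
      case (elim R)
      have "pair_count k R m \<le> card {y\<in>?E. \<bar>of_int y\<bar> < R}"
        unfolding pair_count_def by (intro card_mono) auto
      then show ?case using elim by (intro divide_right_mono of_nat_mono) auto
    qed
  qed
qed

section \<open>The weights of the two families of Dirac combs\<close>

text \<open>
  Up to the factor \<open>\<xi>(k)\<close>, this is the weight of the Dirac comb of \<open>d\<^sup>k \<int>\<close> in the autocorrelation,
  and \<open>comb_weight\<close> below is the weight of its dual \<open>\<int> / d\<^sup>k\<close> in the diffraction measure.
\<close>

definition corr_weight :: "nat \<Rightarrow> nat \<Rightarrow> real" where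
  "corr_weight k d = (\<Prod>p\<in>prime_factors d. 1 / (real p ^ k - 2))"

definition comb_weight :: "nat \<Rightarrow> nat \<Rightarrow> real" where
  "comb_weight k d = (\<Prod>p\<in>prime_factors d. 1 / (real p ^ (2 * k) - 2 * real p ^ k))"

lemma euler_product_tends_divide:
  assumes "euler_product_tends f L" "euler_product_tends g M" "M \<noteq> 0"
    and "\<And>p. prime p \<Longrightarrow> h p = f p / g p"
  shows "euler_product_tends h (L / M)"
proof -
  have "(\<lambda>N. (\<Prod>p\<in>primes_le N. f p) / (\<Prod>p\<in>primes_le N. g p)) \<longlonglongrightarrow> L / M"
    using assms(1-3) unfolding euler_product_tends_def by (intro tendsto_divide)
  moreover have "(\<Prod>p\<in>primes_le N. f p) / (\<Prod>p\<in>primes_le N. g p) = (\<Prod>p\<in>primes_le N. h p)" for N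
    unfolding prod_dividef[symmetric] by (intro prod.cong refl) (simp add: assms(4) primes_le_def)
  ultimately show ?thesis by (simp add: euler_product_tends_def)
qed

text \<open>
  Divided by the factor \<open>1 - 2 / p ^ k\<close> of \<open>\<xi>(k)\<close>, \<^const>\<open>pair_factor\<close> becomes
  \<open>1 + 1 / (p ^ k - 2)\<close> if \<open>p ^ k\<close> divides \<open>m\<close> and 1 otherwise. Multiplying out leaves the
  squarefree \<open>d\<close> all of whose prime factors satisfy this, that is, those with \<open>d ^ k dvd m\<close>.
\<close>

lemma pair_count_limit:
  assumes k: "k \<ge> 2" and X: "X > 0" "euler_product_tends (\<lambda>p. 1 - 2 / real p ^ k) X"
  obtains s where
    "((\<lambda>d. if int d ^ k dvd m then corr_weight k d else 0) has_sum s) {d. d \<ge> 1 \<and> squarefree d}"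
    "((\<lambda>R. pair_count k R m / (2 * R))
       \<longlongrightarrow> X * s) at_top"
proof -
  obtain c where c: "euler_product_tends (pair_factor k m) c"
    using euler_product_pair_factor[OF k] .
  define g where "g p = (if int p ^ k dvd m then 1 / (real p ^ k - 2) else 0)" for p
  have "euler_product_tends (\<lambda>p. g p + (if p \<in> {} then 0 else 1)) (c / X)"
  proof (rule euler_product_tends_divide[OF c X(2)])
    fix p :: nat assume p: "prime p"
    then show "g p + (if p \<in> {} then 0 else 1) = pair_factor k m p / (1 - 2 / real p ^ k)"
      using prime_power_ge_4[OF p k] by (auto simp: g_def pair_factor_def field_simps)
  qed (use X in simp)
  then have "((\<lambda>d. \<Prod>p\<in>prime_factors d. g p) has_sum c / X) {d. d \<ge> 1 \<and> squarefree d \<and> {} \<subseteq> prime_factors d}"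
  proof (rule squarefree_sum_eq_euler_product[rotated 3])
    show "0 \<le> g p" if "prime p" for p
      using prime_power_ge_4[OF that k] by (simp add: g_def)
  qed simp_all
  also have "{d::nat. d \<ge> 1 \<and> squarefree d \<and> {} \<subseteq> prime_factors d} = {d. d \<ge> 1 \<and> squarefree d}" by simp
  also have "((\<lambda>d. \<Prod>p\<in>prime_factors d. g p) has_sum c / X) {d. d \<ge> 1 \<and> squarefree d} \<longleftrightarrow>
      ((\<lambda>d. if int d ^ k dvd m then corr_weight k d else 0) has_sum c / X) {d. d \<ge> 1 \<and> squarefree d}"
  proof (rule has_sum_cong)
    fix d :: nat assume "d \<in> {d. d \<ge> 1 \<and> squarefree d}"
    then have d: "squarefree d" by simp
    show "(\<Prod>p\<in>prime_factors d. g p) = (if int d ^ k dvd m then corr_weight k d else 0)"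
    proof (cases "int d ^ k dvd m")
      case True
      then have "\<forall>p\<in>prime_factors d. int p ^ k dvd m" using prime_powers_dvd_iff[OF d] by blast
      with True show ?thesis by (simp add: g_def corr_weight_def)
    next
      case False
      then obtain p where "p \<in> prime_factors d" "\<not> int p ^ k dvd m"
        using prime_powers_dvd_iff[OF d] by blast
      with False show ?thesis by (auto simp: g_def intro!: prod_zero)
    qed
  qed
  finally show thesis
    using that[of "c / X"] pair_count_tendsto[OF power_free_pairs_has_density[OF k c]] X(1) by simp
qed

lemma comb_weight_nonneg:
  assumes "k \<ge> 2"
  shows "comb_weight k d \<ge> 0"
  unfolding comb_weight_def
proof (intro prod_nonneg)
  fix p assume "p \<in> prime_factors d"
  then have t: "real p ^ k \<ge> 4" using prime_power_ge_4[OF _ assms] by (simp add: in_prime_factors_imp_prime)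
  then have "real p ^ k * real p ^ k \<ge> 2 * real p ^ k" by (intro mult_right_mono) auto
  moreover have "real p ^ (2 * k) = real p ^ k * real p ^ k" unfolding mult_2 by (rule power_add)
  ultimately have "0 \<le> real p ^ (2 * k) - 2 * real p ^ k" by (simp only: diff_ge_0_iff_ge)
  then show "0 \<le> 1 / (real p ^ (2 * k) - 2 * real p ^ k)" by (rule divide_nonneg_nonneg[OF zero_le_one])
qed

lemma corr_weight_nonneg:
  assumes "k \<ge> 2"
  shows "corr_weight k d \<ge> 0"
  unfolding corr_weight_def
proof (intro prod_nonneg)
  fix p assume "p \<in> prime_factors d"
  then show "0 \<le> 1 / (real p ^ k - 2)"
    using prime_power_ge_4[OF in_prime_factors_imp_prime assms, of p d] by simp
qed

lemma comb_weight_eq: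
  assumes "squarefree d"
  shows "comb_weight k d * real d ^ k = corr_weight k d"
proof -
  have "real d ^ k = (\<Prod>p\<in>prime_factors d. real p ^ k)"
    by (subst prod_prime_factors_squarefree[OF assms, symmetric]) (simp add: prod_power_distrib)
  then have "comb_weight k d * real d ^ k
      = (\<Prod>p\<in>prime_factors d. 1 / (real p ^ (2 * k) - 2 * real p ^ k) * real p ^ k)"
    by (simp only: comb_weight_def prod.distrib)
  also have "\<dots> = corr_weight k d"
    unfolding corr_weight_def
  proof (rule prod.cong[OF refl])
    fix p assume "p \<in> prime_factors d"
    then have "real p ^ k \<noteq> 0" using prime_gt_0_nat[OF in_prime_factors_imp_prime, of p d] by simp
    moreover have "1 / ((t - 2) * t) * t = 1 / (t - 2)" if "t \<noteq> 0" for t :: real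
      using that by simp
    moreover have "real p ^ (2 * k) - 2 * real p ^ k = (real p ^ k - 2) * real p ^ k"
      by (simp only: mult_2[of k] power_add left_diff_distrib)
    ultimately show "1 / (real p ^ (2 * k) - 2 * real p ^ k) * real p ^ k = 1 / (real p ^ k - 2)"
      by (simp only:)
  qed
  finally show ?thesis .
qed

text \<open>
  With \<open>t = p ^ k\<close> and \<open>h = 1 / (t (t - 2))\<close>, a prime outside \<open>Q\<close> contributes
  \<open>1 + h = (1 - 1 / t)\<^sup>2 / (1 - 2 / t)\<close>, a factor of the Euler product of \<open>1 / (\<zeta>(k)\<^sup>2 \<xi>(k))\<close>.
  A prime in \<open>Q\<close> contributes \<open>h\<close>, and \<open>h / (1 + h) = 1 / (t - 1)\<^sup>2\<close>.
\<close>

lemma comb_weight_has_sum: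
  assumes k: "k \<ge> 2" and X: "X > 0" "euler_product_tends (\<lambda>p. 1 - 2 / real p ^ k) X"
    and Q: "finite Q" "\<And>p. p \<in> Q \<Longrightarrow> prime p"
  shows "(comb_weight k has_sum (1 / zeta_value k ^ 2 * (\<Prod>p\<in>Q. 1 / (real p ^ k - 1) ^ 2) / X))
    {d. d \<ge> 1 \<and> squarefree d \<and> Q \<subseteq> prime_factors d}"
proof -
  define h where "h p = 1 / (real p ^ (2 * k) - 2 * real p ^ k)" for p
  have h: "h p \<ge> 0" "h p / (h p + 1) = 1 / (real p ^ k - 1) ^ 2" "h p + 1 > 0"
    "h p + 1 = (1 - 1 / real p ^ k) ^ 2 / (1 - 2 / real p ^ k)" if "prime p" for p
  proof -
    define t where "t = real p ^ k"
    have t: "t \<ge> 4" using prime_power_ge_4[OF that k] by (simp add: t_def)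
    have "real p ^ (2 * k) = t * t" by (simp add: t_def mult_2 power_add)
    then have h_t: "h p = 1 / (t * (t - 2))"
      by (simp add: h_def t_def[symmetric] right_diff_distrib)
    have h1: "h p + 1 = (t - 1) ^ 2 / (t * (t - 2))"
      using t by (simp add: h_t field_simps power2_eq_square)
    show "h p \<ge> 0" "h p + 1 > 0" using t by (simp_all add: h_t h1 add_pos_nonneg)
    show "h p / (h p + 1) = 1 / (real p ^ k - 1) ^ 2"
      using t unfolding h1 unfolding h_t t_def[symmetric] by simp
    show "h p + 1 = (1 - 1 / real p ^ k) ^ 2 / (1 - 2 / real p ^ k)"
      using t unfolding h1 t_def[symmetric] by (simp add: field_simps power2_eq_square)
  qed
  have sq: "euler_product_tends (\<lambda>p. (1 - 1 / real p ^ k) ^ 2) ((1 / zeta_value k) ^ 2)"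
    using tendsto_power[OF euler_product_zeta[OF k, unfolded euler_product_tends_def], of 2]
    by (simp add: euler_product_tends_def prod_power_distrib)
  have full: "euler_product_tends (\<lambda>p. h p + 1) ((1 / zeta_value k) ^ 2 / X)"
    by (rule euler_product_tends_divide[OF sq X(2)]) (use X h in auto)
  have "(\<lambda>N. (\<Prod>p\<in>primes_le N. h p + 1) * (\<Prod>p\<in>Q. h p / (h p + 1)))
      \<longlonglongrightarrow> (1 / zeta_value k) ^ 2 / X * (\<Prod>p\<in>Q. h p / (h p + 1))"
    using full unfolding euler_product_tends_def by (intro tendsto_mult_right)
  moreover have "\<forall>\<^sub>F N in sequentially. (\<Prod>p\<in>primes_le N. h p + 1) * (\<Prod>p\<in>Q. h p / (h p + 1))
      = (\<Prod>p\<in>primes_le N. h p + (if p \<in> Q then 0 else 1))"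
  proof (rule eventually_mono[OF eventually_subset_primes_le])
    fix N assume sub: "Q \<subseteq> primes_le N"
    have "(\<Prod>p\<in>primes_le N. h p + (if p \<in> Q then 0 else 1)) =
       (\<Prod>p\<in>primes_le N - Q. h p + (if p \<in> Q then 0 else 1)) * (\<Prod>p\<in>Q. h p + (if p \<in> Q then 0 else 1))"
      using sub by (intro prod.subset_diff) auto
    also have "\<dots> = (\<Prod>p\<in>primes_le N - Q. h p + 1) * (\<Prod>p\<in>Q. h p)" by simp
    also have "(\<Prod>p\<in>Q. h p) = (\<Prod>p\<in>Q. h p + 1) * (\<Prod>p\<in>Q. h p / (h p + 1))"
      unfolding prod.distrib[symmetric]
    proof (rule prod.cong[OF refl])
      fix p assume "p \<in> Q"
      from h(3)[OF Q(2)[OF this]] show "h p = (h p + 1) * (h p / (h p + 1))" by simp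
    qed
    also have "(\<Prod>p\<in>primes_le N - Q. h p + 1) * ((\<Prod>p\<in>Q. h p + 1) * (\<Prod>p\<in>Q. h p / (h p + 1)))
       = (\<Prod>p\<in>primes_le N. h p + 1) * (\<Prod>p\<in>Q. h p / (h p + 1))"
      using sub by (subst prod.subset_diff[of Q "primes_le N"]) auto
    finally show "(\<Prod>p\<in>primes_le N. h p + 1) * (\<Prod>p\<in>Q. h p / (h p + 1))
      = (\<Prod>p\<in>primes_le N. h p + (if p \<in> Q then 0 else 1))" ..
  qed (use Q in auto)
  ultimately have "euler_product_tends (\<lambda>p. h p + (if p \<in> Q then 0 else 1))
      ((1 / zeta_value k) ^ 2 / X * (\<Prod>p\<in>Q. h p / (h p + 1)))"
    unfolding euler_product_tends_def by (rule Lim_transform_eventually)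
  from squarefree_sum_eq_euler_product[OF h(1) Q(1) Q(2) this]
  have "(comb_weight k has_sum ((1 / zeta_value k) ^ 2 / X * (\<Prod>p\<in>Q. h p / (h p + 1))))
      {d. d \<ge> 1 \<and> squarefree d \<and> Q \<subseteq> prime_factors d}"
    by (simp add: comb_weight_def[abs_def] h_def)
  moreover have "(1 / zeta_value k) ^ 2 / X * (\<Prod>p\<in>Q. h p / (h p + 1))
      = 1 / zeta_value k ^ 2 * (\<Prod>p\<in>Q. 1 / (real p ^ k - 1) ^ 2) / X"
    using h(2) Q(2) by (simp add: power_divide)
  ultimately show ?thesis by simp
qed

section \<open>Lattice sums and weak* limits\<close>

lemma limitin_weak_starI:
  assumes "L \<in> tempered" "\<forall>\<^sub>F i in F. T i \<in> tempered"
    and "\<And>\<psi>. \<psi> \<in> Schwartz \<Longrightarrow> ((\<lambda>i. T i \<psi>) \<longlongrightarrow> L \<psi>) F"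
  shows "limitin weak_star T L F"
proof -
  have "\<forall>\<^sub>F i in F. T i \<in> topspace (product_topology (\<lambda>_. euclidean) Schwartz)"
    using assms(2) by eventually_elim (simp add: tempered_def PiE_def)
  moreover have "L \<in> extensional Schwartz" using assms(1) by (simp add: tempered_def)
  ultimately show ?thesis
    using assms by (simp add: weak_star_def limitin_subtopology limitin_componentwise)
qed

lemma infsum_complex_of_real:
  "f summable_on A \<Longrightarrow> (\<Sum>\<^sub>\<infinity>x\<in>A. complex_of_real (f x)) = of_real (\<Sum>\<^sub>\<infinity>x\<in>A. f x)"
  by (intro infsumI has_sum_of_real has_sum_infsum)

definition decay_integral :: real where
  "decay_integral = (LINT x|lborel. inverse (1 + x\<^sup>2))"

lemma summable_on_lattice_decay:
  fixes N :: real
  assumes "N \<ge> 1"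
  shows "(\<lambda>n::int. inverse (1 + (of_int n / N)\<^sup>2)) summable_on UNIV"
  using sum_int_decay_le[OF _ assms]
  by (intro nonneg_bdd_above_summable_on)
     (auto simp: bdd_above_def intro!: exI[of _ "3 * N * (LINT x|lborel. inverse (1 + x\<^sup>2))"])

lemma infsum_lattice_decay_le:
  fixes N :: real
  assumes "N \<ge> 1"
  shows "(\<Sum>\<^sub>\<infinity>n::int. inverse (1 + (of_int n / N)\<^sup>2)) \<le> 3 * decay_integral * N"
proof (rule has_sum_le_finite_sums[OF has_sum_infsum[OF summable_on_lattice_decay[OF assms]]])
  fix F :: "int set" assume "finite F"
  from sum_int_decay_le[OF this assms]
  show "(\<Sum>n\<in>F. inverse (1 + (of_int n / N)\<^sup>2)) \<le> 3 * decay_integral * N"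
    by (simp add: decay_integral_def mult_ac)
qed

definition lattice_sum :: "real \<Rightarrow> (real \<Rightarrow> complex) \<Rightarrow> complex" where
  "lattice_sum N f = (\<Sum>\<^sub>\<infinity>n::int. f (of_int n / N))"

lemma Schwartz_lattice_abs_summable:
  assumes "f \<in> Schwartz" "N \<ge> 1"
  shows "(\<lambda>n::int. norm (f (of_int n / N))) summable_on UNIV"
  by (rule summable_on_comparison_test[OF summable_on_cmult_right[OF summable_on_lattice_decay[OF assms(2)], of "decay_norm f"]])
     (simp_all add: Schwartz_decay assms)

lemma Schwartz_lattice_summable:
  assumes "f \<in> Schwartz" "N \<ge> 1"
  shows "(\<lambda>n::int. f (of_int n / N)) summable_on UNIV"
  by (rule abs_summable_summable[OF Schwartz_lattice_abs_summable[OF assms]])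

lemma norm_lattice_sum_le:
  assumes "f \<in> Schwartz" "N \<ge> 1"
  shows "(\<Sum>\<^sub>\<infinity>n::int. norm (f (of_int n / N))) \<le> 3 * decay_integral * N * decay_norm f"
proof -
  have "(\<Sum>\<^sub>\<infinity>n::int. norm (f (of_int n / N))) \<le> (\<Sum>\<^sub>\<infinity>n::int. decay_norm f * inverse (1 + (of_int n / N)\<^sup>2))"
    using assms by (intro infsum_mono Schwartz_lattice_abs_summable Schwartz_decay
      summable_on_cmult_right summable_on_lattice_decay)
  also have "\<dots> = decay_norm f * (\<Sum>\<^sub>\<infinity>n::int. inverse (1 + (of_int n / N)\<^sup>2))"
    by (rule infsum_cmult_right) (simp add: summable_on_lattice_decay assms)
  also have "\<dots> \<le> decay_norm f * (3 * decay_integral * N)"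
    by (intro mult_left_mono infsum_lattice_decay_le decay_norm_nonneg assms)
  finally show ?thesis by (simp add: mult_ac)
qed

lemma lattice_sum_add:
  assumes "f \<in> Schwartz" "g \<in> Schwartz" "N \<ge> 1"
  shows "lattice_sum N (\<lambda>x. f x + g x) = lattice_sum N f + lattice_sum N g"
  unfolding lattice_sum_def by (intro infsum_add Schwartz_lattice_summable assms)

lemma lattice_sum_scale:
  assumes "f \<in> Schwartz" "N \<ge> 1"
  shows "lattice_sum N (\<lambda>x. c * f x) = c * lattice_sum N f"
  unfolding lattice_sum_def by (intro infsum_cmult_right Schwartz_lattice_summable assms)

lemma norm_lattice_sum:
  assumes "f \<in> Schwartz" "N \<ge> 1"
  shows "norm (lattice_sum N f) \<le> 3 * decay_integral * N * decay_norm f"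
  unfolding lattice_sum_def
  by (rule order_trans[OF norm_infsum_bound norm_lattice_sum_le]) (intro Schwartz_lattice_abs_summable assms)+

lemma dirac_comb_scaled_integers:
  assumes "d \<ge> 1" "f \<in> Schwartz"
  shows "dirac_comb (scaled_integers d k) f = lattice_sum (real d ^ k) f"
proof -
  have "scaled_integers d k = (\<lambda>m::int. of_int m / real d ^ k) ` UNIV"
    by (auto simp: scaled_integers_def)
  moreover have "inj (\<lambda>m::int. of_int m / real d ^ k)"
    using assms(1) by (auto simp: inj_on_def)
  ultimately show ?thesis
    using assms(2) by (simp add: dirac_comb_def lattice_sum_def infsum_reindex o_def)
qed

text \<open>
  Poisson summation for the multiples of \<open>N\<close>, as a sum over all integers, so that for different
  \<open>N\<close> the sums can be added under one summation sign.
\<close>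

lemma lattice_sum_fourier_sublattice:
  assumes "f \<in> Schwartz" "N \<ge> 1"
  shows "((\<lambda>m::int. if int N dvd m then fourier f (of_int m) else 0) has_sum (1 / of_nat N * lattice_sum (real N) f)) UNIV"
proof -
  have F: "fourier f \<in> Schwartz" by (rule fourier_Schwartz[OF assms(1)])
  have resc: "(\<lambda>x. fourier f (real N * x)) \<in> Schwartz"
    using assms(2) by (intro Schwartz_rescale F) simp
  have "((\<lambda>j::int. fourier f (real N * of_int j)) has_sum (\<Sum>\<^sub>\<infinity>j::int. fourier f (real N * of_int j))) UNIV"
    by (rule has_sum_infsum[OF abs_summable_summable[OF Schwartz_abs_summable_int[OF resc]]])
  also have "(\<Sum>\<^sub>\<infinity>j::int. fourier f (real N * of_int j)) = 1 / of_nat N * lattice_sum (real N) f"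
    using poisson_summation_lattice[OF assms(1), of "real N"] assms(2) by (simp add: lattice_sum_def)
  also have "((\<lambda>j::int. fourier f (real N * of_int j)) has_sum (1 / of_nat N * lattice_sum (real N) f)) UNIV \<longleftrightarrow>
      ((\<lambda>m::int. fourier f (of_int m)) has_sum (1 / of_nat N * lattice_sum (real N) f)) (range (\<lambda>j. int N * j))"
    using assms(2) by (subst has_sum_reindex) (auto simp: o_def inj_on_def)
  also have "\<dots> \<longleftrightarrow> ?thesis"
    by (rule has_sum_cong_neutral) auto
  finally show ?thesis .
qed

lemma power_free_denominator:
  assumes "squarefree (d::nat)" "d \<ge> 1" "q dvd d ^ k" "k \<ge> 1"
  shows "power_free (k + 1) (int q)"
proof (subst power_free_iff_prime)
  have q: "q \<noteq> 0" using assms by (metis dvd_0_left_iff not_one_le_zero power_not_zero)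
  have "\<not> int p ^ (k + 1) dvd int q" if p: "prime p" for p :: nat
  proof
    assume "int p ^ (k + 1) dvd int q"
    then have "p ^ (k + 1) dvd q" by (metis int_dvd_int_iff of_nat_power)
    then have "p ^ (k + 1) dvd d ^ k" using assms(3) by (rule dvd_trans)
    then have "k + 1 \<le> multiplicity p (d ^ k)"
      using p assms(2) by (intro multiplicity_geI) auto
    also have "\<dots> = k * multiplicity p d"
      using p assms(2) by (simp add: prime_elem_multiplicity_power_distrib)
    also have "\<dots> \<le> k * 1"
      using assms(1,2) p by (intro mult_left_mono) (auto simp: squarefree_factorial_semiring'')
    finally show False by simp
  qed
  with q show "int q \<noteq> 0 \<and> (\<forall>p. prime p \<longrightarrow> \<not> int p ^ (k + 1) dvd int q)" by simp
qed simp

section \<open>The diffraction measure\<close>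

text \<open>
  The limit \<open>X\<close> of the partial Euler products is \<open>\<xi>(k)\<close>.
\<close>

locale power_free_diffraction =
  fixes k :: nat and X :: real
  assumes k: "k \<ge> 2" and X: "X > 0" "euler_product_tends (\<lambda>p. 1 - 2 / real p ^ k) X"
begin

definition SF :: "nat set" where "SF = {d. d \<ge> 1 \<and> squarefree d}"

lemma SF_power_ge_1: "d \<in> SF \<Longrightarrow> real d ^ k \<ge> 1"
  by (simp add: SF_def)

lemma corr_weight_summable: "corr_weight k summable_on SF"
proof -
  obtain s where "((\<lambda>d. if int d ^ k dvd 0 then corr_weight k d else 0) has_sum s) {d. d \<ge> 1 \<and> squarefree d}"
    using pair_count_limit[OF k X, of 0] .
  then show ?thesis by (auto simp: SF_def summable_on_def)
qed

definition I :: "(nat \<times> int) set" where "I = SF \<times> UNIV"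

definition point :: "nat \<times> int \<Rightarrow> real" where
  "point = (\<lambda>(d, m). of_int m / real d ^ k)"

definition mass :: "nat \<times> int \<Rightarrow> real" where
  "mass = (\<lambda>(d, m). X * comb_weight k d)"

text \<open>
  The atoms are listed with repetitions, one for each comb and each of its points, so that integrals
  are sums over pairs. Taking the image under \<^const>\<open>point\<close> adds up the masses of equal points.
\<close>

definition \<mu> :: "real measure" where
  "\<mu> = distr (density (count_space I) (\<lambda>i. ennreal (mass i))) borel point"

lemma mass_nonneg: "mass i \<ge> 0"
  using X(1) comb_weight_nonneg[OF k] by (auto simp: mass_def split: prod.splits)

lemma sets_\<mu> [measurable_cong]: "sets \<mu> = sets borel" by (simp add: \<mu>_def)

lemma space_\<mu> [simp]: "space \<mu> = UNIV" by (simp add: \<mu>_def)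

text \<open>
  The points of the comb for \<open>d\<close> contribute at most a multiple of \<open>comb_weight k d * d ^ k\<close>, which
  is \<open>corr_weight k d\<close> and therefore summable.
\<close>

lemma mass_decay_summable: "(\<lambda>i. mass i * inverse (1 + (point i)\<^sup>2)) summable_on I"
  unfolding I_def
proof (rule summable_on_SigmaI)
  fix d assume d: "d \<in> SF"
  show "((\<lambda>m. mass (d, m) * inverse (1 + (point (d, m))\<^sup>2)) has_sum
      (X * comb_weight k d * (\<Sum>\<^sub>\<infinity>m::int. inverse (1 + (of_int m / real d ^ k)\<^sup>2)))) UNIV"
    unfolding mass_def point_def prod.case
    by (intro has_sum_cmult_right has_sum_infsum summable_on_lattice_decay SF_power_ge_1 d)
next
  show "(\<lambda>d. X * comb_weight k d * (\<Sum>\<^sub>\<infinity>m::int. inverse (1 + (of_int m / real d ^ k)\<^sup>2))) summable_on SF"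
  proof (rule summable_on_comparison_test)
    show "(\<lambda>d. X * (3 * decay_integral) * corr_weight k d) summable_on SF"
      by (intro summable_on_cmult_right corr_weight_summable)
    fix d assume d: "d \<in> SF"
    have "X * comb_weight k d * (\<Sum>\<^sub>\<infinity>m::int. inverse (1 + (of_int m / real d ^ k)\<^sup>2))
        \<le> X * comb_weight k d * (3 * decay_integral * real d ^ k)"
      using X(1) comb_weight_nonneg[OF k]
      by (intro mult_left_mono infsum_lattice_decay_le SF_power_ge_1 d) auto
    also have "\<dots> = X * (3 * decay_integral) * (comb_weight k d * real d ^ k)" by simp
    also have "comb_weight k d * real d ^ k = corr_weight k d"
      using d by (intro comb_weight_eq) (simp add: SF_def)
    finally show "X * comb_weight k d * (\<Sum>\<^sub>\<infinity>m::int. inverse (1 + (of_int m / real d ^ k)\<^sup>2))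
        \<le> X * (3 * decay_integral) * corr_weight k d" .
    show "0 \<le> X * comb_weight k d * (\<Sum>\<^sub>\<infinity>m::int. inverse (1 + (of_int m / real d ^ k)\<^sup>2))"
      using X(1) comb_weight_nonneg[OF k] by (intro mult_nonneg_nonneg infsum_nonneg) auto
  qed
qed (simp add: mass_nonneg)

context
  fixes f :: "real \<Rightarrow> complex" and C :: real
  assumes meas: "f \<in> borel_measurable borel" and decay: "\<And>x. norm (f x) \<le> C * inverse (1 + x\<^sup>2)"
begin

lemma decay_abs_summable: "(\<lambda>i. norm (mass i *\<^sub>R f (point i))) summable_on I"
proof (rule summable_on_comparison_test)
  show "(\<lambda>i. C * (mass i * inverse (1 + (point i)\<^sup>2))) summable_on I"
    by (intro summable_on_cmult_right mass_decay_summable)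
  fix i
  have "mass i * norm (f (point i)) \<le> mass i * (C * inverse (1 + (point i)\<^sup>2))"
    by (intro mult_left_mono decay mass_nonneg)
  then show "norm (mass i *\<^sub>R f (point i)) \<le> C * (mass i * inverse (1 + (point i)\<^sup>2))"
    using mass_nonneg[of i] by (simp add: mult_ac)
qed simp

lemma decay_count_integrable: "integrable (count_space I) (\<lambda>i. mass i *\<^sub>R f (point i))"
  using decay_abs_summable unfolding abs_summable_equivalent Infinite_Set_Sum.abs_summable_on_def .

lemma decay_integrable: "integrable \<mu> f"
  unfolding \<mu>_def
  using meas decay_count_integrable
  by (subst integrable_distr_eq, simp, simp, subst integrable_density) (auto simp: mass_nonneg)

lemma decay_lebesgue_integral: "(LINT x|\<mu>. f x) = (\<Sum>\<^sub>\<infinity>i\<in>I. mass i *\<^sub>R f (point i))"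
proof -
  have "(LINT x|\<mu>. f x) = (LINT i|density (count_space I) (\<lambda>i. ennreal (mass i)). f (point i))"
    unfolding \<mu>_def using meas by (intro integral_distr) auto
  also have "\<dots> = (LINT i|count_space I. mass i *\<^sub>R f (point i))"
    by (rule integral_density) (auto simp: mass_nonneg)
  also have "\<dots> = infsetsum (\<lambda>i. mass i *\<^sub>R f (point i)) I"
    by (simp add: infsetsum_def)
  also have "\<dots> = (\<Sum>\<^sub>\<infinity>i\<in>I. mass i *\<^sub>R f (point i))"
    using decay_count_integrable
    by (intro infsetsum_infsum) (simp add: Infinite_Set_Sum.abs_summable_on_def)
  finally show ?thesis .
qed

end

lemma AE_point: "(\<And>i. i \<in> I \<Longrightarrow> P (point i)) \<Longrightarrow> {x. P x} \<in> sets borel \<Longrightarrow> AE x in \<mu>. P x"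
  unfolding \<mu>_def by (subst AE_distr_iff) (auto simp: AE_density AE_count_space)

lemma countable_points: "countable (point ` I)"
  by (intro countable_image) (auto simp: I_def)

lemma sets_countable: "countable A \<Longrightarrow> A \<in> sets (borel :: real measure)"
  by (rule sets.countable) auto

text \<open>
  The countable set of all points of the combs has full measure.
\<close>

theorem pure_point_\<mu>: "pure_point \<mu>"
  unfolding pure_point_def
proof
  fix A assume "A \<in> sets \<mu>"
  then have A: "A \<in> sets borel" by (simp add: sets_\<mu>)
  let ?C = "point ` I"
  have C: "?C \<in> sets borel" by (intro sets_countable countable_points)
  have ae: "AE x in \<mu>. x \<in> ?C" using C by (intro AE_point) auto
  have zero: "emeasure \<mu> {x} = 0" if "x \<notin> ?C" for x
  proof -
    have "emeasure \<mu> {x} = emeasure \<mu> {}"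
      by (rule emeasure_eq_AE) (use ae that in \<open>auto elim: eventually_mono simp: sets_\<mu>\<close>)
    then show ?thesis by simp
  qed
  have "emeasure \<mu> A = emeasure \<mu> (A \<inter> ?C)"
    by (rule emeasure_eq_AE) (use ae A C in \<open>auto elim: eventually_mono simp: sets_\<mu>\<close>)
  also have "\<dots> = (\<integral>\<^sup>+x. emeasure \<mu> {x} \<partial>count_space (A \<inter> ?C))"
    by (rule emeasure_countable_singleton) (auto simp: sets_\<mu> intro: countable_points countable_subset)
  also have "\<dots> = (\<integral>\<^sup>+x. emeasure \<mu> {x} \<partial>count_space A)"
    using zero by (intro nn_integral_count_space_eq) auto
  finally show "emeasure \<mu> A = (\<integral>\<^sup>+x. emeasure \<mu> {x} \<partial>count_space A)" .
qed

lemma emeasure_compact_finite: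
  assumes "compact K"
  shows "emeasure \<mu> K < \<infinity>"
proof -
  have K: "K \<in> sets borel" using assms by (intro borel_closed compact_imp_closed)
  obtain B where B: "B > 0" "\<And>x. x \<in> K \<Longrightarrow> \<bar>x\<bar> \<le> B"
    using compact_imp_bounded[OF assms] unfolding bounded_pos by auto
  have "integrable \<mu> (\<lambda>x. complex_of_real (indicator K x))"
  proof (rule decay_integrable)
    show "(\<lambda>x. complex_of_real (indicator K x)) \<in> borel_measurable borel" using K by measurable
    show "norm (complex_of_real (indicator K x)) \<le> (1 + B\<^sup>2) * inverse (1 + x\<^sup>2)" for x
    proof (cases "x \<in> K")
      case True
      then have "x\<^sup>2 \<le> B\<^sup>2" using B by (simp add: abs_le_square_iff[symmetric])
      with True show ?thesis by (simp add: field_simps add_pos_nonneg)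
    qed simp
  qed
  then have "integrable \<mu> (indicator K :: real \<Rightarrow> real)"
    by (simp add: complex_of_real_integrable_eq)
  then show ?thesis by (simp add: integrable_indicator_iff)
qed

lemma measure_dist_bound:
  assumes f: "f \<in> Schwartz"
  shows "norm (LINT x|\<mu>. f x) \<le> (\<Sum>\<^sub>\<infinity>i\<in>I. mass i * inverse (1 + (point i)\<^sup>2)) * decay_norm f"
proof -
  note fm = Schwartz_measurable[OF f] Schwartz_decay[OF f]
  have "norm (LINT x|\<mu>. f x) \<le> (\<Sum>\<^sub>\<infinity>i\<in>I. norm (mass i *\<^sub>R f (point i)))"
    unfolding decay_lebesgue_integral[OF fm] by (intro norm_infsum_bound decay_abs_summable[OF fm])
  also have "\<dots> \<le> (\<Sum>\<^sub>\<infinity>i\<in>I. decay_norm f * (mass i * inverse (1 + (point i)\<^sup>2)))"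
  proof (rule infsum_mono)
    fix i
    have "mass i * norm (f (point i)) \<le> mass i * (decay_norm f * inverse (1 + (point i)\<^sup>2))"
      by (intro mult_left_mono fm(2) mass_nonneg)
    then show "norm (mass i *\<^sub>R f (point i)) \<le> decay_norm f * (mass i * inverse (1 + (point i)\<^sup>2))"
      using mass_nonneg[of i] by (simp add: mult_ac)
  qed (intro decay_abs_summable[OF fm] summable_on_cmult_right mass_decay_summable)+
  also have "\<dots> = decay_norm f * (\<Sum>\<^sub>\<infinity>i\<in>I. mass i * inverse (1 + (point i)\<^sup>2))"
    by (rule infsum_cmult_right) (simp add: mass_decay_summable)
  finally show ?thesis by (simp add: mult.commute)
qed

lemma Schwartz_integrable_\<mu>: "f \<in> Schwartz \<Longrightarrow> integrable \<mu> f"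
  by (rule decay_integrable[OF Schwartz_measurable Schwartz_decay])

lemma measure_dist_tempered: "measure_dist \<mu> \<in> tempered"
  unfolding measure_dist_def
proof (rule temperedI)
  fix f assume "f \<in> Schwartz"
  then show "norm (LINT x|\<mu>. f x) \<le> (\<Sum>\<^sub>\<infinity>i\<in>I. mass i * inverse (1 + (point i)\<^sup>2)) * decay_norm f"
    by (rule measure_dist_bound)
qed (simp_all add: Schwartz_integrable_\<mu>)

theorem tempered_measure_\<mu>: "tempered_measure \<mu>"
  unfolding tempered_measure_def
  using sets_\<mu> emeasure_compact_finite Schwartz_integrable_\<mu> measure_dist_tempered by blast

theorem measure_dist_has_sum:
  assumes f: "f \<in> Schwartz"
  shows "((\<lambda>d. of_real (X * comb_weight k d) * lattice_sum (real d ^ k) f) has_sum (LINT x|\<mu>. f x)) SF"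
proof -
  note fm = Schwartz_measurable[OF f] Schwartz_decay[OF f]
  have "((\<lambda>i. mass i *\<^sub>R f (point i)) has_sum (LINT x|\<mu>. f x)) (SF \<times> UNIV)"
    unfolding decay_lebesgue_integral[OF fm] I_def[symmetric]
    by (rule has_sum_infsum[OF abs_summable_summable[OF decay_abs_summable[OF fm]]])
  then show ?thesis
  proof (rule has_sum_SigmaD)
    fix d assume d: "d \<in> SF"
    show "((\<lambda>m. mass (d, m) *\<^sub>R f (point (d, m))) has_sum of_real (X * comb_weight k d) * lattice_sum (real d ^ k) f) UNIV"
      unfolding mass_def point_def prod.case scaleR_conv_of_real lattice_sum_def
      by (intro has_sum_cmult_right has_sum_infsum Schwartz_lattice_summable f SF_power_ge_1 d)
  qed
qed

lemma supported_on_power_free_denominators: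
  "AE x in \<mu>. \<exists>(a::int) (q::nat). q \<ge> 1 \<and> coprime a (int q) \<and> power_free (k + 1) (int q) \<and> x = of_int a / of_nat q"
proof (rule AE_point)
  fix i assume "i \<in> I"
  then obtain d m where i: "i = (d, m)" and d: "d \<in> SF" by (auto simp: I_def)
  define g where "g = gcd m (int (d ^ k))"
  have dk: "d ^ k \<ge> 1" using d by (simp add: SF_def)
  then have dk0: "int (d ^ k) \<noteq> 0" by linarith
  then have g: "g > 0" unfolding g_def gcd_pos_int by blast
  define a where "a = m div g"
  define q where "q = nat (int (d ^ k) div g)"
  have ag: "m = a * g" by (simp add: a_def g_def)
  have qg: "int (d ^ k) = int q * g"
    using g by (simp add: q_def g_def pos_imp_zdiv_nonneg_iff del: of_nat_power)
  have q1: "q \<ge> 1"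
  proof (rule ccontr)
    assume "\<not> q \<ge> 1"
    then have "int (d ^ k) = 0" unfolding qg by simp
    with dk show False by linarith
  qed
  have "coprime a (int q)"
  proof -
    have "coprime (m div g) (int (d ^ k) div g)"
      unfolding g_def using dk0 by (intro div_gcd_coprime) blast
    then show ?thesis using qg g by (simp add: a_def)
  qed
  moreover have "power_free (k + 1) (int q)"
  proof (rule power_free_denominator)
    have "int q dvd int (d ^ k)" using qg by simp
    then show "q dvd d ^ k" by (simp only: int_dvd_int_iff)
  qed (use d k in \<open>auto simp: SF_def\<close>)
  moreover have "point i = of_int a / of_nat q"
  proof -
    have "real d ^ k = of_int (int (d ^ k))" by simp
    also have "\<dots> = real q * of_int g" unfolding qg by simp
    finally show ?thesis using g by (simp add: i point_def ag)
  qed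
  ultimately show "\<exists>(a::int) (q::nat). q \<ge> 1 \<and> coprime a (int q) \<and> power_free (k + 1) (int q) \<and> point i = of_int a / of_nat q"
    using q1 by blast
next
  have "{x. \<exists>(a::int) (q::nat). q \<ge> 1 \<and> coprime a (int q) \<and> power_free (k + 1) (int q) \<and> x = of_int a / of_nat q}
     \<subseteq> (\<lambda>(a::int, q::nat). real_of_int a / real q) ` UNIV" by auto
  then have "countable {x. \<exists>(a::int) (q::nat). q \<ge> 1 \<and> coprime a (int q) \<and> power_free (k + 1) (int q) \<and> x = real_of_int a / of_nat q}"
    by (rule countable_subset) simp
  then show "{x. \<exists>(a::int) (q::nat). q \<ge> 1 \<and> coprime a (int q) \<and> power_free (k + 1) (int q) \<and> x = real_of_int a / of_nat q} \<in> sets borel"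
    by (rule sets_countable)
qed

text \<open>
  Since \<open>a / q\<close> is in lowest terms, \<open>m / d ^ k = a / q\<close> forces \<open>q dvd d ^ k\<close> and determines
  \<open>m = a * (d ^ k div q)\<close>. So the atoms at \<open>a / q\<close> correspond to the squarefree \<open>d\<close> that are
  divisible by all prime factors of \<open>q\<close>.
\<close>

theorem intensity:
  fixes a :: int and q :: nat
  assumes q: "q \<ge> 1" "coprime a (int q)" "power_free (k + 1) (int q)"
  shows "measure \<mu> {of_int a / of_nat q} = 1 / zeta_value k ^ 2 * (\<Prod>p\<in>prime_factors q. 1 / (real p ^ k - 1) ^ 2)"
proof -
  let ?x = "real_of_int a / real q"
  define S where "S = {d. d \<ge> 1 \<and> squarefree d \<and> prime_factors q \<subseteq> prime_factors d}"
  define j where "j d = (d, a * int (d ^ k div q))" for d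
  have fm: "(\<lambda>x. complex_of_real (indicator {?x} x)) \<in> borel_measurable borel"
    "\<And>x. norm (complex_of_real (indicator {?x} x)) \<le> (1 + ?x\<^sup>2) * inverse (1 + x\<^sup>2)"
    by (auto simp: indicator_def field_simps add_pos_nonneg)
  have J: "{i \<in> I. point i = ?x} = j ` S"
  proof (rule equalityI; rule subsetI)
    fix i assume "i \<in> {i \<in> I. point i = ?x}"
    then obtain d m where i: "i = (d, m)" and d: "d \<ge> 1" "squarefree d" and eq: "of_int m / real d ^ k = ?x"
      by (auto simp: I_def SF_def point_def)
    have "real_of_int (m * int q) = real_of_int (a * int (d ^ k))"
      using eq d q by (simp add: field_simps)
    then have cross: "m * int q = a * int (d ^ k)" by (simp only: of_int_eq_iff)
    then have "int q dvd a * int (d ^ k)" by (metis dvd_triv_right)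
    then have "int q dvd int (d ^ k)" using q(2) by (simp add: coprime_dvd_mult_right_iff coprime_commute)
    then have qd: "q dvd d ^ k" by (simp only: int_dvd_int_iff)
    then have "d \<in> S" using d k q by (simp add: S_def dvd_power_squarefree_iff)
    moreover have "m = a * int (d ^ k div q)"
    proof -
      have "d ^ k = (d ^ k div q) * q" using qd by simp
      then have "m * int q = a * int (d ^ k div q) * int q" using cross by (metis mult.assoc of_nat_mult)
      then show ?thesis using q by simp
    qed
    ultimately show "i \<in> j ` S" by (auto simp: i j_def)
  next
    fix i assume "i \<in> j ` S"
    then obtain d where d: "d \<ge> 1" "squarefree d" "prime_factors q \<subseteq> prime_factors d" and i: "i = j d"
      by (auto simp: S_def)
    have "q dvd d ^ k" using d k q by (simp add: dvd_power_squarefree_iff)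
    then have "d ^ k = (d ^ k div q) * q" by simp
    then have "real d ^ k = real (d ^ k div q) * real q" by (metis of_nat_mult of_nat_power)
    moreover have "real d ^ k \<noteq> 0" using d by simp
    ultimately have "point i = ?x" by (simp add: i j_def point_def field_simps)
    then show "i \<in> {i \<in> I. point i = ?x}" using d by (simp add: i j_def I_def SF_def)
  qed
  have inj: "inj_on j S" by (auto simp: inj_on_def j_def)
  have S_sum: "((\<lambda>d. X * comb_weight k d) has_sum
      X * (1 / zeta_value k ^ 2 * (\<Prod>p\<in>prime_factors q. 1 / (real p ^ k - 1) ^ 2) / X)) S"
    unfolding S_def by (intro has_sum_cmult_right comb_weight_has_sum[OF k X]) auto
  have "complex_of_real (measure \<mu> {?x}) = (LINT x|\<mu>. complex_of_real (indicator {?x} x))"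
    by (simp add: sets_\<mu>)
  also have "\<dots> = (\<Sum>\<^sub>\<infinity>i\<in>I. mass i *\<^sub>R complex_of_real (indicator {?x} (point i)))"
    by (rule decay_lebesgue_integral[OF fm])
  also have "\<dots> = (\<Sum>\<^sub>\<infinity>i\<in>j ` S. complex_of_real (mass i))"
    unfolding J[symmetric] by (rule infsum_cong_neutral) (auto simp: scaleR_conv_of_real)
  also have "\<dots> = (\<Sum>\<^sub>\<infinity>d\<in>S. complex_of_real (X * comb_weight k d))"
    unfolding infsum_reindex[OF inj] by (simp add: o_def j_def mass_def)
  also have "\<dots> = complex_of_real (\<Sum>\<^sub>\<infinity>d\<in>S. X * comb_weight k d)"
    by (rule infsum_complex_of_real[OF has_sum_imp_summable[OF S_sum]])
  finally have "measure \<mu> {?x} = (\<Sum>\<^sub>\<infinity>d\<in>S. X * comb_weight k d)"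
    by (simp only: of_real_eq_iff)
  also have "\<dots> = X * (1 / zeta_value k ^ 2 * (\<Prod>p\<in>prime_factors q. 1 / (real p ^ k - 1) ^ 2) / X)"
    by (rule infsumI[OF S_sum])
  finally show ?thesis using X(1) by simp
qed

section \<open>The representation by Dirac combs\<close>

definition comb_sum :: functional where
  "comb_sum = (\<lambda>\<psi>\<in>Schwartz. of_real (1 / X) * (LINT x|\<mu>. \<psi> x))"

lemma complex_comb_weight:
  "(\<Prod>p\<in>prime_factors d. 1 / (of_nat p ^ (2 * k) - 2 * of_nat p ^ k)) = complex_of_real (comb_weight k d)"
  by (simp add: comb_weight_def)

lemma has_weak_star_sum_comb_sum:
  "has_weak_star_sum
     (\<lambda>d::nat. scale_dist (\<Prod>p\<in>prime_factors d. 1 / (of_nat p ^ (2 * k) - 2 * of_nat p ^ k))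
        (dirac_comb (scaled_integers d k)))
     {d. d \<ge> 1 \<and> squarefree d} comb_sum"
  unfolding has_weak_star_sum_def complex_comb_weight SF_def[symmetric]
proof (rule limitin_weak_starI)
  let ?T = "\<lambda>d. scale_dist (complex_of_real (comb_weight k d)) (dirac_comb (scaled_integers d k))"
  have T: "?T d \<psi> = of_real (comb_weight k d) * lattice_sum (real d ^ k) \<psi>" if "d \<in> SF" "\<psi> \<in> Schwartz" for d \<psi>
    using that by (simp add: scale_dist_def dirac_comb_scaled_integers SF_def)
  show "comb_sum \<in> tempered"
    unfolding comb_sum_def
  proof (rule temperedI)
    fix f assume f: "f \<in> Schwartz"
    have "norm (of_real (1 / X) * (LINT x|\<mu>. f x)) = 1 / X * norm (LINT x|\<mu>. f x)"
      using X(1) by (simp add: norm_mult norm_divide)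
    also have "\<dots> \<le> 1 / X * ((\<Sum>\<^sub>\<infinity>i\<in>I. mass i * inverse (1 + (point i)\<^sup>2)) * decay_norm f)"
      using X(1) by (intro mult_left_mono measure_dist_bound f) auto
    finally show "norm (of_real (1 / X) * (LINT x|\<mu>. f x))
        \<le> (1 / X * (\<Sum>\<^sub>\<infinity>i\<in>I. mass i * inverse (1 + (point i)\<^sup>2))) * decay_norm f"
      by (simp only: mult.assoc)
  qed (simp_all add: Schwartz_integrable_\<mu> distrib_left)
  show "\<forall>\<^sub>F D in finite_subsets_at_top SF. (\<lambda>\<psi>\<in>Schwartz. \<Sum>i\<in>D. ?T i \<psi>) \<in> tempered"
  proof (rule eventually_finite_subsets_at_top_weakI)
    fix D assume D: "finite D" "D \<subseteq> SF"
    have ge1: "real d ^ k \<ge> 1" if "d \<in> D" for d using that D SF_power_ge_1 by blast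
    have eq: "(\<Sum>i\<in>D. ?T i \<psi>) = (\<Sum>d\<in>D. of_real (comb_weight k d) * lattice_sum (real d ^ k) \<psi>)"
      if "\<psi> \<in> Schwartz" for \<psi>
      using D that by (intro sum.cong) (auto simp: T)
    show "(\<lambda>\<psi>\<in>Schwartz. \<Sum>i\<in>D. ?T i \<psi>) \<in> tempered"
    proof (rule temperedI)
      fix f g assume fg: "f \<in> Schwartz" "g \<in> Schwartz"
      show "(\<Sum>i\<in>D. ?T i (\<lambda>x. f x + g x)) = (\<Sum>i\<in>D. ?T i f) + (\<Sum>i\<in>D. ?T i g)"
        unfolding eq[OF fg(1)] eq[OF fg(2)] eq[OF Schwartz_add[OF fg]] sum.distrib[symmetric]
        by (intro sum.cong refl) (simp add: lattice_sum_add fg ge1 distrib_left)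
    next
      fix c f assume f: "f \<in> Schwartz"
      show "(\<Sum>i\<in>D. ?T i (\<lambda>x. c * f x)) = c * (\<Sum>i\<in>D. ?T i f)"
        unfolding eq[OF f] eq[OF Schwartz_mult_left[OF f]] sum_distrib_left
        by (intro sum.cong refl) (simp add: lattice_sum_scale f ge1)
    next
      fix f assume f: "f \<in> Schwartz"
      have "norm (\<Sum>i\<in>D. ?T i f) \<le> (\<Sum>d\<in>D. comb_weight k d * (3 * decay_integral * real d ^ k * decay_norm f))"
        unfolding eq[OF f]
      proof (rule sum_norm_le)
        fix d assume "d \<in> D"
        then have "comb_weight k d * norm (lattice_sum (real d ^ k) f)
            \<le> comb_weight k d * (3 * decay_integral * real d ^ k * decay_norm f)"
          by (intro mult_left_mono norm_lattice_sum f ge1 comb_weight_nonneg[OF k])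
        then show "norm (of_real (comb_weight k d) * lattice_sum (real d ^ k) f)
            \<le> comb_weight k d * (3 * decay_integral * real d ^ k * decay_norm f)"
          using comb_weight_nonneg[OF k, of d] by (simp add: norm_mult)
      qed
      also have "\<dots> = (\<Sum>d\<in>D. comb_weight k d * (3 * decay_integral * real d ^ k)) * decay_norm f"
        by (simp add: sum_distrib_right mult.assoc)
      finally show "norm (\<Sum>i\<in>D. ?T i f) \<le> (\<Sum>d\<in>D. comb_weight k d * (3 * decay_integral * real d ^ k)) * decay_norm f" .
    qed
  qed
  fix \<psi> assume \<psi>: "\<psi> \<in> Schwartz"
  have "((\<lambda>d. of_real (1 / X) * (of_real (X * comb_weight k d) * lattice_sum (real d ^ k) \<psi>)) has_sum
      of_real (1 / X) * (LINT x|\<mu>. \<psi> x)) SF"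
    by (intro has_sum_cmult_right measure_dist_has_sum \<psi>)
  also have "of_real (1 / X) * (LINT x|\<mu>. \<psi> x) = comb_sum \<psi>"
    using \<psi> by (simp add: comb_sum_def)
  also have "((\<lambda>d. of_real (1 / X) * (of_real (X * comb_weight k d) * lattice_sum (real d ^ k) \<psi>)) has_sum
      comb_sum \<psi>) SF \<longleftrightarrow> ((\<lambda>d. ?T d \<psi>) has_sum comb_sum \<psi>) SF"
    using \<psi> X(1) by (intro has_sum_cong) (simp add: T)
  finally have "((\<lambda>D. \<Sum>d\<in>D. ?T d \<psi>) \<longlongrightarrow> comb_sum \<psi>) (finite_subsets_at_top SF)"
    by (simp add: has_sum_def)
  then show "((\<lambda>D. (\<lambda>\<psi>\<in>Schwartz. \<Sum>i\<in>D. ?T i \<psi>) \<psi>) \<longlongrightarrow> comb_sum \<psi>) (finite_subsets_at_top SF)"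
    using \<psi> by simp
qed

lemma measure_dist_eq_comb_sum: "measure_dist \<mu> = scale_dist (of_real X) comb_sum"
  using X(1) by (auto simp: measure_dist_def scale_dist_def comb_sum_def)

section \<open>The autocorrelation and its Fourier transform\<close>

definition correlation :: "int \<Rightarrow> real" where
  "correlation m = X * (\<Sum>\<^sub>\<infinity>d\<in>SF. if int d ^ k dvd m then corr_weight k d else 0)"

lemma correlation_summable: "(\<lambda>d. if int d ^ k dvd m then corr_weight k d else 0) summable_on SF"
  by (rule summable_on_comparison_test[OF corr_weight_summable]) (auto simp: corr_weight_nonneg[OF k])

lemma pair_count_tendsto_correlation: "((\<lambda>R. pair_count k R m / (2 * R)) \<longlongrightarrow> correlation m) at_top"
proof -
  obtain s where s: "((\<lambda>d. if int d ^ k dvd m then corr_weight k d else 0) has_sum s) {d. d \<ge> 1 \<and> squarefree d}"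
    "((\<lambda>R. pair_count k R m / (2 * R))
       \<longlongrightarrow> X * s) at_top"
    using pair_count_limit[OF k X, of m] .
  then show ?thesis by (simp add: correlation_def SF_def infsumI)
qed

definition correlation_bound :: real where
  "correlation_bound = X * (\<Sum>\<^sub>\<infinity>d\<in>SF. corr_weight k d)"

lemma correlation_bounds: "0 \<le> correlation m" "correlation m \<le> correlation_bound"
proof -
  show "0 \<le> correlation m"
    unfolding correlation_def using X(1) corr_weight_nonneg[OF k]
    by (intro mult_nonneg_nonneg infsum_nonneg) auto
  show "correlation m \<le> correlation_bound"
    unfolding correlation_def correlation_bound_def using X(1) corr_weight_nonneg[OF k]
    by (intro mult_left_mono infsum_mono correlation_summable corr_weight_summable) auto
qed

definition \<gamma> :: functional where
  "\<gamma> = (\<lambda>\<psi>\<in>Schwartz. \<Sum>\<^sub>\<infinity>m::int. of_real (correlation m) * \<psi> (of_int m))"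

lemma correlation_abs_summable:
  assumes "f \<in> Schwartz"
  shows "(\<lambda>m::int. norm (of_real (correlation m) * f (of_int m))) summable_on UNIV"
proof (rule summable_on_comparison_test[OF summable_on_cmult_right[OF Schwartz_abs_summable_int[OF assms], of correlation_bound]])
  show "norm (of_real (correlation m) * f (of_int m)) \<le> correlation_bound * norm (f (of_int m))" for m
    using correlation_bounds[of m] by (simp add: norm_mult mult_right_mono)
qed simp

lemma \<gamma>_tempered: "\<gamma> \<in> tempered"
  unfolding \<gamma>_def
proof (rule temperedI)
  note sm = abs_summable_summable[OF correlation_abs_summable]
  fix f assume f: "f \<in> Schwartz"
  show "(\<Sum>\<^sub>\<infinity>m::int. of_real (correlation m) * (f (of_int m) + g (of_int m))) =
      (\<Sum>\<^sub>\<infinity>m::int. of_real (correlation m) * f (of_int m)) + (\<Sum>\<^sub>\<infinity>m::int. of_real (correlation m) * g (of_int m))"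
    if "g \<in> Schwartz" for g
    unfolding distrib_left by (intro infsum_add sm f that)
  show "(\<Sum>\<^sub>\<infinity>m::int. of_real (correlation m) * (c * f (of_int m))) =
      c * (\<Sum>\<^sub>\<infinity>m::int. of_real (correlation m) * f (of_int m))" for c
    unfolding mult.left_commute[of _ c] by (intro infsum_cmult_right sm f)
  have "norm (\<Sum>\<^sub>\<infinity>m::int. of_real (correlation m) * f (of_int m)) \<le>
      (\<Sum>\<^sub>\<infinity>m::int. norm (of_real (correlation m) * f (of_int m)))"
    by (intro norm_infsum_bound correlation_abs_summable f)
  also have "\<dots> \<le> (\<Sum>\<^sub>\<infinity>m::int. correlation_bound * norm (f (of_int m)))"
    using correlation_bounds
    by (intro infsum_mono correlation_abs_summable summable_on_cmult_right Schwartz_abs_summable_int f)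
       (simp add: norm_mult mult_right_mono)
  also have "\<dots> = correlation_bound * (\<Sum>\<^sub>\<infinity>m::int. norm (f (of_int m)))"
    by (rule infsum_cmult_right) (simp add: Schwartz_abs_summable_int f)
  also have "\<dots> \<le> correlation_bound * (3 * decay_integral * 1 * decay_norm f)"
    using norm_lattice_sum_le[OF f, of 1] order_trans[OF correlation_bounds]
    by (intro mult_left_mono) auto
  finally show "norm (\<Sum>\<^sub>\<infinity>m::int. of_real (correlation m) * f (of_int m))
      \<le> (correlation_bound * (3 * decay_integral)) * decay_norm f" by (simp add: mult.assoc)
qed

lemma double_sum_eq_pair_count:
  fixes \<psi> :: "real \<Rightarrow> complex"
  defines "A R \<equiv> {x\<in>power_free_points k. \<bar>x\<bar> < R}"
  shows "(\<Sum>x\<in>A R. \<Sum>y\<in>A R. \<psi> (x - y)) = (\<Sum>\<^sub>\<infinity>m::int. of_nat (pair_count k R m) * \<psi> (of_int m))"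
proof -
  let ?B = "{y. power_free k y \<and> \<bar>real_of_int y\<bar> < R}"
  have A: "A R = real_of_int ` ?B" by (auto simp: A_def power_free_points_def)
  have fin: "finite ?B" by simp
  have inj: "inj_on real_of_int S" for S by (auto simp: inj_on_def)
  let ?M = "(\<lambda>(a, b). a - b) ` (?B \<times> ?B)"
  have count: "card {z\<in>?B \<times> ?B. (case z of (a, b) \<Rightarrow> a - b) = m} = pair_count k R m" for m
    unfolding pair_count_def
  proof (rule bij_betw_same_card[of snd])
    show "bij_betw snd {z\<in>?B \<times> ?B. (case z of (a, b) \<Rightarrow> a - b) = m}
       {y. power_free k y \<and> power_free k (y + m) \<and> \<bar>real_of_int y\<bar> < R \<and> \<bar>real_of_int (y + m)\<bar> < R}"
      by (rule bij_betw_byWitness[where f' = "\<lambda>y. (y + m, y)"]) auto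
  qed
  have "(\<Sum>x\<in>A R. \<Sum>y\<in>A R. \<psi> (x - y)) = (\<Sum>a\<in>?B. \<Sum>b\<in>?B. \<psi> (real_of_int a - real_of_int b))"
    unfolding A by (simp add: sum.reindex[OF inj])
  also have "\<dots> = (\<Sum>z\<in>?B \<times> ?B. (\<lambda>m. \<psi> (of_int m)) (case z of (a, b) \<Rightarrow> a - b))"
    by (simp add: sum.cartesian_product case_prod_beta)
  also have "\<dots> = (\<Sum>m\<in>?M. of_nat (card {z\<in>?B \<times> ?B. (case z of (a, b) \<Rightarrow> a - b) = m}) * \<psi> (of_int m))"
    by (rule sum_fun_comp) (use fin in auto)
  also have "\<dots> = (\<Sum>m\<in>?M. of_nat (pair_count k R m) * \<psi> (of_int m))" by (simp only: count)
  also have "\<dots> = (\<Sum>\<^sub>\<infinity>m\<in>?M. of_nat (pair_count k R m) * \<psi> (of_int m))"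
    using fin by (simp add: infsum_finite)
  also have "\<dots> = (\<Sum>\<^sub>\<infinity>m::int. of_nat (pair_count k R m) * \<psi> (of_int m))"
  proof (rule infsum_cong_neutral)
    fix m assume "m \<in> UNIV - ?M"
    then have "{z\<in>?B \<times> ?B. (case z of (a, b) \<Rightarrow> a - b) = m} = {}" by blast
    then have "pair_count k R m = 0" unfolding count[symmetric] by (simp only: card.empty)
    then show "of_nat (pair_count k R m) * \<psi> (of_int m) = 0" by simp
  qed auto
  finally show ?thesis .
qed

lemma pair_count_le:
  assumes "R \<ge> 1"
  shows "real (pair_count k R m) / (2 * R) \<le> 2"
proof -
  have "pair_count k R m \<le> card {- \<lceil>R\<rceil><..<\<lceil>R\<rceil>}"
    unfolding pair_count_def by (intro card_mono) (auto, linarith+)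
  also have "\<dots> \<le> nat (2 * \<lceil>R\<rceil>)" by simp
  finally have "real (pair_count k R m) \<le> real (nat (2 * \<lceil>R\<rceil>))" by (rule of_nat_mono)
  also have "\<dots> \<le> 4 * R" using assms by linarith
  finally show ?thesis using assms by (simp add: field_simps)
qed

text \<open>
  Grouped by the difference \<open>m\<close>, the approximants are sums over all integers of the normalized pair
  counts times \<open>\<psi> m\<close>. These are dominated by \<open>2 \<bar>\<psi> m\<bar>\<close> as soon as \<open>R \<ge> 1\<close>, and the pair
  counts converge for each \<open>m\<close>.
\<close>

theorem is_autocorrelation_\<gamma>: "is_autocorrelation (power_free_points k) \<gamma>"
  unfolding is_autocorrelation_def
proof (rule limitin_weak_starI[OF \<gamma>_tempered])
  let ?A = "\<lambda>R. {x\<in>power_free_points k. \<bar>x\<bar> < R}"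
  let ?T = "\<lambda>R::real. \<lambda>\<psi>::real \<Rightarrow> complex. of_real (1 / (2 * R)) * (\<Sum>x\<in>?A R. \<Sum>y\<in>?A R. \<psi> (x - y))"
  show "\<forall>\<^sub>F R in at_top. (\<lambda>\<psi>\<in>Schwartz. ?T R \<psi>) \<in> tempered"
  proof (intro always_eventually allI)
    fix R :: real
    show "(\<lambda>\<psi>\<in>Schwartz. ?T R \<psi>) \<in> tempered"
    proof (rule temperedI)
      fix f assume f: "f \<in> Schwartz"
      show "?T R (\<lambda>x. f x + g x) = ?T R f + ?T R g" for g
        by (simp only: sum.distrib distrib_left)
      show "?T R (\<lambda>x. c * f x) = c * ?T R f" for c
        by (simp only: sum_distrib_left[symmetric] mult.left_commute)
      have "norm (\<Sum>x\<in>?A R. \<Sum>y\<in>?A R. f (x - y)) \<le> (\<Sum>x\<in>?A R. \<Sum>y\<in>?A R. decay_norm f)"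
      proof (intro sum_norm_le)
        fix x y
        have "norm (f (x - y)) \<le> decay_norm f * inverse (1 + (x - y)\<^sup>2)" by (rule Schwartz_decay[OF f])
        also have "\<dots> \<le> decay_norm f * 1"
          by (intro mult_left_mono decay_norm_nonneg f) (simp add: field_simps add_pos_nonneg)
        finally show "norm (f (x - y)) \<le> decay_norm f" by simp
      qed
      also have "\<dots> = real (card (?A R)) * real (card (?A R)) * decay_norm f" by simp
      finally have "\<bar>1 / (2 * R)\<bar> * norm (\<Sum>x\<in>?A R. \<Sum>y\<in>?A R. f (x - y))
          \<le> \<bar>1 / (2 * R)\<bar> * (real (card (?A R)) * real (card (?A R)) * decay_norm f)"
        by (intro mult_left_mono) auto
      then show "norm (?T R f) \<le> (\<bar>1 / (2 * R)\<bar> * (real (card (?A R)) * real (card (?A R)))) * decay_norm f"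
        by (simp only: norm_mult norm_of_real mult.assoc)
    qed
  qed
  fix \<psi> assume \<psi>: "\<psi> \<in> Schwartz"
  let ?s = "\<lambda>R (m::int). complex_of_real (pair_count k R m / (2 * R)) * \<psi> (of_int m)"
  let ?N = "count_space (UNIV :: int set)"
  have int: "integrable ?N (\<lambda>m. \<psi> (of_int m))" "integrable ?N (\<lambda>m. of_real (correlation m) * \<psi> (of_int m))"
    using Schwartz_abs_summable_int[OF \<psi>] correlation_abs_summable[OF \<psi>]
    unfolding abs_summable_equivalent Infinite_Set_Sum.abs_summable_on_def .
  have bound: "norm (?s R m) \<le> 2 * norm (\<psi> (of_int m))" if "R \<ge> 1" for R m
  proof -
    have "norm (?s R m) = real (pair_count k R m) / (2 * R) * norm (\<psi> (of_int m))"
      using that by (simp add: norm_mult norm_divide)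
    also have "\<dots> \<le> 2 * norm (\<psi> (of_int m))"
      by (intro mult_right_mono pair_count_le that) simp
    finally show ?thesis .
  qed
  have lim: "((\<lambda>R. LINT m|?N. ?s R m) \<longlongrightarrow> (LINT m|?N. of_real (correlation m) * \<psi> (of_int m))) at_top"
  proof (rule integral_dominated_convergence_at_top)
    show "integrable ?N (\<lambda>m. 2 * norm (\<psi> (of_int m)))"
      by (intro integrable_mult_right integrable_norm int)
    show "\<forall>\<^sub>F R in at_top. AE m in ?N. norm (?s R m) \<le> 2 * norm (\<psi> (of_int m))"
      using eventually_ge_at_top[of 1] by eventually_elim (use bound in \<open>simp add: AE_count_space\<close>)
    show "AE m in ?N. ((\<lambda>R. ?s R m) \<longlongrightarrow> of_real (correlation m) * \<psi> (of_int m)) at_top"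
      unfolding AE_count_space
      by (intro ballI tendsto_mult_right tendsto_of_real pair_count_tendsto_correlation)
  qed simp_all
  have LINT_eq: "(LINT m|?N. f m) = (\<Sum>\<^sub>\<infinity>m. f m)" if "integrable ?N f" for f :: "int \<Rightarrow> complex"
    using infsetsum_infsum[of f UNIV] that by (simp add: infsetsum_def Infinite_Set_Sum.abs_summable_on_def)
  have ev: "\<forall>\<^sub>F R in at_top. (LINT m|?N. ?s R m) = (\<lambda>\<psi>\<in>Schwartz. ?T R \<psi>) \<psi>"
    using eventually_ge_at_top[of 1]
  proof eventually_elim
    case (elim R)
    have "integrable ?N (?s R)"
    proof (rule Bochner_Integration.integrable_bound)
      show "integrable ?N (\<lambda>m. 2 * norm (\<psi> (of_int m)))"
        by (intro integrable_mult_right integrable_norm int)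
    qed (use bound[OF elim] in \<open>simp_all add: AE_count_space\<close>)
    then have "(LINT m|?N. ?s R m) = (\<Sum>\<^sub>\<infinity>m. ?s R m)" by (rule LINT_eq)
    also have "\<dots> = (\<Sum>\<^sub>\<infinity>m. of_real (1 / (2 * R)) * (of_nat (pair_count k R m) * \<psi> (of_int m)))"
      by (intro infsum_cong) (simp add: field_simps)
    also have "\<dots> = of_real (1 / (2 * R)) * (\<Sum>\<^sub>\<infinity>m. of_nat (pair_count k R m) * \<psi> (of_int m))"
      by (rule infsum_cmult_right')
    also have "\<dots> = ?T R \<psi>" by (simp only: double_sum_eq_pair_count)
    finally show ?case using \<psi> by simp
  qed
  have "\<gamma> \<psi> = (LINT m|?N. of_real (correlation m) * \<psi> (of_int m))"
    using \<psi> by (simp add: \<gamma>_def LINT_eq[OF int(2)])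
  with Lim_transform_eventually[OF lim ev]
  show "((\<lambda>R. (\<lambda>\<psi>\<in>Schwartz. ?T R \<psi>) \<psi>) \<longlongrightarrow> \<gamma> \<psi>) at_top" by simp
qed

text \<open>
  The coefficient at \<open>m\<close> is a sum over the \<open>d\<close> with \<open>d ^ k dvd m\<close>. Once the two summations are
  exchanged, the inner one runs over the multiples of \<open>d ^ k\<close>, and Poisson summation turns it into
  the sum over \<open>\<int> / d ^ k\<close>.
\<close>

theorem fourier_\<gamma>: "fourier_dist \<gamma> = measure_dist \<mu>"
  unfolding fourier_dist_def measure_dist_def
proof (rule restrict_ext)
  fix \<psi> assume \<psi>: "\<psi> \<in> Schwartz"
  have F: "fourier \<psi> \<in> Schwartz" by (rule fourier_Schwartz[OF \<psi>])
  define t where "t = (\<lambda>d (m::int). if int d ^ k dvd m then of_real (X * corr_weight k d) * fourier \<psi> (of_int m) else 0)"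
  have wn: "X * corr_weight k d \<ge> 0" for d using X(1) corr_weight_nonneg[OF k] by simp
  have abs: "(\<lambda>z. norm (case z of (d, m) \<Rightarrow> t d m)) summable_on SF \<times> UNIV"
  proof (rule summable_on_comparison_test)
    show "(\<lambda>(d, m). (X * corr_weight k d) * norm (fourier \<psi> (of_int m))) summable_on SF \<times> (UNIV :: int set)"
    proof (rule summable_on_SigmaI)
      show "((\<lambda>m. case (d, m) of (d, m) \<Rightarrow> (X * corr_weight k d) * norm (fourier \<psi> (of_int m))) has_sum
         (X * corr_weight k d) * (\<Sum>\<^sub>\<infinity>m::int. norm (fourier \<psi> (of_int m)))) UNIV" for d
        unfolding prod.case by (intro has_sum_cmult_right has_sum_infsum Schwartz_abs_summable_int F)
      show "(\<lambda>d. (X * corr_weight k d) * (\<Sum>\<^sub>\<infinity>m::int. norm (fourier \<psi> (of_int m)))) summable_on SF"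
        by (intro summable_on_cmult_left summable_on_cmult_right corr_weight_summable)
    qed (use wn in auto)
    show "norm (case z of (d, m) \<Rightarrow> t d m) \<le> (case z of (d, m) \<Rightarrow> (X * corr_weight k d) * norm (fourier \<psi> (of_int m)))" for z
      using wn by (auto simp: t_def norm_mult simp del: of_real_mult split: prod.splits)
  qed simp
  have sum: "(\<lambda>(d, m). t d m) summable_on SF \<times> UNIV" by (rule abs_summable_summable[OF abs])
  have inner_m: "(\<Sum>\<^sub>\<infinity>m. t d m) = of_real (X * comb_weight k d) * lattice_sum (real d ^ k) \<psi>" if d: "d \<in> SF" for d
  proof -
    have dk: "d ^ k \<ge> 1" using d by (simp add: SF_def)
    have "((\<lambda>m. of_real (X * corr_weight k d) * (if int (d ^ k) dvd m then fourier \<psi> (of_int m) else 0)) has_sum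
        of_real (X * corr_weight k d) * (1 / of_nat (d ^ k) * lattice_sum (real (d ^ k)) \<psi>)) UNIV"
      using dk by (intro has_sum_cmult_right lattice_sum_fourier_sublattice \<psi>) simp
    moreover have "(\<lambda>m. of_real (X * corr_weight k d) * (if int (d ^ k) dvd m then fourier \<psi> (of_int m) else 0)) = t d"
      by (auto simp: t_def)
    ultimately have "(\<Sum>\<^sub>\<infinity>m. t d m) = of_real (X * corr_weight k d) * (1 / of_nat (d ^ k) * lattice_sum (real (d ^ k)) \<psi>)"
      by (simp only: infsumI)
    also have "corr_weight k d = comb_weight k d * real d ^ k"
      using d by (intro comb_weight_eq[symmetric]) (simp add: SF_def)
    finally show ?thesis using d by (simp add: SF_def)
  qed
  have inner_d: "(\<Sum>\<^sub>\<infinity>d\<in>SF. t d m) = of_real (correlation m) * fourier \<psi> (of_int m)" for m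
  proof -
    have "(\<Sum>\<^sub>\<infinity>d\<in>SF. t d m) = (\<Sum>\<^sub>\<infinity>d\<in>SF. of_real (X * (if int d ^ k dvd m then corr_weight k d else 0)) * fourier \<psi> (of_int m))"
      by (intro infsum_cong) (simp add: t_def)
    also have "\<dots> = (\<Sum>\<^sub>\<infinity>d\<in>SF. complex_of_real (X * (if int d ^ k dvd m then corr_weight k d else 0))) * fourier \<psi> (of_int m)"
      by (rule infsum_cmult_left')
    also have "(\<Sum>\<^sub>\<infinity>d\<in>SF. complex_of_real (X * (if int d ^ k dvd m then corr_weight k d else 0))) = of_real (correlation m)"
      unfolding correlation_def
    by (subst infsum_complex_of_real) (simp_all add: infsum_cmult_right' summable_on_cmult_right correlation_summable)
    finally show ?thesis .
  qed
  have "\<gamma> (fourier \<psi>) = (\<Sum>\<^sub>\<infinity>m. \<Sum>\<^sub>\<infinity>d\<in>SF. t d m)"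
    using F by (simp add: \<gamma>_def inner_d)
  also have "\<dots> = (\<Sum>\<^sub>\<infinity>d\<in>SF. \<Sum>\<^sub>\<infinity>m. t d m)"
    by (rule infsum_swap_banach[OF sum, symmetric])
  also have "\<dots> = (\<Sum>\<^sub>\<infinity>d\<in>SF. of_real (X * comb_weight k d) * lattice_sum (real d ^ k) \<psi>)"
    by (intro infsum_cong inner_m)
  also have "\<dots> = (LINT x|\<mu>. \<psi> x)"
    by (rule infsumI[OF measure_dist_has_sum[OF \<psi>]])
  finally show "\<gamma> (fourier \<psi>) = (LINT x|\<mu>. \<psi> x)" .
qed

lemma is_diffraction_spectrum_\<mu>: "is_diffraction_spectrum (power_free_points k) \<mu>"
  unfolding is_diffraction_spectrum_def
  using tempered_measure_\<mu> is_autocorrelation_\<gamma> fourier_\<gamma> by blast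

end

theorem theorem5:
  fixes k :: nat
  assumes "k \<ge> 2"
  shows "\<exists>\<mu>. is_diffraction_spectrum (power_free_points k) \<mu> \<and>
    pure_point \<mu> \<and>
    (AE x in \<mu>. \<exists>(a::int) (q::nat). q \<ge> 1 \<and> coprime a (int q) \<and>
       power_free (k + 1) (int q) \<and> x = of_int a / of_nat q) \<and>
    (\<forall>(a::int) (q::nat). q \<ge> 1 \<and> coprime a (int q) \<and> power_free (k + 1) (int q) \<longrightarrow>
       complex_of_real (measure \<mu> {of_int a / of_nat q}) =
         1 / zeta (of_nat k) ^ 2 * (\<Prod>p\<in>prime_factors q. 1 / (of_nat p ^ k - 1) ^ 2)) \<and>
    (\<exists>T. has_weak_star_sum
           (\<lambda>d::nat. scale_dist
              (\<Prod>p\<in>prime_factors d. 1 / (of_nat p ^ (2 * k) - 2 * of_nat p ^ k))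
              (dirac_comb (scaled_integers d k)))
           {d. d \<ge> 1 \<and> squarefree d} T \<and>
         measure_dist \<mu> = scale_dist (xi (of_nat k)) T)"
proof -
  obtain X where xi: "X > 0" "xi (of_nat k) = of_real X" "euler_product_tends (\<lambda>p. 1 - 2 / real p ^ k) X"
    using xi_of_nat[OF assms] .
  interpret power_free_diffraction k X
    by unfold_locales (fact assms xi)+
  have int: "complex_of_real (measure \<mu> {of_int a / of_nat q}) =
      1 / zeta (of_nat k) ^ 2 * (\<Prod>p\<in>prime_factors q. 1 / (of_nat p ^ k - 1) ^ 2)"
    if "q \<ge> 1 \<and> coprime a (int q) \<and> power_free (k + 1) (int q)" for a :: int and q :: nat
    using intensity[of q a] that by (simp add: zeta_of_nat[OF assms])
  show ?thesis
    unfolding xi(2)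
  proof (intro exI[of _ \<mu>] exI[of _ comb_sum] conjI allI impI)
  qed (fact is_diffraction_spectrum_\<mu> pure_point_\<mu> supported_on_power_free_denominators
      int has_weak_star_sum_comb_sum measure_dist_eq_comb_sum | rule int)+
qed

end
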